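(* Let $N\ge1$, let $B\in\mathbb{R}^{N\times 2N}$ be well-posed (see context), let $\alpha_k\in L_\infty[a,b]$ ($0\le k\le N$) and $\beta_{ij}\in L_\infty[a,b]$ ($0\le j\le i\le N-1$), so that $\{B,[\alpha,\beta]\}$ defines a quadratic PDE, and let $\{\mathcal{T},[\mathcal{A},\mathcal{B}]\}$ be the associated PI operators. Suppose that there exist $\epsilon,\delta>0$ and $\mathcal{P}=\mathcal{P}^*\in\Pi_3$ such that $$\mathcal{P}\succeq\epsilon I,\qquad \mathcal{A}^*\mathcal{P}\mathcal{T}+\mathcal{T}^*\mathcal{P}\mathcal{A}\preceq-\delta\,\mathcal{T}^*\mathcal{T},\qquad \mathcal{K}_{\text{lin}}[\mathcal{T}^*\mathcal{P}\mathcal{B}]=0.$$ Let $\mu=\|\mathcal{P}\|$ be the operator norm of $\mathcal{P}$ on $L_2[a,b]$. Then any (classical) solution $\mathbf{u}(t)$ to the PDE defined by $\{B,[\alpha,\beta]\}$ satisfies, for all $t\ge0$, $$\|\mathbf{u}(t)\|_{L_2}^2\le\frac{\mu}{\epsilon}\,\|\mathbf{u}(0)\|_{L_2}^2\,e^{-\frac{\delta}{\mu}t}.$$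
   Context: All functions are real-valued; $[a,b]$ is a compact interval, $a<b$. $H_N[a,b]$ is the Sobolev space of $\mathbf{u}\in L_2[a,b]$ with $\partial_s^k\mathbf{u}\in L_2[a,b]$ for all $k\le N$. Inner products, adjoints ($^*$) and orderings are with respect to $L_2$: $\mathcal{S}_1\preceq\mathcal{S}_2$ means $\langle\mathbf{v},\mathcal{S}_1\mathbf{v}\rangle_{L_2}\le\langle\mathbf{v},\mathcal{S}_2\mathbf{v}\rangle_{L_2}$ for all $\mathbf{v}\in L_2[a,b]$. Boundary conditions: $$X_B:=\Big\{\mathbf{u}\in H_N[a,b] : B\,\big(\mathbf{u}(a),\dots,\partial_s^{N-1}\mathbf{u}(a),\mathbf{u}(b),\dots,\partial_s^{N-1}\mathbf{u}(b)\big)^T=0\Big\}.$$ $B$ is well-posed if the only polynomial in $s$ of degree at most $N-1$ in $X_B$ is zero; equivalently, $\partial_s^N:X_B\to L_2[a,b]$ is a bijection. PDE: a classical solution to the quadratic PDE defined by $\{B,[\alpha,\beta]\}$ with initial state $\mathbf{u}_0\in X_B$ is a map $\mathbf{u}$ on $[0,\infty)$ with $\mathbf{u}(t)\in X_B$ for all $t\ge 0$, $\mathbf{u}(0)=\mathbf{u}_0$, (Fréchet) differentiable in $t$ as an $L_2[a,b]$-valued map, and such that for all $t\ge0$ (and almost every $s\in[a,b]$) $$\partial_t\mathbf{u}(t,s)=\sum_{i=0}^N\alpha_i(s)\partial_s^i\mathbf{u}(t,s)+\sum_{i=0}^{N-1}\sum_{j=0}^i\beta_{ij}(s)\,\partial_s^i\mathbf{u}(t,s)\,\partial_s^j\mathbf{u}(t,s).$$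 PI operators: $\Pi_3$ is the set of operators on $L_2[a,b]$ of the form $(\mathcal{R}\mathbf{v})(s)=R_0(s)\mathbf{v}(s)+\int_a^sR_1(s,\theta)\mathbf{v}(\theta)d\theta+\int_s^bR_2(s,\theta)\mathbf{v}(\theta)d\theta$ with $R_0\in L_\infty[a,b]$, $R_1,R_2\in L_2[[a,b]^2]$; $\Pi_2$ is the subset with $R_0=0$. $\Pi_{2^2}$ is the set of operators $\mathcal{P}[Q]:L_2[[a,b]^2]\to L_2[a,b]$, $Q=[Q_1,Q_2,Q_3]$ with $Q_i\in L_2[[a,b]^3]$, $$(\mathcal{P}[Q]\mathbf{w})(s)=\int_a^s\!\int_a^\theta Q_1(s,\theta,\eta)\mathbf{w}(\theta,\eta)d\eta d\theta+\int_s^b\!\int_a^s Q_2(s,\theta,\eta)\mathbf{w}(\theta,\eta)d\eta d\theta+\int_s^b\!\int_s^\theta Q_3(s,\theta,\eta)\mathbf{w}(\theta,\eta)d\eta d\theta.$$ For $\mathcal{S},\mathcal{R}\in\Pi_2$ with kernels $S_1,S_2$ and $R_1,R_2$, $\mathcal{S}\otimes\mathcal{R}:=\mathcal{P}[Q]$ with $Q_1(s,\theta,\eta)=S_1(s,\theta)R_1(s,\eta)+S_1(s,\eta)R_1(s,\theta)$, $Q_2(s,\theta,\eta)=S_2(s,\theta)R_1(s,\eta)+S_1(s,\eta)R_2(s,\theta)$, $Q_3(s,\theta,\eta)=S_2(s,\theta)R_2(s,\eta)+S_2(s,\eta)R_2(s,\theta)$. For $c\in L_\infty[a,b]$, $(\mathcal{M}_c\mathbf{v})(s)=c(s)\mathbf{v}(s)$.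 Associated operators: $\mathcal{T}:L_2[a,b]\to X_B$ is the inverse of $\partial_s^N:X_B\to L_2[a,b]$; $\mathcal{R}_j:=\partial_s^j\circ\mathcal{T}$ for $0\le j\le N-1$; $\mathcal{R}_N:=I$. It is known, and may be used, that $\mathcal{T}$ and $\mathcal{R}_0,\dots,\mathcal{R}_{N-1}$ are in $\Pi_2$ with polynomial (in particular bounded) kernels. Then $$\mathcal{A}=\sum_{i=0}^{N}\mathcal{M}_{\alpha_i}\mathcal{R}_i\in\Pi_3,\qquad\mathcal{B}=\sum_{i=0}^{N-1}\sum_{j=0}^i\mathcal{M}_{\beta_{ij}}[\mathcal{R}_i\otimes\mathcal{R}_j]\in\Pi_{2^2}.$$ $\Pi_2$ and $\Pi_3$ are closed under sums, compositions and adjoints, and the composition of an element of $\Pi_3$ with an element of $\Pi_{2^2}$ is in $\Pi_{2^2}$, so $\mathcal{T}^*\mathcal{P}\mathcal{B}\in\Pi_{2^2}$. For $\mathcal{G}=\mathcal{P}[G]\in\Pi_{2^2}$ with $G=[G_1,G_2,G_3]$, the operator $\mathcal{K}_{\text{lin}}[\mathcal{G}]:L_2[[a,b]^3]\to\mathbb{R}$ is $$\mathcal{K}_{\text{lin}}[\mathcal{G}]\mathbf{w}=\int_a^b\!\int_a^s\!\int_a^\theta K(s,\theta,\eta)\mathbf{w}(s,\theta,\eta)\,d\eta\,d\theta\,ds,\qquad K(s,\theta,\eta)=G_1(s,\theta,\eta)+G_2(\theta,s,\eta)+G_3(\eta,s,\theta).$$ *)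

theory Defs
  imports "HOL-Analysis.Analysis"
begin

text \<open>
  Elements of \<open>L\<^sub>2\<close> and \<open>L\<^sub>\<infinity>\<close> are represented by real functions, and equality of classes by
  equality almost everywhere. Functions on the square and the cube are curried. They are measurable
  with respect to the product of the one-dimensional Lebesgue \<open>\<sigma>\<close>-algebras; every class of
  Lebesgue measurable functions on the square or the cube has such a representative.
\<close>

abbreviation Leb1 :: "real \<Rightarrow> real \<Rightarrow> real measure" where
  "Leb1 a b \<equiv> lebesgue_on {a..b}"

abbreviation Leb2 :: "real \<Rightarrow> real \<Rightarrow> (real \<times> real) measure" where
  "Leb2 a b \<equiv> Leb1 a b \<Otimes>\<^sub>M Leb1 a b"

abbreviation Leb3 :: "real \<Rightarrow> real \<Rightarrow> (real \<times> real \<times> real) measure" where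
  "Leb3 a b \<equiv> Leb1 a b \<Otimes>\<^sub>M Leb1 a b \<Otimes>\<^sub>M Leb1 a b"

definition L2 :: "'a measure \<Rightarrow> ('a \<Rightarrow> real) set" where
  "L2 M = {f \<in> borel_measurable M. integrable M (\<lambda>x. (f x)\<^sup>2)}"

definition Linf :: "'a measure \<Rightarrow> ('a \<Rightarrow> real) set" where
  "Linf M = {f \<in> borel_measurable M. \<exists>C. AE x in M. \<bar>f x\<bar> \<le> C}"

definition L2_inner :: "real \<Rightarrow> real \<Rightarrow> (real \<Rightarrow> real) \<Rightarrow> (real \<Rightarrow> real) \<Rightarrow> real" where
  "L2_inner a b f g = (LINT x|Leb1 a b. f x * g x)"

definition L2_norm :: "real \<Rightarrow> real \<Rightarrow> (real \<Rightarrow> real) \<Rightarrow> real" where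
  "L2_norm a b f = sqrt (L2_inner a b f f)"

definition L2_eq :: "real \<Rightarrow> real \<Rightarrow> (real \<Rightarrow> real) \<Rightarrow> (real \<Rightarrow> real) \<Rightarrow> bool" where
  "L2_eq a b f g \<longleftrightarrow> (AE x in Leb1 a b. f x = g x)"

text \<open>
  On an interval, continuously differentiable test functions give the same weak derivatives as
  smooth ones.
\<close>

definition has_weak_deriv :: "real \<Rightarrow> real \<Rightarrow> (real \<Rightarrow> real) \<Rightarrow> (real \<Rightarrow> real) \<Rightarrow> bool" where
  "has_weak_deriv a b u v \<longleftrightarrow>
     (\<forall>\<phi> \<phi>'. (\<forall>x. (\<phi> has_real_derivative \<phi>' x) (at x)) \<and> continuous_on UNIV \<phi>' \<and>
        (\<exists>c d. a < c \<and> d < b \<and> (\<forall>x. x \<notin> {c..d} \<longrightarrow> \<phi> x = 0)) \<longrightarrow>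
        (LINT x|Leb1 a b. u x * \<phi>' x) = - (LINT x|Leb1 a b. v x * \<phi> x))"

text \<open>
  \<open>wderiv a b u\<close> is a representative of the weak derivative of \<open>u\<close>, meaningful whenever \<open>u\<close> has a
  weak derivative in \<open>L\<^sub>2\<close>; its class is then unique.
\<close>

definition wderiv :: "real \<Rightarrow> real \<Rightarrow> (real \<Rightarrow> real) \<Rightarrow> real \<Rightarrow> real" where
  "wderiv a b u = (SOME v. v \<in> L2 (Leb1 a b) \<and> has_weak_deriv a b u v)"

abbreviation wderivs :: "real \<Rightarrow> real \<Rightarrow> nat \<Rightarrow> (real \<Rightarrow> real) \<Rightarrow> real \<Rightarrow> real" where
  "wderivs a b k u \<equiv> (wderiv a b ^^ k) u"

definition sobolev :: "real \<Rightarrow> real \<Rightarrow> nat \<Rightarrow> (real \<Rightarrow> real) set" where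
  "sobolev a b N = {u \<in> L2 (Leb1 a b).
     \<forall>k<N. \<exists>v \<in> L2 (Leb1 a b). has_weak_deriv a b (wderivs a b k u) v}"

text \<open>
  Point values are those of the continuous representative, which exists for \<open>\<partial>\<^sup>k u\<close> with \<open>k < N\<close>
  when \<open>u\<close> lies in the Sobolev space of order \<open>N\<close>, and is unique on \<open>{a..b}\<close>.
\<close>

definition cont_rep :: "real \<Rightarrow> real \<Rightarrow> (real \<Rightarrow> real) \<Rightarrow> real \<Rightarrow> real" where
  "cont_rep a b f = (SOME g. continuous_on {a..b} g \<and> L2_eq a b f g)"

text \<open>
  \<open>B\<close> is an \<open>N \<times> 2N\<close> matrix: only the entries \<open>B r k\<close> with \<open>r < N\<close> and \<open>k < 2 * N\<close> are used. Its
  first \<open>N\<close> columns act on the derivatives at \<open>a\<close>, the others on those at \<open>b\<close>.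
\<close>

definition XB :: "real \<Rightarrow> real \<Rightarrow> nat \<Rightarrow> (nat \<Rightarrow> nat \<Rightarrow> real) \<Rightarrow> (real \<Rightarrow> real) set" where
  "XB a b N B = {u \<in> sobolev a b N. \<forall>r<N.
     (\<Sum>k<N. B r k * cont_rep a b (wderivs a b k u) a) +
     (\<Sum>k<N. B r (N + k) * cont_rep a b (wderivs a b k u) b) = 0}"

definition well_posed_bc :: "real \<Rightarrow> real \<Rightarrow> nat \<Rightarrow> (nat \<Rightarrow> nat \<Rightarrow> real) \<Rightarrow> bool" where
  "well_posed_bc a b N B \<longleftrightarrow>
     (\<forall>p :: real poly. degree p \<le> N - 1 \<and> poly p \<in> XB a b N B \<longrightarrow> p = 0)"

definition L2_has_deriv ::
  "real \<Rightarrow> real \<Rightarrow> (real \<Rightarrow> real \<Rightarrow> real) \<Rightarrow> (real \<Rightarrow> real) \<Rightarrow> real \<Rightarrow> bool" where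
  "L2_has_deriv a b u d t \<longleftrightarrow> d \<in> L2 (Leb1 a b) \<and>
     ((\<lambda>\<tau>. L2_norm a b (\<lambda>s. u \<tau> s - u t s - (\<tau> - t) * d s) / \<bar>\<tau> - t\<bar>) \<longlongrightarrow> 0)
       (at t within {0..})"

definition classical_solution ::
  "real \<Rightarrow> real \<Rightarrow> nat \<Rightarrow> (nat \<Rightarrow> nat \<Rightarrow> real) \<Rightarrow> (nat \<Rightarrow> real \<Rightarrow> real) \<Rightarrow>
   (nat \<Rightarrow> nat \<Rightarrow> real \<Rightarrow> real) \<Rightarrow> (real \<Rightarrow> real) \<Rightarrow> (real \<Rightarrow> real \<Rightarrow> real) \<Rightarrow> bool" where
  "classical_solution a b N B \<alpha> \<beta> u0 u \<longleftrightarrow>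
     (\<forall>t\<ge>0. u t \<in> XB a b N B) \<and>
     L2_eq a b (u 0) u0 \<and>
     (\<forall>t\<ge>0. \<exists>d. L2_has_deriv a b u d t \<and>
        (AE s in Leb1 a b. d s =
           (\<Sum>i\<le>N. \<alpha> i s * wderivs a b i (u t) s) +
           (\<Sum>i<N. \<Sum>j\<le>i. \<beta> i j s * wderivs a b i (u t) s * wderivs a b j (u t) s)))"

type_synonym op1 = "(real \<Rightarrow> real) \<Rightarrow> real \<Rightarrow> real"
type_synonym op2 = "(real \<Rightarrow> real \<Rightarrow> real) \<Rightarrow> real \<Rightarrow> real"

definition op_eq :: "real \<Rightarrow> real \<Rightarrow> op1 \<Rightarrow> op1 \<Rightarrow> bool" where
  "op_eq a b S R \<longleftrightarrow> (\<forall>v \<in> L2 (Leb1 a b). L2_eq a b (S v) (R v))"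

definition op_le :: "real \<Rightarrow> real \<Rightarrow> op1 \<Rightarrow> op1 \<Rightarrow> bool" where
  "op_le a b S R \<longleftrightarrow> (\<forall>v \<in> L2 (Leb1 a b). L2_inner a b v (S v) \<le> L2_inner a b v (R v))"

definition L2_adjoint :: "real \<Rightarrow> real \<Rightarrow> op1 \<Rightarrow> op1" where
  "L2_adjoint a b T = (SOME S. \<forall>w \<in> L2 (Leb1 a b). S w \<in> L2 (Leb1 a b) \<and>
     (\<forall>v \<in> L2 (Leb1 a b). L2_inner a b (T v) w = L2_inner a b v (S w)))"

definition L2_onorm :: "real \<Rightarrow> real \<Rightarrow> op1 \<Rightarrow> real" where
  "L2_onorm a b S = (SUP v \<in> L2 (Leb1 a b). L2_norm a b (S v) / L2_norm a b v)"

definition mult_op :: "(real \<Rightarrow> real) \<Rightarrow> op1" where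
  "mult_op c v = (\<lambda>s. c s * v s)"

definition PI3 ::
  "real \<Rightarrow> real \<Rightarrow> (real \<Rightarrow> real) \<Rightarrow> (real \<Rightarrow> real \<Rightarrow> real) \<Rightarrow> (real \<Rightarrow> real \<Rightarrow> real) \<Rightarrow> op1" where
  "PI3 a b R0 R1 R2 v = (\<lambda>s. R0 s * v s +
     (LINT \<theta>:{a..s}|lebesgue. R1 s \<theta> * v \<theta>) +
     (LINT \<theta>:{s..b}|lebesgue. R2 s \<theta> * v \<theta>))"

definition has_Pi3_kernels ::
  "real \<Rightarrow> real \<Rightarrow> op1 \<Rightarrow> (real \<Rightarrow> real) \<Rightarrow> (real \<Rightarrow> real \<Rightarrow> real) \<Rightarrow> (real \<Rightarrow> real \<Rightarrow> real) \<Rightarrow> bool" where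
  "has_Pi3_kernels a b R R0 R1 R2 \<longleftrightarrow>
     R0 \<in> Linf (Leb1 a b) \<and>
     (\<lambda>(s, \<theta>). R1 s \<theta>) \<in> L2 (Leb2 a b) \<and>
     (\<lambda>(s, \<theta>). R2 s \<theta>) \<in> L2 (Leb2 a b) \<and>
     op_eq a b R (PI3 a b R0 R1 R2)"

definition Pi3 :: "real \<Rightarrow> real \<Rightarrow> op1 set" where
  "Pi3 a b = {R. \<exists>R0 R1 R2. has_Pi3_kernels a b R R0 R1 R2}"

definition has_Pi2_kernels ::
  "real \<Rightarrow> real \<Rightarrow> op1 \<Rightarrow> (real \<Rightarrow> real \<Rightarrow> real) \<Rightarrow> (real \<Rightarrow> real \<Rightarrow> real) \<Rightarrow> bool" where
  "has_Pi2_kernels a b R R1 R2 \<longleftrightarrow> has_Pi3_kernels a b R (\<lambda>_. 0) R1 R2"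

definition PI22 ::
  "real \<Rightarrow> real \<Rightarrow> (real \<Rightarrow> real \<Rightarrow> real \<Rightarrow> real) \<Rightarrow> (real \<Rightarrow> real \<Rightarrow> real \<Rightarrow> real) \<Rightarrow>
   (real \<Rightarrow> real \<Rightarrow> real \<Rightarrow> real) \<Rightarrow> op2" where
  "PI22 a b Q1 Q2 Q3 w = (\<lambda>s.
     (LINT \<theta>:{a..s}|lebesgue. LINT \<eta>:{a..\<theta>}|lebesgue. Q1 s \<theta> \<eta> * w \<theta> \<eta>) +
     (LINT \<theta>:{s..b}|lebesgue. LINT \<eta>:{a..s}|lebesgue. Q2 s \<theta> \<eta> * w \<theta> \<eta>) +
     (LINT \<theta>:{s..b}|lebesgue. LINT \<eta>:{s..\<theta>}|lebesgue. Q3 s \<theta> \<eta> * w \<theta> \<eta>))"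

definition has_Pi22_kernels ::
  "real \<Rightarrow> real \<Rightarrow> op2 \<Rightarrow> (real \<Rightarrow> real \<Rightarrow> real \<Rightarrow> real) \<Rightarrow> (real \<Rightarrow> real \<Rightarrow> real \<Rightarrow> real) \<Rightarrow>
   (real \<Rightarrow> real \<Rightarrow> real \<Rightarrow> real) \<Rightarrow> bool" where
  "has_Pi22_kernels a b G G1 G2 G3 \<longleftrightarrow>
     (\<lambda>(s, \<theta>, \<eta>). G1 s \<theta> \<eta>) \<in> L2 (Leb3 a b) \<and>
     (\<lambda>(s, \<theta>, \<eta>). G2 s \<theta> \<eta>) \<in> L2 (Leb3 a b) \<and>
     (\<lambda>(s, \<theta>, \<eta>). G3 s \<theta> \<eta>) \<in> L2 (Leb3 a b) \<and>
     (\<forall>w. (\<lambda>(\<theta>, \<eta>). w \<theta> \<eta>) \<in> L2 (Leb2 a b) \<longrightarrow> L2_eq a b (G w) (PI22 a b G1 G2 G3 w))"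

definition tensor_PI ::
  "real \<Rightarrow> real \<Rightarrow> (real \<Rightarrow> real \<Rightarrow> real) \<Rightarrow> (real \<Rightarrow> real \<Rightarrow> real) \<Rightarrow>
   (real \<Rightarrow> real \<Rightarrow> real) \<Rightarrow> (real \<Rightarrow> real \<Rightarrow> real) \<Rightarrow> op2" where
  "tensor_PI a b S1 S2 R1 R2 = PI22 a b
     (\<lambda>s \<theta> \<eta>. S1 s \<theta> * R1 s \<eta> + S1 s \<eta> * R1 s \<theta>)
     (\<lambda>s \<theta> \<eta>. S2 s \<theta> * R1 s \<eta> + S1 s \<eta> * R2 s \<theta>)
     (\<lambda>s \<theta> \<eta>. S2 s \<theta> * R2 s \<eta> + S2 s \<eta> * R2 s \<theta>)"

definition Klin ::
  "real \<Rightarrow> real \<Rightarrow> (real \<Rightarrow> real \<Rightarrow> real \<Rightarrow> real) \<Rightarrow> (real \<Rightarrow> real \<Rightarrow> real \<Rightarrow> real) \<Rightarrow>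
   (real \<Rightarrow> real \<Rightarrow> real \<Rightarrow> real) \<Rightarrow> (real \<Rightarrow> real \<Rightarrow> real \<Rightarrow> real) \<Rightarrow> real" where
  "Klin a b G1 G2 G3 w =
     (LINT s:{a..b}|lebesgue. LINT \<theta>:{a..s}|lebesgue. LINT \<eta>:{a..\<theta>}|lebesgue.
        (G1 s \<theta> \<eta> + G2 \<theta> s \<eta> + G3 \<eta> s \<theta>) * w s \<theta> \<eta>)"

definition T_op :: "real \<Rightarrow> real \<Rightarrow> nat \<Rightarrow> (nat \<Rightarrow> nat \<Rightarrow> real) \<Rightarrow> op1" where
  "T_op a b N B v = (SOME u. u \<in> XB a b N B \<and> L2_eq a b (wderivs a b N u) v)"

definition R_op :: "real \<Rightarrow> real \<Rightarrow> nat \<Rightarrow> (nat \<Rightarrow> nat \<Rightarrow> real) \<Rightarrow> nat \<Rightarrow> op1" where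
  "R_op a b N B j v = (if j < N then wderivs a b j (T_op a b N B v) else v)"

definition A_op ::
  "real \<Rightarrow> real \<Rightarrow> nat \<Rightarrow> (nat \<Rightarrow> nat \<Rightarrow> real) \<Rightarrow> (nat \<Rightarrow> real \<Rightarrow> real) \<Rightarrow> op1" where
  "A_op a b N B \<alpha> v = (\<lambda>s. \<Sum>i\<le>N. mult_op (\<alpha> i) (R_op a b N B i v) s)"

text \<open>
  The tensor products are defined through the kernels \<open>R1 j\<close>, \<open>R2 j\<close> of \<open>R_op a b N B j\<close>, so those
  are arguments here.
\<close>

definition B_op ::
  "real \<Rightarrow> real \<Rightarrow> nat \<Rightarrow> (nat \<Rightarrow> nat \<Rightarrow> real \<Rightarrow> real) \<Rightarrow>
   (nat \<Rightarrow> real \<Rightarrow> real \<Rightarrow> real) \<Rightarrow> (nat \<Rightarrow> real \<Rightarrow> real \<Rightarrow> real) \<Rightarrow> op2" where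
  "B_op a b N \<beta> R1 R2 w = (\<lambda>s. \<Sum>i<N. \<Sum>j\<le>i.
     mult_op (\<beta> i j) (tensor_PI a b (R1 i) (R2 i) (R1 j) (R2 j) w) s)"

end

theory Submission
  imports Defs
begin

text \<open>
  The Lyapunov function is \<open>V t = \<langle>u t, P (u t)\<rangle>\<close>. It lies between \<open>\<epsilon> \<parallel>u t\<parallel>\<^sup>2\<close> and \<open>\<mu> \<parallel>u t\<parallel>\<^sup>2\<close>, and for
  symmetric bounded \<open>P\<close> its derivative is \<open>2 \<langle>P u, \<partial>\<^sub>t u\<rangle>\<close> (\<open>quadratic_form_has_derivative\<close>). If this is at
  most \<open>- \<delta> \<parallel>u\<parallel>\<^sup>2\<close>, it is at most \<open>- (\<delta> / \<mu>) V\<close>, and \<open>exponential_decay\<close> gives the claim.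

  To estimate the derivative, the equation is rewritten in the variable \<open>v = \<partial>\<^sup>N u\<close>, which satisfies no
  boundary conditions. Well-posedness of the boundary conditions makes \<open>\<partial>\<^sup>N\<close> injective on \<open>XB\<close>
  (\<open>XB_inj\<close>): a function whose weak derivative of order \<open>N\<close> vanishes is a polynomial of degree less than
  \<open>N\<close>, by the lemma of du Bois-Reymond. So \<open>u = T v\<close> and \<open>\<partial>\<^sup>j u = R\<^sub>j v\<close> almost everywhere, and since the
  tensor product of two partial integral operators multiplies their values on \<open>v \<otimes> v\<close>
  (\<open>tensor_PI_diagonal_AE\<close>), the equation becomes \<open>\<partial>\<^sub>t u = A v + \<B> (v \<otimes> v)\<close>.

  The linear part contributes \<open>\<langle>v, (A\<^sup>* P T + T\<^sup>* P A) v\<rangle> \<le> - \<delta> \<parallel>T v\<parallel>\<^sup>2 = - \<delta> \<parallel>u\<parallel>\<^sup>2\<close>. The quadratic part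
  contributes twice \<open>\<langle>v, T\<^sup>* P \<B> (v \<otimes> v)\<rangle>\<close>, a cubic form in \<open>v\<close>. Since \<open>v \<otimes> v \<otimes> v\<close> is symmetric, this form
  depends only on the kernels folded onto the simplex \<open>\<eta> \<le> \<theta> \<le> s\<close>; it is the value of the cubic
  functional on \<open>v \<otimes> v \<otimes> v\<close> (\<open>PI22_diagonal_inner_eq_Klin\<close>), hence zero.

  Adjoints exist for all partial integral operators because transposing a square-integrable kernel
  gives the adjoint (\<open>Pi3_adjoint_pair\<close>), and the Hilbert--Schmidt bound makes \<open>P\<close> bounded.
\<close>

section \<open>Square-integrable functions\<close>

lemma L2_measurable: "f \<in> L2 M \<Longrightarrow> f \<in> borel_measurable M"
  by (simp add: L2_def)

lemma L2_square_integrable: "f \<in> L2 M \<Longrightarrow> integrable M (\<lambda>x. (f x)\<^sup>2)"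
  by (simp add: L2_def)

lemma L2_mult_integrable:
  assumes "f \<in> L2 M" "g \<in> L2 M"
  shows "integrable M (\<lambda>x. f x * g x)"
proof (rule Bochner_Integration.integrable_bound)
  show "integrable M (\<lambda>x. (f x)\<^sup>2 + (g x)\<^sup>2)"
    using assms by (auto simp: L2_def)
  show "(\<lambda>x. f x * g x) \<in> borel_measurable M"
    using assms by (auto simp: L2_def)
  have "\<bar>f x * g x\<bar> \<le> (f x)\<^sup>2 + (g x)\<^sup>2" for x
  proof -
    have "2 * (\<bar>f x\<bar> * \<bar>g x\<bar>) \<le> (f x)\<^sup>2 + (g x)\<^sup>2"
      using sum_squares_bound[of "\<bar>f x\<bar>" "\<bar>g x\<bar>"] by (simp add: mult.assoc)
    moreover have "0 \<le> \<bar>f x\<bar> * \<bar>g x\<bar>"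
      by simp
    ultimately show ?thesis
      unfolding abs_mult by linarith
  qed
  then show "AE x in M. norm (f x * g x) \<le> norm ((f x)\<^sup>2 + (g x)\<^sup>2)"
    by auto
qed

lemma L2_zero: "(\<lambda>x. 0) \<in> L2 M"
  by (simp add: L2_def)

lemma L2_cmult:
  assumes "f \<in> L2 M"
  shows "(\<lambda>x. c * f x) \<in> L2 M"
  using assms by (auto simp: L2_def power_mult_distrib)

lemma L2_add:
  assumes "f \<in> L2 M" "g \<in> L2 M"
  shows "(\<lambda>x. f x + g x) \<in> L2 M"
proof -
  have "integrable M (\<lambda>x. (f x)\<^sup>2 + (g x)\<^sup>2 + 2 * (f x * g x))"
    using L2_mult_integrable[OF assms] assms by (auto simp: L2_def)
  moreover have "(f x + g x)\<^sup>2 = (f x)\<^sup>2 + (g x)\<^sup>2 + 2 * (f x * g x)" for x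
    by (simp add: power2_sum)
  ultimately show ?thesis
    using assms by (auto simp: L2_def)
qed

lemma L2_diff:
  assumes "f \<in> L2 M" "g \<in> L2 M"
  shows "(\<lambda>x. f x - g x) \<in> L2 M"
  using L2_add[OF assms(1) L2_cmult[OF assms(2), of "-1"]] by simp

lemma L2_sum:
  assumes "\<And>i. i \<in> I \<Longrightarrow> f i \<in> L2 M"
  shows "(\<lambda>x. \<Sum>i\<in>I. f i x) \<in> L2 M"
  using assms by (induction I rule: infinite_finite_induct) (auto intro: L2_zero L2_add)

lemma L2_Linf_mult:
  assumes c: "c \<in> Linf M" and f: "f \<in> L2 M"
  shows "(\<lambda>x. c x * f x) \<in> L2 M"
proof -
  obtain C where C: "AE x in M. \<bar>c x\<bar> \<le> C"
    using c by (auto simp: Linf_def)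
  have [measurable]: "c \<in> borel_measurable M" "f \<in> borel_measurable M"
    using c f by (auto simp: L2_def Linf_def)
  have "integrable M (\<lambda>x. (c x * f x)\<^sup>2)"
  proof (rule Bochner_Integration.integrable_bound)
    show "integrable M (\<lambda>x. C\<^sup>2 * (f x)\<^sup>2)"
      using f by (auto simp: L2_def)
    show "AE x in M. norm ((c x * f x)\<^sup>2) \<le> norm (C\<^sup>2 * (f x)\<^sup>2)"
      using C
    proof eventually_elim
      case (elim x)
      have "(c x)\<^sup>2 \<le> C\<^sup>2"
        using elim by (simp add: abs_le_square_iff[symmetric])
      then show ?case
        by (simp add: power_mult_distrib mult_right_mono)
    qed
  qed simp
  then show ?thesis
    by (simp add: L2_def)
qed

text \<open>
  The quadratic polynomial \<open>t \<mapsto> \<integral> (f + t g)\<^sup>2\<close> is nonnegative, so its discriminant is not positive.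
\<close>

lemma L2_Cauchy_Schwarz:
  assumes f: "f \<in> L2 M" and g: "g \<in> L2 M"
  shows "(LINT x|M. f x * g x)\<^sup>2 \<le> (LINT x|M. (f x)\<^sup>2) * (LINT x|M. (g x)\<^sup>2)"
proof -
  define F where "F = (LINT x|M. (f x)\<^sup>2)"
  define G where "G = (LINT x|M. (g x)\<^sup>2)"
  define H where "H = (LINT x|M. f x * g x)"
  have poly: "0 \<le> s\<^sup>2 * F + 2 * s * t * H + t\<^sup>2 * G" for s t
  proof -
    have "0 \<le> (LINT x|M. (s * f x + t * g x)\<^sup>2)"
      by simp
    also have "(\<lambda>x. (s * f x + t * g x)\<^sup>2)
        = (\<lambda>x. s\<^sup>2 * (f x)\<^sup>2 + 2 * s * t * (f x * g x) + t\<^sup>2 * (g x)\<^sup>2)"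
      by (auto simp: power2_eq_square algebra_simps)
    also have "(LINT x|M. \<dots> x) = s\<^sup>2 * F + 2 * s * t * H + t\<^sup>2 * G"
      using L2_mult_integrable[OF f g] f g by (simp add: L2_def F_def G_def H_def)
    finally show ?thesis .
  qed
  have F0: "0 \<le> F" and G0: "0 \<le> G"
    by (simp_all add: F_def G_def)
  have "H\<^sup>2 \<le> F * G"
  proof (cases "G = 0")
    case True
    have "H = 0"
    proof (rule ccontr)
      assume "H \<noteq> 0"
      then have "2 * (- (F + 1) / (2 * H)) * H = - (F + 1)"
        by (simp add: field_simps)
      then show False
        using poly[of 1 "- (F + 1) / (2 * H)"] True by simp
    qed
    then show ?thesis
      using True by simp
  next
    case False
    then have "0 \<le> G * (F * G - H\<^sup>2)"
      using poly[of G "-H"] by (simp add: power2_eq_square algebra_simps)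
    then show ?thesis
      using False G0 by (simp add: zero_le_mult_iff)
  qed
  then show ?thesis
    by (simp add: F_def G_def H_def)
qed

section \<open>The space \<open>L\<^sub>2\<close> over an interval\<close>

lemma finite_measure_Leb1: "finite_measure (Leb1 a b)"
  by (rule finite_measure_lebesgue_on) auto

lemma sigma_finite_Leb1: "sigma_finite_measure (Leb1 a b)"
  using finite_measure_Leb1 finite_measure_def by blast

lemma pair_sigma_finite_Leb1: "pair_sigma_finite (Leb1 a b) (Leb1 a b)"
  by (intro pair_sigma_finite.intro sigma_finite_Leb1)

lemma sigma_finite_Leb2: "sigma_finite_measure (Leb2 a b)"
  by (intro sigma_finite_pair_measure sigma_finite_Leb1)

lemma borel_measurable_Leb1I:
  fixes f :: "real \<Rightarrow> real"
  shows "f \<in> borel_measurable borel \<Longrightarrow> f \<in> borel_measurable (Leb1 a b)"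
  by (intro measurable_restrict_space1 measurable_completion) simp

lemma id_measurable_Leb1: "(\<lambda>x. x) \<in> borel_measurable (Leb1 a b)"
  by (rule borel_measurable_Leb1I) simp

lemma AE_Leb1_neq: "AE x in Leb1 a b. x \<noteq> c"
proof -
  have "{c} \<in> null_sets lebesgue"
    by simp
  then have "AE x in lebesgue. x \<noteq> c"
    using AE_not_in by fastforce
  then show ?thesis
    by (subst AE_restrict_space_iff) auto
qed

text \<open>Lebesgue measure is complete, so representatives of measurable classes are measurable.\<close>

lemma Leb1_measurable_AE:
  fixes f g :: "real \<Rightarrow> real"
  assumes f: "f \<in> borel_measurable (Leb1 a b)" and eq: "L2_eq a b f g"
  shows "g \<in> borel_measurable (Leb1 a b)"
proof -
  have "(\<lambda>x. if x \<in> {a..b} then f x else 0) \<in> borel_measurable lebesgue"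
    using f by (intro borel_measurable_if_I) auto
  moreover have "AE x in lebesgue. (if x \<in> {a..b} then f x else 0) = (if x \<in> {a..b} then g x else 0)"
    using eq unfolding L2_eq_def by (subst (asm) AE_restrict_space_iff) auto
  ultimately have "(\<lambda>x. if x \<in> {a..b} then g x else 0) \<in> borel_measurable lebesgue"
    by (rule borel_measurable_AE)
  then show ?thesis
    by (rule borel_measurable_if_D)
qed

lemma L2_eq_refl: "L2_eq a b f f"
  by (simp add: L2_eq_def)

lemma L2_eq_sym: "L2_eq a b f g \<Longrightarrow> L2_eq a b g f"
  unfolding L2_eq_def by (auto elim: eventually_mono)

lemma L2_eq_trans: "L2_eq a b f g \<Longrightarrow> L2_eq a b g h \<Longrightarrow> L2_eq a b f h"
  unfolding L2_eq_def by (auto elim: eventually_elim2)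

lemma L2_eq_in_L2:
  assumes f: "f \<in> L2 (Leb1 a b)" and eq: "L2_eq a b f g"
  shows "g \<in> L2 (Leb1 a b)"
proof -
  have g: "g \<in> borel_measurable (Leb1 a b)"
    using Leb1_measurable_AE[OF L2_measurable[OF f] eq] .
  have "integrable (Leb1 a b) (\<lambda>x. (g x)\<^sup>2)"
  proof (rule integrable_cong_AE_imp[OF L2_square_integrable[OF f]])
    show "AE x in Leb1 a b. (f x)\<^sup>2 = (g x)\<^sup>2"
      using eq unfolding L2_eq_def by eventually_elim simp
  qed (use g in \<open>auto intro: borel_measurable_power\<close>)
  then show ?thesis
    using g by (simp add: L2_def)
qed

lemma L2_inner_cong:
  assumes "f \<in> borel_measurable (Leb1 a b)" "g \<in> borel_measurable (Leb1 a b)"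
    and "L2_eq a b f f'" "L2_eq a b g g'"
  shows "L2_inner a b f g = L2_inner a b f' g'"
  unfolding L2_inner_def
proof (rule integral_cong_AE)
  show "AE x in Leb1 a b. f x * g x = f' x * g' x"
    using assms(3,4) unfolding L2_eq_def by eventually_elim simp
  show "(\<lambda>x. f x * g x) \<in> borel_measurable (Leb1 a b)"
    by (intro borel_measurable_times assms)
  show "(\<lambda>x. f' x * g' x) \<in> borel_measurable (Leb1 a b)"
    by (intro borel_measurable_times Leb1_measurable_AE[OF assms(1,3)] Leb1_measurable_AE[OF assms(2,4)])
qed

lemma L2_inner_commute: "L2_inner a b f g = L2_inner a b g f"
  by (simp add: L2_inner_def mult.commute)

lemma L2_inner_add_left:
  assumes "f \<in> L2 (Leb1 a b)" "g \<in> L2 (Leb1 a b)" "h \<in> L2 (Leb1 a b)"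
  shows "L2_inner a b (\<lambda>s. f s + g s) h = L2_inner a b f h + L2_inner a b g h"
  using assms by (simp add: L2_inner_def distrib_right L2_mult_integrable)

lemma L2_inner_add_right:
  assumes "f \<in> L2 (Leb1 a b)" "g \<in> L2 (Leb1 a b)" "h \<in> L2 (Leb1 a b)"
  shows "L2_inner a b h (\<lambda>s. f s + g s) = L2_inner a b h f + L2_inner a b h g"
  using assms by (simp add: L2_inner_def distrib_left L2_mult_integrable)

lemma L2_inner_cmult_left: "L2_inner a b (\<lambda>s. c * f s) h = c * L2_inner a b f h"
  by (simp add: L2_inner_def mult.assoc)

lemma L2_inner_cmult_right: "L2_inner a b h (\<lambda>s. c * f s) = c * L2_inner a b h f"
  by (simp add: L2_inner_def mult.left_commute)

lemma L2_inner_sum_left: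
  assumes "\<And>i. i \<in> I \<Longrightarrow> f i \<in> L2 (Leb1 a b)" "h \<in> L2 (Leb1 a b)"
  shows "L2_inner a b (\<lambda>s. \<Sum>i\<in>I. f i s) h = (\<Sum>i\<in>I. L2_inner a b (f i) h)"
  using assms by (simp add: L2_inner_def sum_distrib_right L2_mult_integrable)

lemma L2_inner_sum_right:
  assumes "\<And>i. i \<in> I \<Longrightarrow> f i \<in> L2 (Leb1 a b)" "h \<in> L2 (Leb1 a b)"
  shows "L2_inner a b h (\<lambda>s. \<Sum>i\<in>I. f i s) = (\<Sum>i\<in>I. L2_inner a b h (f i))"
  using L2_inner_sum_left[OF assms] by (simp add: L2_inner_commute)

lemma L2_inner_ge_0: "0 \<le> L2_inner a b f f"
  by (simp add: L2_inner_def)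

lemma L2_norm_ge_0: "0 \<le> L2_norm a b f"
  by (simp add: L2_norm_def L2_inner_ge_0)

lemma L2_norm_sq: "(L2_norm a b f)\<^sup>2 = L2_inner a b f f"
  by (simp add: L2_norm_def L2_inner_ge_0)

lemma L2_inner_bound:
  assumes "f \<in> L2 (Leb1 a b)" "g \<in> L2 (Leb1 a b)"
  shows "\<bar>L2_inner a b f g\<bar> \<le> L2_norm a b f * L2_norm a b g"
proof (rule power2_le_imp_le)
  show "\<bar>L2_inner a b f g\<bar>\<^sup>2 \<le> (L2_norm a b f * L2_norm a b g)\<^sup>2"
    using L2_Cauchy_Schwarz[OF assms]
    by (simp add: power_mult_distrib L2_norm_sq) (simp add: L2_inner_def power2_eq_square)
qed (simp add: L2_norm_ge_0)

lemma L2_integrable: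
  assumes "f \<in> L2 (Leb1 a b)"
  shows "integrable (Leb1 a b) f"
proof -
  interpret finite_measure "Leb1 a b" by (rule finite_measure_Leb1)
  have "(\<lambda>x. 1) \<in> L2 (Leb1 a b)"
    by (simp add: L2_def)
  from L2_mult_integrable[OF assms this] show ?thesis
    by simp
qed

lemma continuous_in_L2:
  assumes "continuous_on {a..b} f"
  shows "f \<in> L2 (Leb1 a b)"
proof -
  have "integrable (Leb1 a b) (\<lambda>x. (f x)\<^sup>2)"
    by (intro continuous_imp_integrable_real continuous_intros assms)
  then show ?thesis
    using continuous_imp_measurable_on_sets_lebesgue[OF assms] by (simp add: L2_def)
qed

section \<open>Integral operators with square-integrable kernels\<close>

lemma L2_tensor:
  assumes "pair_sigma_finite M N" and v: "v \<in> L2 M" and w: "w \<in> L2 N"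
  shows "(\<lambda>(x, y). v x * w y) \<in> L2 (M \<Otimes>\<^sub>M N)"
proof -
  interpret pair_sigma_finite M N by fact
  have [measurable]: "v \<in> borel_measurable M" "w \<in> borel_measurable N"
    using v w by (auto simp: L2_def)
  have "integrable (M \<Otimes>\<^sub>M N) (\<lambda>p. (v (fst p) * w (snd p))\<^sup>2)"
  proof (rule Fubini_integrable)
    show "integrable M (\<lambda>x. LINT y|N. norm ((v (fst (x, y)) * w (snd (x, y)))\<^sup>2))"
      using v w by (simp add: power_mult_distrib L2_def)
    show "AE x in M. integrable N (\<lambda>y. (v (fst (x, y)) * w (snd (x, y)))\<^sup>2)"
      using w by (simp add: power_mult_distrib L2_def)
  qed measurable
  then show ?thesis
    by (simp add: L2_def split_beta')
qed

lemma L2_AE_section: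
  assumes "pair_sigma_finite M N" and k: "(\<lambda>(x, y). k x y) \<in> L2 (M \<Otimes>\<^sub>M N)"
  shows "AE x in M. k x \<in> L2 N"
proof -
  interpret pair_sigma_finite M N by fact
  have [measurable]: "(\<lambda>(x, y). k x y) \<in> borel_measurable (M \<Otimes>\<^sub>M N)"
    using k by (auto simp: L2_def)
  have "AE x in M. integrable N (\<lambda>y. (k x y)\<^sup>2)"
    using AE_integrable_fst'[OF L2_square_integrable[OF k]] by simp
  then show ?thesis
  proof (rule AE_mp, intro AE_I2 impI)
    fix x assume x: "x \<in> space M" "integrable N (\<lambda>y. (k x y)\<^sup>2)"
    have "(\<lambda>y. (\<lambda>(x, y). k x y) (x, y)) \<in> borel_measurable N"
      by (rule measurable_compose[OF measurable_Pair1'[OF x(1)]]) measurable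
    then show "k x \<in> L2 N"
      using x by (simp add: L2_def)
  qed
qed

text \<open>The Hilbert--Schmidt bound: Cauchy--Schwarz on almost every section of the kernel.\<close>

lemma Hilbert_Schmidt:
  assumes psf: "pair_sigma_finite M N" and k: "(\<lambda>(x, y). k x y) \<in> L2 (M \<Otimes>\<^sub>M N)" and v: "v \<in> L2 N"
  shows "(\<lambda>x. LINT y|N. k x y * v y) \<in> L2 M"
    and "(LINT x|M. (LINT y|N. k x y * v y)\<^sup>2)
         \<le> (LINT x|M. LINT y|N. (k x y)\<^sup>2) * (LINT y|N. (v y)\<^sup>2)"
proof -
  interpret pair_sigma_finite M N by fact
  have [measurable]: "(\<lambda>(x, y). k x y) \<in> borel_measurable (M \<Otimes>\<^sub>M N)" "v \<in> borel_measurable N"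
    using k v by (auto simp: L2_def)
  have meas: "(\<lambda>x. LINT y|N. k x y * v y) \<in> borel_measurable M"
    by (rule M2.borel_measurable_lebesgue_integral) measurable
  have bound: "AE x in M. (LINT y|N. k x y * v y)\<^sup>2 \<le> (LINT y|N. (k x y)\<^sup>2) * (LINT y|N. (v y)\<^sup>2)"
    using L2_AE_section[OF psf k] by (rule AE_mp) (auto intro!: AE_I2 L2_Cauchy_Schwarz v)
  have int: "integrable M (\<lambda>x. (LINT y|N. (k x y)\<^sup>2) * (LINT y|N. (v y)\<^sup>2))"
    using integrable_fst'[OF L2_square_integrable[OF k]] by simp
  have sq: "integrable M (\<lambda>x. (LINT y|N. k x y * v y)\<^sup>2)"
    by (rule Bochner_Integration.integrable_bound[OF int]) (use meas bound in \<open>auto intro: order_trans[OF _ abs_ge_self]\<close>)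
  show "(\<lambda>x. LINT y|N. k x y * v y) \<in> L2 M"
    using meas sq by (simp add: L2_def)
  show "(LINT x|M. (LINT y|N. k x y * v y)\<^sup>2)
         \<le> (LINT x|M. LINT y|N. (k x y)\<^sup>2) * (LINT y|N. (v y)\<^sup>2)"
    using integral_mono_AE[OF sq int bound] by simp
qed

lemma L2_transpose:
  assumes "pair_sigma_finite M N" and k: "(\<lambda>(x, y). k x y) \<in> L2 (M \<Otimes>\<^sub>M N)"
  shows "(\<lambda>(y, x). k x y) \<in> L2 (N \<Otimes>\<^sub>M M)"
proof -
  interpret pair_sigma_finite M N by fact
  have "integrable (N \<Otimes>\<^sub>M M) (\<lambda>(y, x). (\<lambda>p. ((\<lambda>(x, y). k x y) p)\<^sup>2) (x, y))"
    by (rule integrable_product_swap) (rule L2_square_integrable[OF k])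
  moreover have "(\<lambda>(y, x). k x y) \<in> borel_measurable (N \<Otimes>\<^sub>M M)"
    using measurable_pair_swap[OF L2_measurable[OF k]] by simp
  ultimately show ?thesis
    by (simp add: L2_def split_beta')
qed

lemma kernel_transpose_inner:
  assumes psf: "pair_sigma_finite M N" and k: "(\<lambda>(x, y). k x y) \<in> L2 (M \<Otimes>\<^sub>M N)"
    and v: "v \<in> L2 N" and w: "w \<in> L2 M"
  shows "(LINT x|M. (LINT y|N. k x y * v y) * w x) = (LINT y|N. v y * (LINT x|M. k x y * w x))"
proof -
  interpret pair_sigma_finite M N by fact
  have "integrable (M \<Otimes>\<^sub>M N) (\<lambda>p. (\<lambda>(x, y). k x y) p * (\<lambda>(x, y). w x * v y) p)"
    by (intro L2_mult_integrable k L2_tensor v w psf)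
  then have "integrable (M \<Otimes>\<^sub>M N) (\<lambda>(x, y). k x y * (w x * v y))"
    by (simp add: split_beta')
  from Fubini_integral[OF this]
  have "(LINT y|N. LINT x|M. k x y * (w x * v y)) = (LINT x|M. LINT y|N. k x y * (w x * v y))" .
  moreover have "(LINT x|M. k x y * (w x * v y)) = v y * (LINT x|M. k x y * w x)" for y
    by (subst integral_mult_right_zero[symmetric]) (simp add: mult_ac)
  moreover have "(LINT y|N. k x y * (w x * v y)) = (LINT y|N. k x y * v y) * w x" for x
    by (subst integral_mult_left_zero[symmetric]) (simp add: mult_ac)
  ultimately show ?thesis
    by simp
qed

section \<open>Partial integral operators on an interval\<close>

lemma set_integral_Leb1:
  assumes "C \<subseteq> {a..b}" "C \<in> sets lebesgue"
  shows "(LINT x:C|lebesgue. f x) = (LINT x|Leb1 a b. indicator C x * (f x :: real))"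
proof -
  have "(LINT x|Leb1 a b. indicator C x * f x)
      = (LINT x|lebesgue. indicator {a..b} x *\<^sub>R (indicator C x * f x))"
    by (rule Bochner_Integration.integral_restrict_space) auto
  also have "(\<lambda>x. indicator {a..b} x *\<^sub>R (indicator C x * f x)) = (\<lambda>x. indicator C x *\<^sub>R f x)"
    using assms(1) by (auto simp: indicator_def fun_eq_iff)
  finally show ?thesis
    by (simp add: set_lebesgue_integral_def)
qed

lemma set_integral_Leb1_lower:
  assumes "s \<in> {a..b}"
  shows "(LINT x:{a..s}|lebesgue. f x) = (LINT x|Leb1 a b. indicator {..s} x * (f x :: real))"
proof -
  have "(LINT x:{a..s}|lebesgue. f x) = (LINT x|Leb1 a b. indicator {a..s} x * f x)"
    using assms by (intro set_integral_Leb1) auto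
  also have "\<dots> = (LINT x|Leb1 a b. indicator {..s} x * f x)"
    by (rule Bochner_Integration.integral_cong) (auto simp: indicator_def)
  finally show ?thesis .
qed

lemma set_integral_Leb1_upper:
  assumes "s \<in> {a..b}"
  shows "(LINT x:{s..b}|lebesgue. f x) = (LINT x|Leb1 a b. indicator {s..} x * (f x :: real))"
proof -
  have "(LINT x:{s..b}|lebesgue. f x) = (LINT x|Leb1 a b. indicator {s..b} x * f x)"
    using assms by (intro set_integral_Leb1) auto
  also have "\<dots> = (LINT x|Leb1 a b. indicator {s..} x * f x)"
    by (rule Bochner_Integration.integral_cong) (auto simp: indicator_def)
  finally show ?thesis .
qed

lemma measurable_Leb1_borel: "h \<in> measurable M (Leb1 a b) \<Longrightarrow> h \<in> borel_measurable M"
  by (rule measurable_compose[OF _ id_measurable_Leb1])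

lemma measurable_Leb2_coords:
  "fst \<in> borel_measurable (Leb1 a b \<Otimes>\<^sub>M M)" "snd \<in> borel_measurable (M \<Otimes>\<^sub>M Leb1 a b)"
  by (rule measurable_Leb1_borel[OF measurable_fst], rule measurable_Leb1_borel[OF measurable_snd])

lemma indicator_in_Linf:
  assumes "{x \<in> space M. P x} \<in> sets M"
  shows "(\<lambda>x. indicator {x. P x} x :: real) \<in> Linf M"
proof -
  have "(\<lambda>x. indicator {x \<in> space M. P x} x :: real) \<in> borel_measurable M"
    using assms by simp
  then have "(\<lambda>x. indicator {x. P x} x :: real) \<in> borel_measurable M"
    by (rule measurable_cong[THEN iffD1, rotated]) (auto simp: indicator_def)
  moreover have "AE x in M. \<bar>indicator {x. P x} x :: real\<bar> \<le> 1"
    by (auto simp: indicator_def)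
  ultimately show ?thesis
    by (auto simp: Linf_def)
qed

definition PI_kernel ::
  "(real \<Rightarrow> real \<Rightarrow> real) \<Rightarrow> (real \<Rightarrow> real \<Rightarrow> real) \<Rightarrow> real \<Rightarrow> real \<Rightarrow> real" where
  "PI_kernel R1 R2 s \<theta> = indicator {..s} \<theta> * R1 s \<theta> + indicator {s..} \<theta> * R2 s \<theta>"

lemma PI_kernel_L2:
  assumes R: "(\<lambda>(s, \<theta>). R1 s \<theta>) \<in> L2 (Leb2 a b)" "(\<lambda>(s, \<theta>). R2 s \<theta>) \<in> L2 (Leb2 a b)"
  shows "(\<lambda>(s, \<theta>). PI_kernel R1 R2 s \<theta>) \<in> L2 (Leb2 a b)"
proof -
  have "(\<lambda>p. indicator {p. snd p \<le> fst p} p * (\<lambda>(s, \<theta>). R1 s \<theta>) p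
           + indicator {p. fst p \<le> snd p} p * (\<lambda>(s, \<theta>). R2 s \<theta>) p) \<in> L2 (Leb2 a b)"
    by (intro L2_add L2_Linf_mult indicator_in_Linf R borel_measurable_le measurable_Leb2_coords)
  then show ?thesis
    by (simp add: PI_kernel_def split_beta' indicator_def)
qed

lemma PI3_eq_kernel:
  assumes R: "(\<lambda>(s, \<theta>). R1 s \<theta>) \<in> L2 (Leb2 a b)" "(\<lambda>(s, \<theta>). R2 s \<theta>) \<in> L2 (Leb2 a b)"
    and v: "v \<in> L2 (Leb1 a b)"
  shows "L2_eq a b (PI3 a b R0 R1 R2 v)
     (\<lambda>s. R0 s * v s + (LINT \<theta>|Leb1 a b. PI_kernel R1 R2 s \<theta> * v \<theta>))"
  unfolding L2_eq_def
  using L2_AE_section[OF pair_sigma_finite_Leb1 R(1)] L2_AE_section[OF pair_sigma_finite_Leb1 R(2)]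
    AE_space
proof eventually_elim
  case (elim s)
  have ind: "(indicator {..s} :: real \<Rightarrow> real) \<in> Linf (Leb1 a b)"
    "(indicator {s..} :: real \<Rightarrow> real) \<in> Linf (Leb1 a b)"
    by (auto simp: Linf_def intro!: borel_measurable_Leb1I exI[of _ 1] AE_I2 split: split_indicator)
  have "integrable (Leb1 a b) (\<lambda>\<theta>. indicator {..s} \<theta> * (R1 s \<theta>) * v \<theta>)"
    "integrable (Leb1 a b) (\<lambda>\<theta>. indicator {s..} \<theta> * (R2 s \<theta>) * v \<theta>)"
    using elim v ind by (auto intro!: L2_mult_integrable L2_Linf_mult)
  moreover have "s \<in> {a..b}"
    using elim(3) by simp
  ultimately show ?case
    unfolding PI3_def PI_kernel_def distrib_right
    by (simp add: set_integral_Leb1_lower[OF \<open>s \<in> {a..b}\<close>]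
        set_integral_Leb1_upper[OF \<open>s \<in> {a..b}\<close>] mult.assoc del: atLeastAtMost_iff)
qed

text \<open>
  Operators enter the energy estimate only through inner products. The identity below makes \<open>R\<close>
  linear and invariant under almost everywhere equality as seen by inner products with \<open>L\<^sub>2\<close>.
\<close>

definition adjoint_pair :: "real \<Rightarrow> real \<Rightarrow> op1 \<Rightarrow> op1 \<Rightarrow> bool" where
  "adjoint_pair a b R S \<longleftrightarrow> (\<forall>v \<in> L2 (Leb1 a b). R v \<in> L2 (Leb1 a b)) \<and>
     (\<forall>w \<in> L2 (Leb1 a b). S w \<in> L2 (Leb1 a b) \<and>
       (\<forall>v \<in> L2 (Leb1 a b). L2_inner a b (R v) w = L2_inner a b v (S w)))"

lemma adjoint_pair_L2_adjoint:
  assumes "adjoint_pair a b R S"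
  shows "adjoint_pair a b R (L2_adjoint a b R)"
proof -
  let ?adj = "\<lambda>S. \<forall>w \<in> L2 (Leb1 a b). S w \<in> L2 (Leb1 a b) \<and>
     (\<forall>v \<in> L2 (Leb1 a b). L2_inner a b (R v) w = L2_inner a b v (S w))"
  have "?adj S"
    using assms by (simp add: adjoint_pair_def)
  then have "?adj (L2_adjoint a b R)"
    unfolding L2_adjoint_def by (rule someI[of ?adj])
  then show ?thesis
    using assms by (simp add: adjoint_pair_def)
qed

lemma Pi3_kernel_form:
  assumes "R \<in> Pi3 a b"
  obtains R0 k where "R0 \<in> Linf (Leb1 a b)" "(\<lambda>(s, \<theta>). k s \<theta>) \<in> L2 (Leb2 a b)"
    "\<And>v. v \<in> L2 (Leb1 a b) \<Longrightarrow>
       L2_eq a b (R v) (\<lambda>s. R0 s * v s + (LINT \<theta>|Leb1 a b. k s \<theta> * v \<theta>))"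
proof -
  obtain R0 R1 R2 where R: "R0 \<in> Linf (Leb1 a b)" "(\<lambda>(s, \<theta>). R1 s \<theta>) \<in> L2 (Leb2 a b)"
    "(\<lambda>(s, \<theta>). R2 s \<theta>) \<in> L2 (Leb2 a b)" "op_eq a b R (PI3 a b R0 R1 R2)"
    using assms by (auto simp: Pi3_def has_Pi3_kernels_def)
  show thesis
  proof (rule that)
    show "R0 \<in> Linf (Leb1 a b)" by fact
    show "(\<lambda>(s, \<theta>). PI_kernel R1 R2 s \<theta>) \<in> L2 (Leb2 a b)"
      by (rule PI_kernel_L2) fact+
    show "L2_eq a b (R v) (\<lambda>s. R0 s * v s + (LINT \<theta>|Leb1 a b. PI_kernel R1 R2 s \<theta> * v \<theta>))"
      if "v \<in> L2 (Leb1 a b)" for v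
      using R that PI3_eq_kernel[OF R(2,3) that] unfolding op_eq_def by (blast intro: L2_eq_trans)
  qed
qed

text \<open>
  The adjoint of a partial integral operator transposes its kernel, by Fubini's theorem.
\<close>

lemma Pi3_adjoint_pair:
  assumes "R \<in> Pi3 a b"
  shows "\<exists>S. adjoint_pair a b R S"
proof -
  let ?M = "Leb1 a b"
  obtain R0 k where R0: "R0 \<in> Linf ?M" and k: "(\<lambda>(s, \<theta>). k s \<theta>) \<in> L2 (Leb2 a b)"
    and R: "\<And>v. v \<in> L2 ?M \<Longrightarrow> L2_eq a b (R v) (\<lambda>s. R0 s * v s + (LINT \<theta>|?M. k s \<theta> * v \<theta>))"
    using Pi3_kernel_form[OF assms] by blast
  note psf = pair_sigma_finite_Leb1[of a b]
  note kT = L2_transpose[OF psf k]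
  define S where "S w \<theta> = R0 \<theta> * w \<theta> + (LINT s|?M. k s \<theta> * w s)" for w \<theta>
  have R_L2: "(\<lambda>s. R0 s * v s + (LINT \<theta>|?M. k s \<theta> * v \<theta>)) \<in> L2 ?M" if "v \<in> L2 ?M" for v
    by (intro L2_add L2_Linf_mult R0 that Hilbert_Schmidt(1)[OF psf k])
  have RvL2: "R v \<in> L2 ?M" if "v \<in> L2 ?M" for v
    using L2_eq_in_L2[OF R_L2[OF that] L2_eq_sym[OF R[OF that]]] .
  have S_L2: "S w \<in> L2 ?M" if "w \<in> L2 ?M" for w
    unfolding S_def by (intro L2_add L2_Linf_mult R0 that Hilbert_Schmidt(1)[OF psf kT])
  have "L2_inner a b (R v) w = L2_inner a b v (S w)" if v: "v \<in> L2 ?M" and w: "w \<in> L2 ?M" for v w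
  proof -
    have "L2_inner a b (R v) w = L2_inner a b (\<lambda>s. R0 s * v s + (LINT \<theta>|?M. k s \<theta> * v \<theta>)) w"
      by (rule L2_inner_cong) (use R[OF v] L2_eq_refl RvL2[OF v] w L2_measurable in auto)
    also have "\<dots> = L2_inner a b (\<lambda>s. R0 s * v s) w + L2_inner a b (\<lambda>s. LINT \<theta>|?M. k s \<theta> * v \<theta>) w"
      by (intro L2_inner_add_left L2_Linf_mult R0 v w Hilbert_Schmidt(1)[OF psf k])
    also have "L2_inner a b (\<lambda>s. R0 s * v s) w = L2_inner a b v (\<lambda>s. R0 s * w s)"
      by (simp add: L2_inner_def mult_ac)
    also have "L2_inner a b (\<lambda>s. LINT \<theta>|?M. k s \<theta> * v \<theta>) w = L2_inner a b v (\<lambda>\<theta>. LINT s|?M. k s \<theta> * w s)"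
      unfolding L2_inner_def by (rule kernel_transpose_inner[OF psf k v w])
    also have "L2_inner a b v (\<lambda>s. R0 s * w s) + \<dots> = L2_inner a b v (S w)"
      unfolding S_def
      by (intro L2_inner_add_right[symmetric] L2_Linf_mult R0 v w Hilbert_Schmidt(1)[OF psf kT])
    finally show ?thesis .
  qed
  then have "adjoint_pair a b R S"
    using S_L2 RvL2 by (auto simp: adjoint_pair_def)
  then show ?thesis
    by blast
qed

lemma Pi3_bounded:
  assumes "R \<in> Pi3 a b"
  shows "\<exists>C. \<forall>v \<in> L2 (Leb1 a b). L2_norm a b (R v) \<le> C * L2_norm a b v"
proof -
  let ?M = "Leb1 a b"
  obtain R0 k where R0: "R0 \<in> Linf ?M" and k: "(\<lambda>(s, \<theta>). k s \<theta>) \<in> L2 (Leb2 a b)"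
    and R: "\<And>v. v \<in> L2 ?M \<Longrightarrow> L2_eq a b (R v) (\<lambda>s. R0 s * v s + (LINT \<theta>|?M. k s \<theta> * v \<theta>))"
    using Pi3_kernel_form[OF assms] by blast
  note psf = pair_sigma_finite_Leb1[of a b]
  obtain C where C: "AE s in ?M. \<bar>R0 s\<bar> \<le> C"
    using R0 by (auto simp: Linf_def)
  define K where "K = (LINT s|?M. LINT \<theta>|?M. (k s \<theta>)\<^sup>2)"
  have "0 \<le> K"
    by (simp add: K_def)
  have "L2_norm a b (R v) \<le> sqrt (2 * C\<^sup>2 + 2 * K) * L2_norm a b v" if v: "v \<in> L2 ?M" for v
  proof -
    define w where "w s = (LINT \<theta>|?M. k s \<theta> * v \<theta>)" for s
    have w: "w \<in> L2 ?M" "L2_inner a b w w \<le> K * L2_inner a b v v"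
      using Hilbert_Schmidt[OF psf k v] by (simp_all add: w_def[abs_def] K_def L2_inner_def power2_eq_square)
    have Rv: "L2_eq a b (R v) (\<lambda>s. R0 s * v s + w s)"
      using R[OF v] by (simp add: w_def)
    have L2: "(\<lambda>s. R0 s * v s + w s) \<in> L2 ?M"
      by (intro L2_add L2_Linf_mult R0 v w)
    have "L2_inner a b (R v) (R v) = L2_inner a b (\<lambda>s. R0 s * v s + w s) (\<lambda>s. R0 s * v s + w s)"
      by (rule L2_inner_cong[symmetric]) (use L2 L2_measurable L2_eq_sym[OF Rv] in auto)
    also have "\<dots> \<le> (LINT s|?M. 2 * C\<^sup>2 * (v s * v s) + 2 * (w s * w s))"
      unfolding L2_inner_def
    proof (rule integral_mono_AE)
      show "AE s in ?M. (R0 s * v s + w s) * (R0 s * v s + w s) \<le> 2 * C\<^sup>2 * (v s * v s) + 2 * (w s * w s)"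
        using C
      proof eventually_elim
        case (elim s)
        have "(R0 s)\<^sup>2 * (v s)\<^sup>2 \<le> C\<^sup>2 * (v s)\<^sup>2"
          using elim by (intro mult_right_mono) (simp_all add: abs_le_square_iff[symmetric])
        moreover have "0 \<le> (R0 s * v s - w s)\<^sup>2"
          by simp
        ultimately show ?case
          by (simp add: power2_eq_square algebra_simps)
      qed
    qed (intro Bochner_Integration.integrable_add integrable_mult_right L2_mult_integrable v w L2)+
    also have "\<dots> = 2 * C\<^sup>2 * L2_inner a b v v + 2 * L2_inner a b w w"
      using L2_mult_integrable[OF v v] L2_mult_integrable[OF w(1) w(1)] by (simp add: L2_inner_def)
    also have "\<dots> \<le> (2 * C\<^sup>2 + 2 * K) * L2_inner a b v v"
      using w(2) by (simp add: algebra_simps)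
    finally show ?thesis
      by (simp add: L2_norm_def real_sqrt_mult[symmetric])
  qed
  then show ?thesis
    by blast
qed

lemma adjoint_pair_id: "adjoint_pair a b (\<lambda>v. v) (\<lambda>v. v)"
  by (simp add: adjoint_pair_def)

lemma adjoint_pair_mult_op:
  assumes "adjoint_pair a b R S" and c: "c \<in> Linf (Leb1 a b)"
  shows "adjoint_pair a b (\<lambda>v. mult_op c (R v)) (\<lambda>w. S (mult_op c w))"
proof -
  have "L2_inner a b (mult_op c f) w = L2_inner a b f (mult_op c w)" for f w
    by (simp add: L2_inner_def mult_op_def mult_ac)
  moreover have "mult_op c f \<in> L2 (Leb1 a b)" if "f \<in> L2 (Leb1 a b)" for f
    using L2_Linf_mult[OF c that] by (simp add: mult_op_def)
  ultimately show ?thesis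
    using assms by (simp add: adjoint_pair_def)
qed

lemma adjoint_pair_sum:
  assumes "\<And>i. i \<in> I \<Longrightarrow> adjoint_pair a b (R i) (S i)"
  shows "adjoint_pair a b (\<lambda>v s. \<Sum>i\<in>I. R i v s) (\<lambda>w s. \<Sum>i\<in>I. S i w s)"
  using assms unfolding adjoint_pair_def
  by (auto intro!: L2_sum simp: L2_inner_sum_left L2_inner_sum_right)

section \<open>The tensor product of two partial integral operators\<close>

lemma integrable_tensor:
  fixes f g :: "_ \<Rightarrow> real"
  assumes "pair_sigma_finite M N" and f: "integrable M f" and g: "integrable N g"
  shows "integrable (M \<Otimes>\<^sub>M N) (\<lambda>(x, y). f x * g y)"
proof -
  interpret pair_sigma_finite M N by fact
  have [measurable]: "f \<in> borel_measurable M" "g \<in> borel_measurable N"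
    using f g by auto
  show ?thesis
  proof (rule Fubini_integrable)
    show "integrable M (\<lambda>x. LINT y|N. norm ((\<lambda>(x, y). f x * g y) (x, y)))"
      using f g by (simp add: abs_mult)
    show "AE x in M. integrable N (\<lambda>y. (\<lambda>(x, y). f x * g y) (x, y))"
      using g by simp
  qed measurable
qed

lemma integrable_Leb1_indicator:
  fixes h :: "real \<Rightarrow> real"
  assumes A: "A \<in> sets borel" and h: "integrable (Leb1 a b) h"
  shows "integrable (Leb1 a b) (\<lambda>x. indicator A x * h x)"
proof (rule Bochner_Integration.integrable_bound[OF h])
  have "(indicator A :: real \<Rightarrow> real) \<in> borel_measurable (Leb1 a b)"
    by (rule borel_measurable_Leb1I) (use A in simp)
  then show "(\<lambda>x. indicator A x * h x) \<in> borel_measurable (Leb1 a b)"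
    using h by simp
qed (auto simp: indicator_def)

text \<open>
  Up to the diagonal, the square is the union of the triangle \<open>\<eta> \<le> \<theta>\<close> and its mirror image, and
  the second summand of the integrand is the mirror image of the first one.
\<close>

lemma triangle_symmetrisation:
  assumes f: "integrable (Leb1 a b) f" and g: "integrable (Leb1 a b) g"
  shows "(LINT \<theta>|Leb1 a b. LINT \<eta>|Leb1 a b. indicator {..\<theta>} \<eta> * (f \<theta> * g \<eta> + f \<eta> * g \<theta>))
     = (LINT \<theta>|Leb1 a b. f \<theta>) * (LINT \<eta>|Leb1 a b. g \<eta> :: real)"
proof -
  let ?M = "Leb1 a b"
  note psf = pair_sigma_finite_Leb1[of a b]
  interpret pair_sigma_finite ?M ?M by (rule psf)
  have ind: "integrable ?M (\<lambda>\<eta>. indicator {..\<theta>} \<eta> * h \<eta>)" "integrable ?M (\<lambda>\<eta>. indicator {\<theta>..} \<eta> * h \<eta>)"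
    if "integrable ?M h" for h :: "real \<Rightarrow> real" and \<theta>
    by (intro integrable_Leb1_indicator that; simp)+
  have tri: "{p \<in> space (?M \<Otimes>\<^sub>M ?M). snd p \<le> fst p} \<in> sets (?M \<Otimes>\<^sub>M ?M)"
    by (intro borel_measurable_le measurable_Leb2_coords)
  have lower: "integrable (?M \<Otimes>\<^sub>M ?M) (\<lambda>(\<theta>, \<eta>). indicator {..\<theta>} \<eta> * (p \<theta> * q \<eta>))"
    if "integrable ?M p" "integrable ?M q" for p q :: "real \<Rightarrow> real"
    using integrable_real_mult_indicator[OF tri integrable_tensor[OF psf that]]
    by (rule Bochner_Integration.integrable_cong[THEN iffD1, rotated 2])
      (auto simp: space_pair_measure indicator_def)
  have fst: "integrable ?M (\<lambda>\<theta>. LINT \<eta>|?M. indicator {..\<theta>} \<eta> * (p \<theta> * q \<eta>))"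
    if "integrable ?M p" "integrable ?M q" for p q :: "real \<Rightarrow> real"
    using integrable_fst'[OF lower[OF that]] by simp
  have mirror: "(LINT \<theta>|?M. LINT \<eta>|?M. indicator {..\<theta>} \<eta> * (g \<theta> * f \<eta>))
      = (LINT \<theta>|?M. LINT \<eta>|?M. indicator {\<theta>..} \<eta> * (f \<theta> * g \<eta>))"
    using Fubini_integral[OF lower[OF g f]] by (simp add: indicator_def mult.commute)
  have mirror_int: "integrable ?M (\<lambda>\<theta>. LINT \<eta>|?M. indicator {\<theta>..} \<eta> * (f \<theta> * g \<eta>))"
    using integrable_snd[OF lower[OF g f]] by (simp add: indicator_def mult.commute)
  have "(LINT \<theta>|?M. LINT \<eta>|?M. indicator {..\<theta>} \<eta> * (f \<theta> * g \<eta> + f \<eta> * g \<theta>))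
    = (LINT \<theta>|?M. (LINT \<eta>|?M. indicator {..\<theta>} \<eta> * (f \<theta> * g \<eta>)) + (LINT \<eta>|?M. indicator {..\<theta>} \<eta> * (g \<theta> * f \<eta>)))"
  proof (rule Bochner_Integration.integral_cong[OF refl])
    fix \<theta>
    have "integrable ?M (\<lambda>\<eta>. indicator {..\<theta>} \<eta> * (f \<theta> * g \<eta>))" "integrable ?M (\<lambda>\<eta>. indicator {..\<theta>} \<eta> * (g \<theta> * f \<eta>))"
      using f g by (intro ind; simp)+
    then show "(LINT \<eta>|?M. indicator {..\<theta>} \<eta> * (f \<theta> * g \<eta> + f \<eta> * g \<theta>)) =
      (LINT \<eta>|?M. indicator {..\<theta>} \<eta> * (f \<theta> * g \<eta>)) + (LINT \<eta>|?M. indicator {..\<theta>} \<eta> * (g \<theta> * f \<eta>))"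
      by (subst Bochner_Integration.integral_add[symmetric]) (simp_all add: algebra_simps)
  qed
  also have "\<dots> = (LINT \<theta>|?M. LINT \<eta>|?M. indicator {..\<theta>} \<eta> * (f \<theta> * g \<eta>))
      + (LINT \<theta>|?M. LINT \<eta>|?M. indicator {\<theta>..} \<eta> * (f \<theta> * g \<eta>))"
    using fst[OF f g] fst[OF g f] mirror by simp
  also have "\<dots> = (LINT \<theta>|?M. (LINT \<eta>|?M. indicator {..\<theta>} \<eta> * (f \<theta> * g \<eta>))
      + (LINT \<eta>|?M. indicator {\<theta>..} \<eta> * (f \<theta> * g \<eta>)))"
    using fst[OF f g] mirror_int by simp
  also have "\<dots> = (LINT \<theta>|?M. f \<theta> * (LINT \<eta>|?M. g \<eta>))"
  proof (rule Bochner_Integration.integral_cong[OF refl])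
    fix \<theta>
    have "integrable ?M (\<lambda>\<eta>. indicator {..\<theta>} \<eta> * (f \<theta> * g \<eta>))" "integrable ?M (\<lambda>\<eta>. indicator {\<theta>..} \<eta> * (f \<theta> * g \<eta>))"
      using g by (intro ind; simp)+
    note int = this
    then have "(LINT \<eta>|?M. indicator {..\<theta>} \<eta> * (f \<theta> * g \<eta>)) + (LINT \<eta>|?M. indicator {\<theta>..} \<eta> * (f \<theta> * g \<eta>))
      = (LINT \<eta>|?M. indicator {..\<theta>} \<eta> * (f \<theta> * g \<eta>) + indicator {\<theta>..} \<eta> * (f \<theta> * g \<eta>))"
      by simp
    also have "\<dots> = (LINT \<eta>|?M. f \<theta> * g \<eta>)"
    proof (rule integral_cong_AE)
      show "AE \<eta> in ?M. indicator {..\<theta>} \<eta> * (f \<theta> * g \<eta>) + indicator {\<theta>..} \<eta> * (f \<theta> * g \<eta>) = f \<theta> * g \<eta>"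
        using AE_Leb1_neq[of \<theta> a b] by eventually_elim (auto simp: indicator_def)
    qed (use int g in \<open>auto intro!: borel_measurable_add borel_measurable_integrable\<close>)
    finally show "(LINT \<eta>|?M. indicator {..\<theta>} \<eta> * (f \<theta> * g \<eta>)) + (LINT \<eta>|?M. indicator {\<theta>..} \<eta> * (f \<theta> * g \<eta>))
      = f \<theta> * (LINT \<eta>|?M. g \<eta>)"
      by simp
  qed
  finally show ?thesis
    by simp
qed

text \<open>
  With \<open>f1, f2\<close> and \<open>g1, g2\<close> the integrands of the two operators below and above \<open>s\<close>, the three
  regions of the tensor product collect the products \<open>\<integral>f1 \<integral>g1\<close>, the mixed ones, and \<open>\<integral>f2 \<integral>g2\<close>.
\<close>

lemma tensor_PI_diagonal:
  assumes s: "s \<in> {a..b}" and v: "v \<in> L2 (Leb1 a b)"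
    and SR: "S1 s \<in> L2 (Leb1 a b)" "S2 s \<in> L2 (Leb1 a b)" "R1 s \<in> L2 (Leb1 a b)" "R2 s \<in> L2 (Leb1 a b)"
  shows "tensor_PI a b S1 S2 R1 R2 (\<lambda>\<theta> \<eta>. v \<theta> * v \<eta>) s
     = PI3 a b (\<lambda>_. 0) S1 S2 v s * PI3 a b (\<lambda>_. 0) R1 R2 v s"
proof -
  let ?M = "Leb1 a b"
  define f1 where "f1 \<theta> = indicator {..s} \<theta> * (S1 s \<theta> * v \<theta>)" for \<theta>
  define f2 where "f2 \<theta> = indicator {s..} \<theta> * (S2 s \<theta> * v \<theta>)" for \<theta>
  define g1 where "g1 \<theta> = indicator {..s} \<theta> * (R1 s \<theta> * v \<theta>)" for \<theta>
  define g2 where "g2 \<theta> = indicator {s..} \<theta> * (R2 s \<theta> * v \<theta>)" for \<theta>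
  have ind: "(indicator {..s} :: real \<Rightarrow> real) \<in> Linf ?M" "(indicator {s..} :: real \<Rightarrow> real) \<in> Linf ?M"
    by (auto simp: Linf_def intro!: borel_measurable_Leb1I exI[of _ 1] AE_I2 split: split_indicator)
  have int [simp]: "integrable ?M f1" "integrable ?M f2" "integrable ?M g1" "integrable ?M g2"
    unfolding f1_def[abs_def] f2_def[abs_def] g1_def[abs_def] g2_def[abs_def] mult.assoc[symmetric]
    by (intro L2_mult_integrable L2_Linf_mult ind SR v)+
  have PI3_eq: "PI3 a b (\<lambda>_. 0) S1 S2 v s = integral\<^sup>L ?M f1 + integral\<^sup>L ?M f2"
    "PI3 a b (\<lambda>_. 0) R1 R2 v s = integral\<^sup>L ?M g1 + integral\<^sup>L ?M g2"
    unfolding PI3_def f1_def[abs_def] f2_def[abs_def] g1_def[abs_def] g2_def[abs_def]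
    by (simp_all only: set_integral_Leb1_lower[OF s] set_integral_Leb1_upper[OF s])
  have Q1: "(LINT \<theta>:{a..s}|lebesgue. LINT \<eta>:{a..\<theta>}|lebesgue.
      (S1 s \<theta> * R1 s \<eta> + S1 s \<eta> * R1 s \<theta>) * (v \<theta> * v \<eta>)) = integral\<^sup>L ?M f1 * integral\<^sup>L ?M g1"
  proof -
    have "indicator {..s} \<theta> * (LINT \<eta>:{a..\<theta>}|lebesgue. (S1 s \<theta> * R1 s \<eta> + S1 s \<eta> * R1 s \<theta>) * (v \<theta> * v \<eta>))
      = (LINT \<eta>|?M. indicator {..\<theta>} \<eta> * (f1 \<theta> * g1 \<eta> + f1 \<eta> * g1 \<theta>))" if "\<theta> \<in> {a..b}" for \<theta>
      unfolding set_integral_Leb1_lower[OF that] integral_mult_right_zero[symmetric]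
      by (rule Bochner_Integration.integral_cong)
        (auto simp: f1_def g1_def indicator_def algebra_simps)
    then show ?thesis
      unfolding set_integral_Leb1_lower[OF s] triangle_symmetrisation[OF int(1,3), symmetric]
      by (intro Bochner_Integration.integral_cong) simp_all
  qed
  have Q2: "(LINT \<theta>:{s..b}|lebesgue. LINT \<eta>:{a..s}|lebesgue.
      (S2 s \<theta> * R1 s \<eta> + S1 s \<eta> * R2 s \<theta>) * (v \<theta> * v \<eta>))
      = integral\<^sup>L ?M f2 * integral\<^sup>L ?M g1 + integral\<^sup>L ?M f1 * integral\<^sup>L ?M g2"
  proof -
    have "indicator {s..} \<theta> * (LINT \<eta>:{a..s}|lebesgue. (S2 s \<theta> * R1 s \<eta> + S1 s \<eta> * R2 s \<theta>) * (v \<theta> * v \<eta>))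
      = (LINT \<eta>|?M. f2 \<theta> * g1 \<eta> + g2 \<theta> * f1 \<eta>)" for \<theta>
      unfolding set_integral_Leb1_lower[OF s] integral_mult_right_zero[symmetric]
      by (rule Bochner_Integration.integral_cong)
        (auto simp: f1_def f2_def g1_def g2_def indicator_def algebra_simps)
    also have "(LINT \<eta>|?M. f2 \<theta> * g1 \<eta> + g2 \<theta> * f1 \<eta>)
      = f2 \<theta> * integral\<^sup>L ?M g1 + g2 \<theta> * integral\<^sup>L ?M f1" for \<theta>
      by simp
    finally have "(LINT \<theta>:{s..b}|lebesgue. LINT \<eta>:{a..s}|lebesgue.
      (S2 s \<theta> * R1 s \<eta> + S1 s \<eta> * R2 s \<theta>) * (v \<theta> * v \<eta>))
      = (LINT \<theta>|?M. f2 \<theta> * integral\<^sup>L ?M g1 + g2 \<theta> * integral\<^sup>L ?M f1)"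
      unfolding set_integral_Leb1_upper[OF s] by simp
    then show ?thesis
      by simp
  qed
  have Q3: "(LINT \<theta>:{s..b}|lebesgue. LINT \<eta>:{s..\<theta>}|lebesgue.
      (S2 s \<theta> * R2 s \<eta> + S2 s \<eta> * R2 s \<theta>) * (v \<theta> * v \<eta>)) = integral\<^sup>L ?M f2 * integral\<^sup>L ?M g2"
  proof -
    have "indicator {s..} \<theta> * (LINT \<eta>:{s..\<theta>}|lebesgue. (S2 s \<theta> * R2 s \<eta> + S2 s \<eta> * R2 s \<theta>) * (v \<theta> * v \<eta>))
      = (LINT \<eta>|?M. indicator {..\<theta>} \<eta> * (f2 \<theta> * g2 \<eta> + f2 \<eta> * g2 \<theta>))" if \<theta>: "\<theta> \<in> {a..b}" for \<theta>
    proof -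
      have "{s..\<theta>} \<subseteq> {a..b}" "{s..\<theta>} \<in> sets lebesgue"
        using s \<theta> by auto
      from set_integral_Leb1[OF this] show ?thesis
        unfolding integral_mult_right_zero[symmetric]
        by (simp only:, subst integral_mult_right_zero[symmetric], intro Bochner_Integration.integral_cong)
          (auto simp: f2_def g2_def indicator_def algebra_simps)
    qed
    then show ?thesis
      unfolding set_integral_Leb1_upper[OF s] triangle_symmetrisation[OF int(2,4), symmetric]
      by (intro Bochner_Integration.integral_cong) simp_all
  qed
  show ?thesis
    unfolding tensor_PI_def PI22_def Q1 Q2 Q3 PI3_eq by (simp add: algebra_simps)
qed

text \<open>
  On \<open>v \<otimes> v\<close> the tensor product is the pointwise product. This is what makes it represent the
  quadratic terms of the equation.
\<close>

lemma tensor_PI_diagonal_AE: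
  assumes v: "v \<in> L2 (Leb1 a b)"
    and S: "has_Pi2_kernels a b S S1 S2" and R: "has_Pi2_kernels a b R R1 R2"
  shows "L2_eq a b (tensor_PI a b S1 S2 R1 R2 (\<lambda>\<theta> \<eta>. v \<theta> * v \<eta>)) (\<lambda>s. S v s * R v s)"
proof -
  note psf = pair_sigma_finite_Leb1[of a b]
  have k: "(\<lambda>(s, \<theta>). S1 s \<theta>) \<in> L2 (Leb2 a b)" "(\<lambda>(s, \<theta>). S2 s \<theta>) \<in> L2 (Leb2 a b)"
    "(\<lambda>(s, \<theta>). R1 s \<theta>) \<in> L2 (Leb2 a b)" "(\<lambda>(s, \<theta>). R2 s \<theta>) \<in> L2 (Leb2 a b)"
    and eq: "AE s in Leb1 a b. S v s = PI3 a b (\<lambda>_. 0) S1 S2 v s"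
      "AE s in Leb1 a b. R v s = PI3 a b (\<lambda>_. 0) R1 R2 v s"
    using S R v by (auto simp: has_Pi2_kernels_def has_Pi3_kernels_def op_eq_def L2_eq_def)
  show ?thesis
    unfolding L2_eq_def
    using L2_AE_section[OF psf k(1)] L2_AE_section[OF psf k(2)] L2_AE_section[OF psf k(3)]
      L2_AE_section[OF psf k(4)] eq AE_space
    by eventually_elim (use v in \<open>simp add: tensor_PI_diagonal\<close>)
qed

section \<open>Fubini's theorem on the cube\<close>

lemma has_bochner_integral_measure_preserving:
  fixes f :: "_ \<Rightarrow> real"
  assumes g: "g \<in> M \<rightarrow>\<^sub>M M" and M: "distr M M g = M" and f: "has_bochner_integral M f I"
  shows "has_bochner_integral M (\<lambda>x. f (g x)) I"
proof -
  have "f \<in> borel_measurable M"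
    using f by (simp add: borel_measurable_has_bochner_integral)
  from integrable_distr_eq[OF g this] integral_distr[OF g this] show ?thesis
    using f by (simp add: M has_bochner_integral_iff)
qed

context
  fixes M :: "'a measure"
  assumes sf: "sigma_finite_measure M"
begin

lemma nn_integral_triple:
  assumes [measurable]: "f \<in> borel_measurable (M \<Otimes>\<^sub>M M \<Otimes>\<^sub>M M)"
  shows "(\<integral>\<^sup>+x. \<integral>\<^sup>+y. \<integral>\<^sup>+z. f (x, y, z) \<partial>M \<partial>M \<partial>M) = (\<integral>\<^sup>+p. f p \<partial>(M \<Otimes>\<^sub>M M \<Otimes>\<^sub>M M))"
proof -
  interpret sigma_finite_measure M by (rule sf)
  interpret P: sigma_finite_measure "M \<Otimes>\<^sub>M M"
    by (intro sigma_finite_pair_measure sf)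
  have "(\<integral>\<^sup>+p. f p \<partial>(M \<Otimes>\<^sub>M M \<Otimes>\<^sub>M M)) = (\<integral>\<^sup>+x. \<integral>\<^sup>+q. f (x, q) \<partial>(M \<Otimes>\<^sub>M M) \<partial>M)"
    by (rule P.nn_integral_fst[symmetric]) measurable
  also have "\<dots> = (\<integral>\<^sup>+x. \<integral>\<^sup>+y. \<integral>\<^sup>+z. f (x, y, z) \<partial>M \<partial>M \<partial>M)"
  proof (rule nn_integral_cong)
    fix x assume [measurable]: "x \<in> space M"
    show "(\<integral>\<^sup>+q. f (x, q) \<partial>(M \<Otimes>\<^sub>M M)) = (\<integral>\<^sup>+y. \<integral>\<^sup>+z. f (x, y, z) \<partial>M \<partial>M)"
      by (rule nn_integral_fst[symmetric]) measurable
  qed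
  finally show ?thesis ..
qed

text \<open>
  The two transpositions of neighbouring coordinates generate all changes of the order of
  integration.
\<close>

lemma distr_swap_outer:
  "distr (M \<Otimes>\<^sub>M M \<Otimes>\<^sub>M M) (M \<Otimes>\<^sub>M M \<Otimes>\<^sub>M M) (\<lambda>(x, y, z). (y, x, z)) = M \<Otimes>\<^sub>M M \<Otimes>\<^sub>M M"
proof (rule measure_eqI)
  interpret pair_sigma_finite M M by (intro pair_sigma_finite.intro sf)
  fix A assume "A \<in> sets (distr (M \<Otimes>\<^sub>M M \<Otimes>\<^sub>M M) (M \<Otimes>\<^sub>M M \<Otimes>\<^sub>M M) (\<lambda>(x, y, z). (y, x, z)))"
  then have A [measurable]: "A \<in> sets (M \<Otimes>\<^sub>M M \<Otimes>\<^sub>M M)"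
    by simp
  have [measurable]: "(\<lambda>(x, y, z). (y, x, z)) \<in> M \<Otimes>\<^sub>M M \<Otimes>\<^sub>M M \<rightarrow>\<^sub>M M \<Otimes>\<^sub>M M \<Otimes>\<^sub>M M"
    by measurable
  have "emeasure (distr (M \<Otimes>\<^sub>M M \<Otimes>\<^sub>M M) (M \<Otimes>\<^sub>M M \<Otimes>\<^sub>M M) (\<lambda>(x, y, z). (y, x, z))) A
      = (\<integral>\<^sup>+p. indicator A p \<partial>distr (M \<Otimes>\<^sub>M M \<Otimes>\<^sub>M M) (M \<Otimes>\<^sub>M M \<Otimes>\<^sub>M M) (\<lambda>(x, y, z). (y, x, z)))"
    by simp
  also have "\<dots> = (\<integral>\<^sup>+p. indicator A ((\<lambda>(x, y, z). (y, x, z)) p) \<partial>(M \<Otimes>\<^sub>M M \<Otimes>\<^sub>M M))"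
    by (rule nn_integral_distr) measurable
  also have "\<dots> = (\<integral>\<^sup>+x. \<integral>\<^sup>+y. \<integral>\<^sup>+z. indicator A (y, x, z) \<partial>M \<partial>M \<partial>M)"
    by (subst nn_integral_triple[symmetric]) simp_all
  also have "\<dots> = (\<integral>\<^sup>+y. \<integral>\<^sup>+x. \<integral>\<^sup>+z. indicator A (y, x, z) \<partial>M \<partial>M \<partial>M)"
    by (rule Fubini') measurable
  also have "\<dots> = emeasure (M \<Otimes>\<^sub>M M \<Otimes>\<^sub>M M) A"
    by (simp add: nn_integral_triple)
  finally show "emeasure (distr (M \<Otimes>\<^sub>M M \<Otimes>\<^sub>M M) (M \<Otimes>\<^sub>M M \<Otimes>\<^sub>M M) (\<lambda>(x, y, z). (y, x, z))) A
    = emeasure (M \<Otimes>\<^sub>M M \<Otimes>\<^sub>M M) A" .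
qed simp

lemma distr_swap_inner:
  "distr (M \<Otimes>\<^sub>M M \<Otimes>\<^sub>M M) (M \<Otimes>\<^sub>M M \<Otimes>\<^sub>M M) (\<lambda>(x, y, z). (x, z, y)) = M \<Otimes>\<^sub>M M \<Otimes>\<^sub>M M"
proof (rule measure_eqI)
  interpret pair_sigma_finite M M by (intro pair_sigma_finite.intro sf)
  fix A assume "A \<in> sets (distr (M \<Otimes>\<^sub>M M \<Otimes>\<^sub>M M) (M \<Otimes>\<^sub>M M \<Otimes>\<^sub>M M) (\<lambda>(x, y, z). (x, z, y)))"
  then have A [measurable]: "A \<in> sets (M \<Otimes>\<^sub>M M \<Otimes>\<^sub>M M)"
    by simp
  have [measurable]: "(\<lambda>(x, y, z). (x, z, y)) \<in> M \<Otimes>\<^sub>M M \<Otimes>\<^sub>M M \<rightarrow>\<^sub>M M \<Otimes>\<^sub>M M \<Otimes>\<^sub>M M"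
    by measurable
  have "emeasure (distr (M \<Otimes>\<^sub>M M \<Otimes>\<^sub>M M) (M \<Otimes>\<^sub>M M \<Otimes>\<^sub>M M) (\<lambda>(x, y, z). (x, z, y))) A
      = (\<integral>\<^sup>+p. indicator A p \<partial>distr (M \<Otimes>\<^sub>M M \<Otimes>\<^sub>M M) (M \<Otimes>\<^sub>M M \<Otimes>\<^sub>M M) (\<lambda>(x, y, z). (x, z, y)))"
    by simp
  also have "\<dots> = (\<integral>\<^sup>+p. indicator A ((\<lambda>(x, y, z). (x, z, y)) p) \<partial>(M \<Otimes>\<^sub>M M \<Otimes>\<^sub>M M))"
    by (rule nn_integral_distr) measurable
  also have "\<dots> = (\<integral>\<^sup>+x. \<integral>\<^sup>+y. \<integral>\<^sup>+z. indicator A (x, z, y) \<partial>M \<partial>M \<partial>M)"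
    by (subst nn_integral_triple[symmetric]) simp_all
  also have "\<dots> = (\<integral>\<^sup>+x. \<integral>\<^sup>+z. \<integral>\<^sup>+y. indicator A (x, z, y) \<partial>M \<partial>M \<partial>M)"
  proof (rule nn_integral_cong)
    fix x assume [measurable]: "x \<in> space M"
    show "(\<integral>\<^sup>+y. \<integral>\<^sup>+z. indicator A (x, z, y) \<partial>M \<partial>M) = (\<integral>\<^sup>+z. \<integral>\<^sup>+y. indicator A (x, z, y) \<partial>M \<partial>M)"
      by (rule Fubini') measurable
  qed
  also have "\<dots> = emeasure (M \<Otimes>\<^sub>M M \<Otimes>\<^sub>M M) A"
    by (simp add: nn_integral_triple)
  finally show "emeasure (distr (M \<Otimes>\<^sub>M M \<Otimes>\<^sub>M M) (M \<Otimes>\<^sub>M M \<Otimes>\<^sub>M M) (\<lambda>(x, y, z). (x, z, y))) A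
    = emeasure (M \<Otimes>\<^sub>M M \<Otimes>\<^sub>M M) A" .
qed simp

lemma has_bochner_integral_swap_outer:
  fixes f :: "'a \<Rightarrow> 'a \<Rightarrow> 'a \<Rightarrow> real"
  assumes "has_bochner_integral (M \<Otimes>\<^sub>M M \<Otimes>\<^sub>M M) (\<lambda>(x, y, z). f x y z) I"
  shows "has_bochner_integral (M \<Otimes>\<^sub>M M \<Otimes>\<^sub>M M) (\<lambda>(x, y, z). f y x z) I"
proof -
  have "(\<lambda>(x, y, z). (y, x, z)) \<in> M \<Otimes>\<^sub>M M \<Otimes>\<^sub>M M \<rightarrow>\<^sub>M M \<Otimes>\<^sub>M M \<Otimes>\<^sub>M M"
    by measurable
  from has_bochner_integral_measure_preserving[OF this distr_swap_outer assms] show ?thesis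
    by (simp add: split_beta')
qed

lemma has_bochner_integral_swap_inner:
  fixes f :: "'a \<Rightarrow> 'a \<Rightarrow> 'a \<Rightarrow> real"
  assumes "has_bochner_integral (M \<Otimes>\<^sub>M M \<Otimes>\<^sub>M M) (\<lambda>(x, y, z). f x y z) I"
  shows "has_bochner_integral (M \<Otimes>\<^sub>M M \<Otimes>\<^sub>M M) (\<lambda>(x, y, z). f x z y) I"
proof -
  have "(\<lambda>(x, y, z). (x, z, y)) \<in> M \<Otimes>\<^sub>M M \<Otimes>\<^sub>M M \<rightarrow>\<^sub>M M \<Otimes>\<^sub>M M \<Otimes>\<^sub>M M"
    by measurable
  from has_bochner_integral_measure_preserving[OF this distr_swap_inner assms] show ?thesis
    by (simp add: split_beta')
qed

lemma has_bochner_integral_iterated: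
  fixes f :: "'a \<Rightarrow> 'a \<Rightarrow> 'a \<Rightarrow> real"
  assumes f: "has_bochner_integral (M \<Otimes>\<^sub>M M \<Otimes>\<^sub>M M) (\<lambda>(x, y, z). f x y z) I"
  shows "has_bochner_integral M (\<lambda>x. LINT y|M. LINT z|M. f x y z) I"
proof -
  interpret sigma_finite_measure M by (rule sf)
  interpret P: pair_sigma_finite M M by (intro pair_sigma_finite.intro sf)
  interpret Q: pair_sigma_finite M "M \<Otimes>\<^sub>M M"
    by (intro pair_sigma_finite.intro sigma_finite_pair_measure sf)
  have int: "integrable (M \<Otimes>\<^sub>M M \<Otimes>\<^sub>M M) (\<lambda>(x, y, z). f x y z)"
    and I: "I = (LINT (x, y, z)|(M \<Otimes>\<^sub>M M \<Otimes>\<^sub>M M). f x y z)"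
    using f by (auto simp: has_bochner_integral_iff)
  have [measurable]: "(\<lambda>(x, y, z). f x y z) \<in> borel_measurable (M \<Otimes>\<^sub>M M \<Otimes>\<^sub>M M)"
    using int by auto
  have AE: "AE x in M. (LINT (y, z)|(M \<Otimes>\<^sub>M M). f x y z) = (LINT y|M. LINT z|M. f x y z)"
    using Q.AE_integrable_fst'[OF int]
  proof eventually_elim
    case (elim x)
    then have "integrable (M \<Otimes>\<^sub>M M) (\<lambda>(y, z). f x y z)"
      by (simp add: split_beta')
    from P.integral_fst'[OF this] show ?case
      by simp
  qed
  have "has_bochner_integral M (\<lambda>x. LINT (y, z)|(M \<Otimes>\<^sub>M M). f x y z) I"
    unfolding has_bochner_integral_iff I
    using Q.integrable_fst'[OF int] Q.integral_fst'[OF int] by (simp add: split_beta')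
  moreover have "(\<lambda>p. (\<lambda>(x, y, z). f x y z) (fst (fst p), snd (fst p), snd p))
      \<in> borel_measurable ((M \<Otimes>\<^sub>M M) \<Otimes>\<^sub>M M)"
    by measurable
  then have "(\<lambda>x. LINT y|M. LINT z|M. f x y z) \<in> borel_measurable M"
    by (intro borel_measurable_lebesgue_integral) (simp add: split_beta')
  ultimately show ?thesis
    using AE by (subst has_bochner_integral_cong_AE[symmetric])
      (auto dest: borel_measurable_has_bochner_integral)
qed

end

section \<open>The cubic functional of an operator on the square\<close>

lemma L2_cube:
  assumes v: "v \<in> L2 (Leb1 a b)"
  shows "(\<lambda>(s, \<theta>, \<eta>). v s * (v \<theta> * v \<eta>)) \<in> L2 (Leb3 a b)"
proof -
  have "(\<lambda>(s, p). v s * (\<lambda>(\<theta>, \<eta>). v \<theta> * v \<eta>) p) \<in> L2 (Leb3 a b)"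
    by (intro L2_tensor v pair_sigma_finite.intro sigma_finite_Leb1 sigma_finite_Leb2)
  then show ?thesis
    by (simp add: split_beta')
qed

lemma measurable_Leb3_coords:
  "(\<lambda>p. fst p) \<in> borel_measurable (Leb3 a b)"
  "(\<lambda>p. fst (snd p)) \<in> borel_measurable (Leb3 a b)"
  "(\<lambda>p. snd (snd p)) \<in> borel_measurable (Leb3 a b)"
  by (rule measurable_Leb1_borel, rule measurable_fst,
      rule measurable_Leb1_borel, rule measurable_compose[OF measurable_snd measurable_fst],
      rule measurable_Leb1_borel, rule measurable_compose[OF measurable_snd measurable_snd])

text \<open>
  Exchanging the order of integration maps each of the three regions of integration of
  \<open>\<langle>v, PI22 a b G1 G2 G3 (v \<otimes> v)\<rangle>\<close> onto the simplex \<open>\<eta> \<le> \<theta> \<le> s\<close>, with the permuted kernels that are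
  summed up in the definition of the cubic functional; the weight \<open>v \<otimes> v \<otimes> v\<close> is symmetric.
\<close>

lemma PI22_diagonal_inner_eq_Klin:
  assumes G: "(\<lambda>(s, \<theta>, \<eta>). G1 s \<theta> \<eta>) \<in> L2 (Leb3 a b)" "(\<lambda>(s, \<theta>, \<eta>). G2 s \<theta> \<eta>) \<in> L2 (Leb3 a b)"
      "(\<lambda>(s, \<theta>, \<eta>). G3 s \<theta> \<eta>) \<in> L2 (Leb3 a b)"
    and v: "v \<in> L2 (Leb1 a b)"
  shows "L2_inner a b v (PI22 a b G1 G2 G3 (\<lambda>\<theta> \<eta>. v \<theta> * v \<eta>))
    = Klin a b G1 G2 G3 (\<lambda>s \<theta> \<eta>. v s * (v \<theta> * v \<eta>))"
proof -
  let ?M = "Leb1 a b"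
  note sf = sigma_finite_Leb1[of a b]
  note w = L2_cube[OF v]
  define D1 :: "real \<Rightarrow> real \<Rightarrow> real \<Rightarrow> real" where
    "D1 s \<theta> \<eta> = indicator {..s} \<theta> * indicator {..\<theta>} \<eta>" for s \<theta> \<eta>
  define D2 :: "real \<Rightarrow> real \<Rightarrow> real \<Rightarrow> real" where
    "D2 s \<theta> \<eta> = indicator {s..} \<theta> * indicator {..s} \<eta>" for s \<theta> \<eta>
  define D3 :: "real \<Rightarrow> real \<Rightarrow> real \<Rightarrow> real" where
    "D3 s \<theta> \<eta> = indicator {s..} \<theta> * indicator {s..\<theta>} \<eta>" for s \<theta> \<eta>
  let ?H = "\<lambda>D G s \<theta> \<eta>. D s \<theta> \<eta> * (G s \<theta> \<eta> * (v s * (v \<theta> * v \<eta>)))"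
  have H: "\<exists>I. has_bochner_integral (Leb3 a b) (\<lambda>(s, \<theta>, \<eta>). ?H D G s \<theta> \<eta>) I"
    if G: "(\<lambda>(s, \<theta>, \<eta>). G s \<theta> \<eta>) \<in> L2 (Leb3 a b)"
      and D: "(\<lambda>(s, \<theta>, \<eta>). D s \<theta> \<eta>) \<in> Linf (Leb3 a b)" for D G
  proof -
    have "integrable (Leb3 a b) (\<lambda>p. (\<lambda>(s, \<theta>, \<eta>). D s \<theta> \<eta>) p * (\<lambda>(s, \<theta>, \<eta>). G s \<theta> \<eta>) p
        * (\<lambda>(s, \<theta>, \<eta>). v s * (v \<theta> * v \<eta>)) p)"
      by (intro L2_mult_integrable L2_Linf_mult G D w)
    then show ?thesis
      by (auto simp: has_bochner_integral_iff split_beta' mult.assoc)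
  qed
  have ind: "(\<lambda>p. indicator {p. P p} p :: real) \<in> Linf (Leb3 a b)"
    if "{p \<in> space (Leb3 a b). P p} \<in> sets (Leb3 a b)" for P
    using that by (rule indicator_in_Linf)
  have "(\<lambda>p. indicator {p. fst (snd p) \<le> fst p \<and> snd (snd p) \<le> fst (snd p)} p :: real) \<in> Linf (Leb3 a b)"
    by (intro ind sets.sets_Collect_conj borel_measurable_le measurable_Leb3_coords)
  then have D1: "(\<lambda>(s, \<theta>, \<eta>). D1 s \<theta> \<eta>) \<in> Linf (Leb3 a b)"
    by (rule rev_iffD1) (rule arg_cong[where f = "\<lambda>f. f \<in> _"], auto simp: D1_def indicator_def fun_eq_iff)
  have "(\<lambda>p. indicator {p. fst p \<le> fst (snd p) \<and> snd (snd p) \<le> fst p} p :: real) \<in> Linf (Leb3 a b)"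
    by (intro ind sets.sets_Collect_conj borel_measurable_le measurable_Leb3_coords)
  then have D2: "(\<lambda>(s, \<theta>, \<eta>). D2 s \<theta> \<eta>) \<in> Linf (Leb3 a b)"
    by (rule rev_iffD1) (rule arg_cong[where f = "\<lambda>f. f \<in> _"], auto simp: D2_def indicator_def fun_eq_iff)
  have "(\<lambda>p. indicator {p. fst p \<le> snd (snd p) \<and> snd (snd p) \<le> fst (snd p)} p :: real) \<in> Linf (Leb3 a b)"
    by (intro ind sets.sets_Collect_conj borel_measurable_le measurable_Leb3_coords)
  then have D3: "(\<lambda>(s, \<theta>, \<eta>). D3 s \<theta> \<eta>) \<in> Linf (Leb3 a b)"
    by (rule rev_iffD1) (rule arg_cong[where f = "\<lambda>f. f \<in> _"], auto simp: D3_def indicator_def fun_eq_iff)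
  obtain I1 I2 I3 where
    I1: "has_bochner_integral (Leb3 a b) (\<lambda>(s, \<theta>, \<eta>). ?H D1 G1 s \<theta> \<eta>) I1" and
    I2: "has_bochner_integral (Leb3 a b) (\<lambda>(s, \<theta>, \<eta>). ?H D2 G2 s \<theta> \<eta>) I2" and
    I3: "has_bochner_integral (Leb3 a b) (\<lambda>(s, \<theta>, \<eta>). ?H D3 G3 s \<theta> \<eta>) I3"
    using H[OF G(1) D1] H[OF G(2) D2] H[OF G(3) D3] by blast
  have "L2_inner a b v (PI22 a b G1 G2 G3 (\<lambda>\<theta> \<eta>. v \<theta> * v \<eta>)) = I1 + I2 + I3"
  proof -
    have "v s * PI22 a b G1 G2 G3 (\<lambda>\<theta> \<eta>. v \<theta> * v \<eta>) s
      = (LINT \<theta>|?M. LINT \<eta>|?M. ?H D1 G1 s \<theta> \<eta>) + (LINT \<theta>|?M. LINT \<eta>|?M. ?H D2 G2 s \<theta> \<eta>)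
        + (LINT \<theta>|?M. LINT \<eta>|?M. ?H D3 G3 s \<theta> \<eta>)" if s: "s \<in> {a..b}" for s
    proof -
      have "v s * (LINT \<theta>:{a..s}|lebesgue. LINT \<eta>:{a..\<theta>}|lebesgue. G1 s \<theta> \<eta> * (v \<theta> * v \<eta>))
        = (LINT \<theta>|?M. LINT \<eta>|?M. ?H D1 G1 s \<theta> \<eta>)"
        unfolding set_integral_Leb1_lower[OF s] integral_mult_right_zero[symmetric]
      proof (rule Bochner_Integration.integral_cong[OF refl])
        fix \<theta> assume "\<theta> \<in> space ?M"
        then have \<theta>: "\<theta> \<in> {a..b}"
          by simp
        show "v s * (indicator {..s} \<theta> * (LINT \<eta>:{a..\<theta>}|lebesgue. G1 s \<theta> \<eta> * (v \<theta> * v \<eta>)))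
          = (LINT \<eta>|?M. ?H D1 G1 s \<theta> \<eta>)"
          unfolding set_integral_Leb1_lower[OF \<theta>] integral_mult_right_zero[symmetric]
          by (intro Bochner_Integration.integral_cong) (auto simp: D1_def)
      qed
      moreover have "v s * (LINT \<theta>:{s..b}|lebesgue. LINT \<eta>:{a..s}|lebesgue. G2 s \<theta> \<eta> * (v \<theta> * v \<eta>))
        = (LINT \<theta>|?M. LINT \<eta>|?M. ?H D2 G2 s \<theta> \<eta>)"
        unfolding set_integral_Leb1_lower[OF s] set_integral_Leb1_upper[OF s] integral_mult_right_zero[symmetric]
        by (intro Bochner_Integration.integral_cong) (auto simp: D2_def)
      moreover have "v s * (LINT \<theta>:{s..b}|lebesgue. LINT \<eta>:{s..\<theta>}|lebesgue. G3 s \<theta> \<eta> * (v \<theta> * v \<eta>))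
        = (LINT \<theta>|?M. LINT \<eta>|?M. ?H D3 G3 s \<theta> \<eta>)"
        unfolding set_integral_Leb1_upper[OF s] integral_mult_right_zero[symmetric]
      proof (rule Bochner_Integration.integral_cong[OF refl])
        fix \<theta> assume "\<theta> \<in> space ?M"
        then have "{s..\<theta>} \<subseteq> {a..b}" "{s..\<theta>} \<in> sets lebesgue"
          using s by auto
        note eq = set_integral_Leb1[OF this]
        show "v s * (indicator {s..} \<theta> * (LINT \<eta>:{s..\<theta>}|lebesgue. G3 s \<theta> \<eta> * (v \<theta> * v \<eta>)))
          = (LINT \<eta>|?M. ?H D3 G3 s \<theta> \<eta>)"
          unfolding eq integral_mult_right_zero[symmetric]
          by (intro Bochner_Integration.integral_cong) (auto simp: D3_def)
      qed
      ultimately show ?thesis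
        by (simp only: PI22_def distrib_left)
    qed
    then have "L2_inner a b v (PI22 a b G1 G2 G3 (\<lambda>\<theta> \<eta>. v \<theta> * v \<eta>))
      = (LINT s|?M. (LINT \<theta>|?M. LINT \<eta>|?M. ?H D1 G1 s \<theta> \<eta>) + (LINT \<theta>|?M. LINT \<eta>|?M. ?H D2 G2 s \<theta> \<eta>)
        + (LINT \<theta>|?M. LINT \<eta>|?M. ?H D3 G3 s \<theta> \<eta>))"
      unfolding L2_inner_def by (intro Bochner_Integration.integral_cong) simp_all
    also have "\<dots> = I1 + I2 + I3"
      by (intro has_bochner_integral_integral_eq has_bochner_integral_add
          has_bochner_integral_iterated[OF sf] I1 I2 I3)
    finally show ?thesis .
  qed
  moreover have "Klin a b G1 G2 G3 (\<lambda>s \<theta> \<eta>. v s * (v \<theta> * v \<eta>)) = I1 + I2 + I3"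
  proof -
    note I2' = has_bochner_integral_swap_outer[OF sf I2]
    note I3' = has_bochner_integral_swap_inner[OF sf has_bochner_integral_swap_outer[OF sf I3]]
    have "has_bochner_integral (Leb3 a b) (\<lambda>(s, \<theta>, \<eta>).
        D1 s \<theta> \<eta> * ((G1 s \<theta> \<eta> + G2 \<theta> s \<eta> + G3 \<eta> s \<theta>) * (v s * (v \<theta> * v \<eta>)))) (I1 + I2 + I3)"
      using has_bochner_integral_add[OF has_bochner_integral_add[OF I1 I2'] I3']
      by (rule rev_iffD1) (intro has_bochner_integral_cong,
          auto simp: D1_def D2_def D3_def indicator_def algebra_simps)
    from has_bochner_integral_integral_eq[OF has_bochner_integral_iterated[OF sf this]]
    have "I1 + I2 + I3 = (LINT s|?M. LINT \<theta>|?M. LINT \<eta>|?M.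
        D1 s \<theta> \<eta> * ((G1 s \<theta> \<eta> + G2 \<theta> s \<eta> + G3 \<eta> s \<theta>) * (v s * (v \<theta> * v \<eta>))))"
      by simp
    also have "\<dots> = Klin a b G1 G2 G3 (\<lambda>s \<theta> \<eta>. v s * (v \<theta> * v \<eta>))"
    proof -
      have "{a..b} \<subseteq> {a..b}" "{a..b} \<in> sets lebesgue"
        by auto
      note outer = set_integral_Leb1[OF this]
      show ?thesis
        unfolding Klin_def outer
      proof (rule Bochner_Integration.integral_cong[OF refl])
        fix s assume "s \<in> space ?M"
        then have s: "s \<in> {a..b}"
          by simp
        show "(LINT \<theta>|?M. LINT \<eta>|?M. D1 s \<theta> \<eta> * ((G1 s \<theta> \<eta> + G2 \<theta> s \<eta> + G3 \<eta> s \<theta>) * (v s * (v \<theta> * v \<eta>))))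
          = indicator {a..b} s * (LINT \<theta>:{a..s}|lebesgue. LINT \<eta>:{a..\<theta>}|lebesgue.
            (G1 s \<theta> \<eta> + G2 \<theta> s \<eta> + G3 \<eta> s \<theta>) * (v s * (v \<theta> * v \<eta>)))"
          unfolding set_integral_Leb1_lower[OF s] integral_mult_right_zero[symmetric]
        proof (rule Bochner_Integration.integral_cong[OF refl])
          fix \<theta> assume "\<theta> \<in> space ?M"
          then have \<theta>: "\<theta> \<in> {a..b}"
            by simp
          show "(LINT \<eta>|?M. D1 s \<theta> \<eta> * ((G1 s \<theta> \<eta> + G2 \<theta> s \<eta> + G3 \<eta> s \<theta>) * (v s * (v \<theta> * v \<eta>))))
            = indicator {a..b} s * (indicator {..s} \<theta> * (LINT \<eta>:{a..\<theta>}|lebesgue.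
              (G1 s \<theta> \<eta> + G2 \<theta> s \<eta> + G3 \<eta> s \<theta>) * (v s * (v \<theta> * v \<eta>))))"
            unfolding set_integral_Leb1_lower[OF \<theta>] integral_mult_right_zero[symmetric]
            by (intro Bochner_Integration.integral_cong) (use s in \<open>auto simp: D1_def\<close>)
        qed
      qed
    qed
    finally show ?thesis
      by simp
  qed
  ultimately show ?thesis
    by simp
qed

section \<open>Test functions and the fundamental lemma\<close>

definition test_function :: "real \<Rightarrow> real \<Rightarrow> (real \<Rightarrow> real) \<Rightarrow> (real \<Rightarrow> real) \<Rightarrow> bool" where
  "test_function a b \<phi> \<phi>' \<longleftrightarrow> (\<forall>x. (\<phi> has_real_derivative \<phi>' x) (at x)) \<and> continuous_on UNIV \<phi>' \<and>
     (\<exists>c d. a < c \<and> d < b \<and> (\<forall>x. x \<notin> {c..d} \<longrightarrow> \<phi> x = 0))"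

lemma has_weak_deriv_iff:
  "has_weak_deriv a b u v \<longleftrightarrow> (\<forall>\<phi> \<phi>'. test_function a b \<phi> \<phi>' \<longrightarrow>
     (LINT x|Leb1 a b. u x * \<phi>' x) = - (LINT x|Leb1 a b. v x * \<phi> x))"
  by (simp add: has_weak_deriv_def test_function_def)

lemma test_function_continuous:
  assumes "test_function a b \<phi> \<phi>'"
  shows "continuous_on S \<phi>" "continuous_on S \<phi>'"
proof -
  have "isCont \<phi> x" for x
    using assms by (auto simp: test_function_def intro: DERIV_isCont)
  then show "continuous_on S \<phi>"
    by (simp add: continuous_at_imp_continuous_on)
  show "continuous_on S \<phi>'"
    using assms continuous_on_subset by (auto simp: test_function_def)
qed

lemma test_function_L2:
  assumes "test_function a b \<phi> \<phi>'"
  shows "\<phi> \<in> L2 (Leb1 a b)" "\<phi>' \<in> L2 (Leb1 a b)"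
  using test_function_continuous[OF assms] by (auto intro: continuous_in_L2)

lemma DERIV_positive_part_square:
  "((\<lambda>x. (max 0 x)\<^sup>2) has_real_derivative 2 * max 0 x) (at (x :: real))"
proof -
  \<comment> \<open>The second-order Taylor remainder is bounded by the square of the increment.\<close>
  have bound: "\<bar>(max 0 y)\<^sup>2 - (max 0 x)\<^sup>2 - 2 * max 0 x * (y - x)\<bar> \<le> (y - x)\<^sup>2" for y
  proof (cases "0 \<le> x"; cases "0 \<le> y")
    assume "0 \<le> x" "\<not> 0 \<le> y"
    then have "x * y \<le> 0"
      by (auto simp: mult_nonneg_nonpos)
    moreover have "0 \<le> x * x"
      by simp
    ultimately have "0 \<le> x * x - 2 * (x * y)"
      by linarith
    then show ?thesis
      using \<open>0 \<le> x\<close> \<open>\<not> 0 \<le> y\<close> by (simp add: power2_eq_square algebra_simps)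
  next
    assume "\<not> 0 \<le> x" "0 \<le> y"
    then have "x * y \<le> 0"
      by (auto simp: mult_nonpos_nonneg)
    then show ?thesis
      using \<open>\<not> 0 \<le> x\<close> \<open>0 \<le> y\<close> by (simp add: power2_eq_square algebra_simps)
  next
    assume "0 \<le> x" "0 \<le> y"
    then have "(max 0 y)\<^sup>2 - (max 0 x)\<^sup>2 - 2 * max 0 x * (y - x) = (y - x)\<^sup>2"
      by (simp add: power2_eq_square algebra_simps)
    then show ?thesis
      by simp
  qed simp
  have "((\<lambda>y. ((max 0 y)\<^sup>2 - (max 0 x)\<^sup>2) / (y - x) - 2 * max 0 x) \<longlongrightarrow> 0) (at x)"
  proof (rule Lim_null_comparison)
    show "((\<lambda>y. \<bar>y - x\<bar>) \<longlongrightarrow> 0) (at x)"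
      by (auto intro!: tendsto_eq_intros)
    show "\<forall>\<^sub>F y in at x. norm (((max 0 y)\<^sup>2 - (max 0 x)\<^sup>2) / (y - x) - 2 * max 0 x) \<le> \<bar>y - x\<bar>"
      unfolding eventually_at_filter
    proof (rule always_eventually, intro allI impI)
      fix y assume "y \<noteq> x"
      then have "((max 0 y)\<^sup>2 - (max 0 x)\<^sup>2) / (y - x) - 2 * max 0 x
        = ((max 0 y)\<^sup>2 - (max 0 x)\<^sup>2 - 2 * max 0 x * (y - x)) / (y - x)"
        by (simp add: field_simps)
      moreover have "\<bar>\<dots>\<bar> \<le> (y - x)\<^sup>2 / \<bar>y - x\<bar>"
        unfolding abs_divide by (intro divide_right_mono bound) simp
      moreover have "(y - x)\<^sup>2 / \<bar>y - x\<bar> = \<bar>y - x\<bar>"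
        using \<open>y \<noteq> x\<close> by (simp add: field_simps power2_eq_square)
      ultimately show "norm (((max 0 y)\<^sup>2 - (max 0 x)\<^sup>2) / (y - x) - 2 * max 0 x) \<le> \<bar>y - x\<bar>"
        by simp
    qed
  qed
  then show ?thesis
    by (simp add: has_field_derivative_iff LIM_zero_iff)
qed

text \<open>
  \<open>plateau c d\<close> is positive exactly on the open interval from \<open>c\<close> to \<open>d\<close>; composing it with
  \<open>r \<mapsto> k r / (1 + k r)\<close> and letting \<open>k\<close> grow gives test functions approximating the indicator function.
\<close>

definition plateau :: "real \<Rightarrow> real \<Rightarrow> real \<Rightarrow> real" where
  "plateau c d x = (max 0 (x - c))\<^sup>2 * (max 0 (d - x))\<^sup>2"

lemma plateau_nonneg: "0 \<le> plateau c d x"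
  by (simp add: plateau_def)

lemma test_function_plateau:
  assumes "a < c" "d < b" "0 \<le> k"
  shows "\<exists>\<phi>'. test_function a b (\<lambda>x. 1 - 1 / (1 + k * plateau c d x)) \<phi>'"
proof -
  define \<rho>' where
    "\<rho>' x = 2 * max 0 (x - c) * (max 0 (d - x))\<^sup>2 - (max 0 (x - c))\<^sup>2 * (2 * max 0 (d - x))" for x
  have \<rho>: "(plateau c d has_real_derivative \<rho>' x) (at x)" for x
  proof -
    have 1: "((\<lambda>x. (max 0 (x - c))\<^sup>2) has_real_derivative 2 * max 0 (x - c)) (at x)"
    proof -
      have "((\<lambda>x. x - c) has_real_derivative 1) (at x)"
        by (auto intro!: derivative_eq_intros)
      from DERIV_chain2[where f = "\<lambda>x. (max 0 x)\<^sup>2", OF DERIV_positive_part_square this]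
      show ?thesis
        by simp
    qed
    have 2: "((\<lambda>x. (max 0 (d - x))\<^sup>2) has_real_derivative - (2 * max 0 (d - x))) (at x)"
    proof -
      have "((\<lambda>x. d - x) has_real_derivative - 1) (at x)"
        by (auto intro!: derivative_eq_intros)
      from DERIV_chain2[where f = "\<lambda>x. (max 0 x)\<^sup>2", OF DERIV_positive_part_square this]
      show ?thesis
        by simp
    qed
    have "((\<lambda>x. (max 0 (x - c))\<^sup>2 * (max 0 (d - x))\<^sup>2) has_real_derivative \<rho>' x) (at x)"
      using DERIV_mult[OF 1 2] by (simp add: \<rho>'_def algebra_simps)
    then show ?thesis
      by (simp add: plateau_def[abs_def])
  qed
  have pos: "1 + k * plateau c d x > 0" for x
    using plateau_nonneg[of c d x] assms(3) by (simp add: add_pos_nonneg)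
  have "((\<lambda>x. 1 - 1 / (1 + k * plateau c d x)) has_real_derivative
      k * \<rho>' x / (1 + k * plateau c d x)\<^sup>2) (at x)" for x
    using pos[of x] by (auto intro!: derivative_eq_intros \<rho> simp: power2_eq_square)
  moreover have "continuous_on UNIV (\<lambda>x. k * \<rho>' x / (1 + k * plateau c d x)\<^sup>2)"
    unfolding \<rho>'_def plateau_def
    by (intro continuous_intros ballI) (use pos plateau_def in \<open>simp add: less_imp_neq[symmetric]\<close>)
  moreover have "1 - 1 / (1 + k * plateau c d x) = 0" if "x \<notin> {c..d}" for x
    using that by (auto simp: plateau_def max_def)
  ultimately have "test_function a b (\<lambda>x. 1 - 1 / (1 + k * plateau c d x))
      (\<lambda>x. k * \<rho>' x / (1 + k * plateau c d x)\<^sup>2)"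
    using assms unfolding test_function_def by blast
  then show ?thesis
    by blast
qed

lemma plateau_tendsto_indicator:
  "(\<lambda>n. 1 - 1 / (1 + real n * plateau (c + 1 / real n) (d - 1 / real n) x)) \<longlonglongrightarrow> indicator {c<..<d} x"
proof (cases "x \<in> {c<..<d}")
  case True
  have "(\<lambda>n. plateau (c + 1 / real n) (d - 1 / real n) x) \<longlonglongrightarrow> plateau (c + 0) (d - 0) x"
    unfolding plateau_def by (intro tendsto_intros lim_1_over_n)
  moreover have "0 < plateau (c + 0) (d - 0) x"
    using True by (simp add: plateau_def)
  ultimately have "filterlim (\<lambda>n. plateau (c + 1 / real n) (d - 1 / real n) x * real n) at_top sequentially"
    by (rule filterlim_tendsto_pos_mult_at_top) (rule filterlim_real_sequentially)
  then have "filterlim (\<lambda>n. 1 + real n * plateau (c + 1 / real n) (d - 1 / real n) x) at_top sequentially"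
    by (intro filterlim_tendsto_add_at_top[OF tendsto_const]) (simp add: mult.commute)
  then have "(\<lambda>n. 1 - 1 / (1 + real n * plateau (c + 1 / real n) (d - 1 / real n) x)) \<longlonglongrightarrow> 1 - 0"
    by (intro tendsto_diff tendsto_const real_tendsto_divide_at_top[OF tendsto_const])
  then show ?thesis
    using True by simp
next
  case False
  have "plateau (c + 1 / real n) (d - 1 / real n) x = 0" for n
  proof (cases "x \<le> c")
    case True
    have "0 \<le> 1 / real n"
      by simp
    then have "x - (c + 1 / real n) \<le> 0"
      using True by linarith
    then show ?thesis
      by (simp add: plateau_def max_def)
  next
    case F: False
    have "0 \<le> 1 / real n"
      by simp
    then have "d - 1 / real n - x \<le> 0"
      using F False by (simp only: greaterThanLessThan_iff) linarith
    then show ?thesis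
      by (simp add: plateau_def max_def)
  qed
  then show ?thesis
    using False by simp
qed

lemma Leb1_integral_eq_lebesgue:
  "(LINT x|Leb1 a b. f x) = (LINT x|lebesgue. (if x \<in> {a..b} then f x else 0 :: real))"
  by (rule Lebesgue_Measure.integral_restrict_UNIV[symmetric]) simp

text \<open>
  The integral over every interval vanishes, by dominated convergence; the intervals generate the
  Borel sets, which exhaust the Lebesgue measurable sets up to null sets.
\<close>

lemma fundamental_lemma:
  assumes h: "integrable (Leb1 a b) h"
    and zero: "\<And>\<phi> \<phi>'. test_function a b \<phi> \<phi>' \<Longrightarrow> (LINT x|Leb1 a b. h x * \<phi> x) = 0"
  shows "L2_eq a b h (\<lambda>_. 0)"
proof -
  have interval: "(LINT x|Leb1 a b. h x * indicator {c<..d} x) = 0" for c d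
  proof -
    define c' where "c' = max a c"
    define d' where "d' = min b d"
    let ?\<phi> = "\<lambda>n x. 1 - 1 / (1 + real n * plateau (c' + 1 / real n) (d' - 1 / real n) x)"
    have conv: "(\<lambda>n. LINT x|Leb1 a b. h x * ?\<phi> (Suc n) x) \<longlonglongrightarrow> (LINT x|Leb1 a b. h x * indicator {c'<..<d'} x)"
    proof (rule integral_dominated_convergence)
      show "integrable (Leb1 a b) (\<lambda>x. \<bar>h x\<bar>)"
        using h by simp
      have ind: "(indicator {c'<..<d'} :: real \<Rightarrow> real) \<in> borel_measurable (Leb1 a b)"
        by (rule borel_measurable_Leb1I) simp
      show "(\<lambda>x. h x * indicator {c'<..<d'} x) \<in> borel_measurable (Leb1 a b)"
        using h ind by simp
      show "(\<lambda>x. h x * ?\<phi> (Suc n) x) \<in> borel_measurable (Leb1 a b)" for n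
      proof -
        have "?\<phi> (Suc n) \<in> borel_measurable (Leb1 a b)"
          by (rule borel_measurable_Leb1I) (simp add: plateau_def)
        then show ?thesis
          using h by (intro borel_measurable_times) auto
      qed
      show "AE x in Leb1 a b. (\<lambda>n. h x * ?\<phi> (Suc n) x) \<longlonglongrightarrow> h x * indicator {c'<..<d'} x"
        by (intro AE_I2 tendsto_mult tendsto_const LIMSEQ_Suc[OF plateau_tendsto_indicator])
      show "AE x in Leb1 a b. norm (h x * ?\<phi> (Suc n) x) \<le> \<bar>h x\<bar>" for n
      proof (rule AE_I2)
        fix x
        have "0 \<le> real (Suc n) * plateau (c' + 1 / real (Suc n)) (d' - 1 / real (Suc n)) x"
          by (simp add: plateau_nonneg)
        then have "\<bar>?\<phi> (Suc n) x\<bar> \<le> 1"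
          by (simp add: field_simps)
        then show "norm (h x * ?\<phi> (Suc n) x) \<le> \<bar>h x\<bar>"
          by (simp add: abs_mult mult_left_le)
      qed
    qed
    have "(LINT x|Leb1 a b. h x * ?\<phi> (Suc n) x) = 0" for n
    proof -
      have "0 < 1 / real (Suc n)"
        by simp
      then have "a < c' + 1 / real (Suc n)" "d' - 1 / real (Suc n) < b"
        unfolding c'_def d'_def by linarith+
      then show ?thesis
        using test_function_plateau[of a _ _ b "real (Suc n)"] zero by fastforce
    qed
    then have "(LINT x|Leb1 a b. h x * indicator {c'<..<d'} x) = 0"
      using LIMSEQ_unique[OF conv] by simp
    moreover have "(LINT x|Leb1 a b. h x * indicator {c<..d} x) = (LINT x|Leb1 a b. h x * indicator {c'<..<d'} x)"
    proof (rule integral_cong_AE)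
      have ind: "(indicator {c'<..<d'} :: real \<Rightarrow> real) \<in> borel_measurable (Leb1 a b)"
        "(indicator {c<..d} :: real \<Rightarrow> real) \<in> borel_measurable (Leb1 a b)"
        by (rule borel_measurable_Leb1I, simp)+
      show "(\<lambda>x. h x * indicator {c<..d} x) \<in> borel_measurable (Leb1 a b)"
        "(\<lambda>x. h x * indicator {c'<..<d'} x) \<in> borel_measurable (Leb1 a b)"
        using h ind by simp_all
      show "AE x in Leb1 a b. h x * indicator {c<..d} x = h x * indicator {c'<..<d'} x"
        using AE_Leb1_neq[of a a b] AE_Leb1_neq[of b a b] AE_Leb1_neq[of d a b] AE_space
        by eventually_elim (auto simp: c'_def d'_def indicator_def)
    qed
    ultimately show ?thesis
      by simp
  qed
  define H where "H x = (if x \<in> {a..b} then h x else 0)" for x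
  have H: "integrable lebesgue H"
  proof -
    have "integrable lebesgue (\<lambda>x. indicator {a..b} x *\<^sub>R h x)"
      using h by (subst (asm) integrable_restrict_space) auto
    then show ?thesis
      by (rule Bochner_Integration.integrable_cong[THEN iffD1, rotated 2]) (auto simp: H_def)
  qed
  have H_int: "(LINT x:A|lebesgue. H x) = (LINT x|Leb1 a b. h x * indicator A x)" for A
    unfolding Leb1_integral_eq_lebesgue set_lebesgue_integral_def
    by (intro Bochner_Integration.integral_cong) (auto simp: H_def)
  have setH: "set_integrable lebesgue A H" if "A \<in> sets lebesgue" for A
    using integrable_mult_indicator[OF that H] by (simp add: set_integrable_def)
  have whole: "(LINT x:UNIV|lebesgue. H x) = 0"
  proof -
    have "(LINT x|Leb1 a b. h x * indicator UNIV x) = (LINT x|Leb1 a b. h x * indicator {a - 1<..b} x)"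
      by (rule Bochner_Integration.integral_cong) (auto simp: indicator_def)
    then show ?thesis
      using interval by (simp only: H_int)
  qed
  have borel: "(LINT x:A|lebesgue. H x) = 0" if A: "A \<in> sets borel" for A
  proof -
    let ?G = "range (\<lambda>(c, d). {c<..d::real})"
    have closed: "?G \<subseteq> Pow UNIV"
      by simp
    have stable: "Int_stable ?G"
    proof (rule Int_stableI)
      fix A B assume "A \<in> ?G" "B \<in> ?G"
      then obtain c d c' d' where "A = {c<..d}" "B = {c'<..d'}"
        by auto
      then have "A \<inter> B = (\<lambda>(c, d). {c<..d}) (max c c', min d d')"
        by auto
      then show "A \<inter> B \<in> ?G"
        by blast
    qed
    have "sets borel = sigma_sets UNIV ?G"
      unfolding borel_sigma_sets_Ioc by simp
    then have sub: "B \<in> sets lebesgue" if "B \<in> sigma_sets UNIV ?G" for B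
      using that by simp
    have "A \<in> sigma_sets UNIV ?G"
      using A \<open>sets borel = _\<close> by simp
    then show ?thesis
    proof (induction A rule: sigma_sets_induct_disjoint[OF stable closed, consumes 1,
          case_names basic empty compl union])
      case (basic A)
      then show ?case
        using interval by (auto simp: H_int)
    next
      case (compl A)
      have "(LINT x:(A \<union> (UNIV - A))|lebesgue. H x) = (LINT x:A|lebesgue. H x) + (LINT x:(UNIV - A)|lebesgue. H x)"
        using sub[OF compl(1)] by (intro set_integral_Un setH) auto
      then show ?case
        using compl(2) whole by simp
    next
      case (union A)
      have meas: "A i \<in> sets lebesgue" for i
        by (rule sub) (use union(2) in blast)
      have "(LINT x:(\<Union>i. A i)|lebesgue. H x) = (\<Sum>i. LINT x:A i|lebesgue. H x)"
        using union(1) meas by (intro lebesgue_integral_countable_add setH sets.countable_UN)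
          (auto simp: disjoint_family_on_def)
      then show ?case
        using union(3) by simp
    qed (auto simp: set_lebesgue_integral_def)
  qed
  have "AE x in lebesgue. H x = 0"
  proof (rule density_unique_real[OF H integrable_zero])
    fix A :: "real set" assume "A \<in> sets lebesgue"
    then obtain S N N' where A: "A = S \<union> N" "N \<subseteq> N'" "N' \<in> null_sets lborel" "S \<in> sets lborel"
      by (rule sets_completionE)
    have "N' \<in> null_sets lebesgue"
      using A(3) by (rule null_sets_completionI)
    then have "AE x in lebesgue. x \<notin> N'"
      by (rule AE_not_in)
    then have "AE x in lebesgue. x \<in> S \<longleftrightarrow> x \<in> A"
      by eventually_elim (use A in auto)
    then have "(LINT x:A|lebesgue. H x) = (LINT x:S|lebesgue. H x)"
      using setH[OF \<open>A \<in> sets lebesgue\<close>] setH[of S] A(4)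
      by (intro set_integral_cong_set) (auto simp: set_integrable_def set_borel_measurable_def)
    then show "(LINT x:A|lebesgue. H x) = (LINT x:A|lebesgue. 0)"
      using borel A(4) by simp
  qed
  then have "AE x in Leb1 a b. H x = 0"
    by (subst AE_restrict_space_iff) (auto elim: eventually_mono)
  then show ?thesis
    unfolding L2_eq_def using AE_space by eventually_elim (simp add: H_def)
qed

section \<open>Weak derivatives on an interval\<close>

lemma has_weak_deriv_cong:
  assumes "has_weak_deriv a b u v" "L2_eq a b u u'" "L2_eq a b v v'"
    and u: "u \<in> L2 (Leb1 a b)" and v: "v \<in> L2 (Leb1 a b)"
  shows "has_weak_deriv a b u' v'"
  unfolding has_weak_deriv_iff
proof (intro allI impI)
  fix \<phi> \<phi>' assume \<phi>: "test_function a b \<phi> \<phi>'"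
  note meas = test_function_L2[OF \<phi>, THEN L2_measurable] u[THEN L2_measurable] v[THEN L2_measurable]
  have "L2_inner a b u \<phi>' = L2_inner a b u' \<phi>'" "L2_inner a b v \<phi> = L2_inner a b v' \<phi>"
    by (rule L2_inner_cong; use assms meas L2_eq_refl in blast)+
  then show "(LINT x|Leb1 a b. u' x * \<phi>' x) = - (LINT x|Leb1 a b. v' x * \<phi> x)"
    using assms(1) \<phi> by (simp add: has_weak_deriv_iff L2_inner_def)
qed

lemma has_weak_deriv_diff:
  assumes "has_weak_deriv a b u1 v1" "has_weak_deriv a b u2 v2"
    and "u1 \<in> L2 (Leb1 a b)" "v1 \<in> L2 (Leb1 a b)" "u2 \<in> L2 (Leb1 a b)" "v2 \<in> L2 (Leb1 a b)"
  shows "has_weak_deriv a b (\<lambda>x. u1 x - u2 x) (\<lambda>x. v1 x - v2 x)"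
  unfolding has_weak_deriv_iff
proof (intro allI impI)
  fix \<phi> \<phi>' assume \<phi>: "test_function a b \<phi> \<phi>'"
  have "(LINT x|Leb1 a b. u1 x * \<phi>' x) = - (LINT x|Leb1 a b. v1 x * \<phi> x)"
    "(LINT x|Leb1 a b. u2 x * \<phi>' x) = - (LINT x|Leb1 a b. v2 x * \<phi> x)"
    using assms(1,2) \<phi> by (auto simp: has_weak_deriv_iff)
  then show "(LINT x|Leb1 a b. (u1 x - u2 x) * \<phi>' x) = - (LINT x|Leb1 a b. (v1 x - v2 x) * \<phi> x)"
    using assms(3-) test_function_L2[OF \<phi>] by (simp add: left_diff_distrib L2_mult_integrable)
qed

lemma has_weak_deriv_unique:
  assumes "has_weak_deriv a b u v1" "has_weak_deriv a b u v2"
    and "v1 \<in> L2 (Leb1 a b)" "v2 \<in> L2 (Leb1 a b)"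
  shows "L2_eq a b v1 v2"
proof -
  have "L2_eq a b (\<lambda>x. v1 x - v2 x) (\<lambda>_. 0)"
  proof (rule fundamental_lemma)
    show "integrable (Leb1 a b) (\<lambda>x. v1 x - v2 x)"
      using assms by (intro L2_integrable L2_diff)
    fix \<phi> \<phi>' assume \<phi>: "test_function a b \<phi> \<phi>'"
    have "(LINT x|Leb1 a b. v1 x * \<phi> x) = (LINT x|Leb1 a b. v2 x * \<phi> x)"
      using assms(1,2) \<phi> by (auto simp: has_weak_deriv_iff)
    then show "(LINT x|Leb1 a b. (v1 x - v2 x) * \<phi> x) = 0"
      using assms(3-) test_function_L2[OF \<phi>] by (simp add: left_diff_distrib L2_mult_integrable)
  qed
  then show ?thesis
    unfolding L2_eq_def by (rule eventually_mono) simp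
qed

lemma FTC_Leb1:
  assumes "a \<le> b" and "\<And>x. (F has_real_derivative f x) (at x)" and f: "continuous_on UNIV f"
  shows "(LINT x:{a..b}|lebesgue. f x) = F b - F a"
proof -
  have "set_integrable lebesgue {a..b} f"
    by (rule absolutely_integrable_continuous_real) (rule continuous_on_subset[OF f], simp)
  moreover have "(f has_integral F b - F a) {a..b}"
    using assms by (intro fundamental_theorem_of_calculus)
      (auto simp: has_real_derivative_iff_has_vector_derivative[symmetric] intro: DERIV_subset)
  ultimately show ?thesis
    by (simp add: set_lebesgue_integral_eq_integral integral_unique)
qed

lemma Leb1_integral_set: "(LINT x|Leb1 a b. f x) = (LINT x:{a..b}|lebesgue. f x :: real)"
  unfolding set_lebesgue_integral_def by (rule Bochner_Integration.integral_restrict_space) simp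

lemma test_function_diff_scaled:
  assumes "test_function a b \<phi> \<phi>'" "test_function a b \<psi> \<psi>'"
  shows "test_function a b (\<lambda>x. \<phi> x - m * \<psi> x) (\<lambda>x. \<phi>' x - m * \<psi>' x)"
proof -
  obtain c1 d1 c2 d2 where cd: "a < c1" "d1 < b" "a < c2" "d2 < b"
    and \<phi>: "\<And>x. x \<notin> {c1..d1} \<Longrightarrow> \<phi> x = 0" and \<psi>: "\<And>x. x \<notin> {c2..d2} \<Longrightarrow> \<psi> x = 0"
    using assms unfolding test_function_def by metis
  have "\<phi> x - m * \<psi> x = 0" if "x \<notin> {min c1 c2..max d1 d2}" for x
  proof -
    have "x \<notin> {c1..d1}" "x \<notin> {c2..d2}"
      using that by auto
    then show ?thesis
      using \<phi> \<psi> by simp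
  qed
  moreover have "a < min c1 c2" "max d1 d2 < b"
    using cd by auto
  moreover have "continuous_on UNIV (\<lambda>x. \<phi>' x - m * \<psi>' x)"
    using assms by (intro continuous_intros) (auto simp: test_function_def)
  moreover have "((\<lambda>x. \<phi> x - m * \<psi> x) has_real_derivative \<phi>' x - m * \<psi>' x) (at x)" for x
    using assms by (auto simp: test_function_def intro!: derivative_eq_intros)
  ultimately show ?thesis
    unfolding test_function_def by blast
qed

text \<open>
  An antiderivative is constant on either side of the support of \<open>\<phi>\<close>. Mean zero makes the two
  constants agree, so one shift gives it compact support.
\<close>

lemma test_function_antiderivative:
  assumes "a < b" and \<phi>: "test_function a b \<phi> \<phi>'" and mean: "(LINT x|Leb1 a b. \<phi> x) = 0"
  shows "\<exists>\<Phi>. test_function a b \<Phi> \<phi>"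
proof -
  obtain c d where cd: "a < c" "d < b" and out: "\<And>x. x \<notin> {c..d} \<Longrightarrow> \<phi> x = 0"
    using \<phi> unfolding test_function_def by metis
  have "isCont \<phi> x" for x
    using \<phi> by (auto simp: test_function_def intro: DERIV_isCont)
  then have "\<exists>F. \<forall>x. - \<infinity> < ereal x \<longrightarrow> ereal x < \<infinity> \<longrightarrow> (F has_vector_derivative \<phi> x) (at x)"
    by (intro einterval_antiderivative) auto
  then obtain F where F: "\<And>x. (F has_real_derivative \<phi> x) (at x)"
    by (auto simp: has_real_derivative_iff_has_vector_derivative)
  have "F b - F a = 0"
    using FTC_Leb1[OF _ F test_function_continuous(1)[OF \<phi>], of a b] mean \<open>a < b\<close>
    by (simp add: Leb1_integral_set)
  obtain k1 where k1: "\<And>x. x < c \<Longrightarrow> F x = k1"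
    using has_field_derivative_zero_constant[of "{..<c}" F] F out DERIV_subset[OF F]
    by (metis atLeastAtMost_iff convex_real_interval(4) lessThan_iff linorder_not_le subset_UNIV)
  obtain k2 where k2: "\<And>x. d < x \<Longrightarrow> F x = k2"
    using has_field_derivative_zero_constant[of "{d<..}" F] F out DERIV_subset[OF F]
    by (metis atLeastAtMost_iff convex_real_interval(3) greaterThan_iff linorder_not_le subset_UNIV)
  have "F x - F a = 0" if "x \<notin> {c..d}" for x
    using that k1[of x] k1[of a] k2[of x] k2[of b] cd \<open>F b - F a = 0\<close> by (cases "x < c") auto
  moreover have "((\<lambda>x. F x - F a) has_real_derivative \<phi> x) (at x)" for x
    using F by (auto intro!: derivative_eq_intros)
  ultimately have "test_function a b (\<lambda>x. F x - F a) \<phi>"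
    using cd test_function_continuous(1)[OF \<phi>] unfolding test_function_def by blast
  then show ?thesis
    by blast
qed

text \<open>
  The lemma of du Bois-Reymond: subtracting a multiple of a fixed test function with nonzero integral
  turns every test function into a derivative.
\<close>

lemma weak_deriv_zero_imp_const:
  assumes "a < b" and u: "u \<in> L2 (Leb1 a b)" and zero: "has_weak_deriv a b u (\<lambda>_. 0)"
  shows "\<exists>c. L2_eq a b u (\<lambda>_. c)"
proof -
  have "\<exists>\<psi> \<psi>'. test_function a b \<psi> \<psi>' \<and> (LINT x|Leb1 a b. \<psi> x) \<noteq> 0"
  proof (rule ccontr)
    assume "\<not> ?thesis"
    moreover have one: "(\<lambda>_. 1) \<in> L2 (Leb1 a b)"
      by (intro continuous_in_L2 continuous_on_const)
    ultimately have "L2_eq a b (\<lambda>_. 1) (\<lambda>_. 0)"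
      by (intro fundamental_lemma L2_integrable) auto
    then have "(LINT x|Leb1 a b. 1 :: real) = 0"
      by (intro integral_eq_zero_AE) (simp add: L2_eq_def)
    then show False
      using FTC_Leb1[of a b "\<lambda>x. x" "\<lambda>_. 1"] \<open>a < b\<close> unfolding Leb1_integral_set by simp
  qed
  then obtain \<psi> \<psi>' where \<psi>: "test_function a b \<psi> \<psi>'" "(LINT x|Leb1 a b. \<psi> x) \<noteq> 0"
    by blast
  define J where "J = (LINT x|Leb1 a b. \<psi> x)"
  define c where "c = (LINT x|Leb1 a b. u x * \<psi> x) / J"
  have const: "(\<lambda>_. c) \<in> L2 (Leb1 a b)"
    by (intro continuous_in_L2 continuous_on_const)
  have "L2_eq a b (\<lambda>x. u x - c) (\<lambda>_. 0)"
  proof (rule fundamental_lemma)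
    show "integrable (Leb1 a b) (\<lambda>x. u x - c)"
      by (intro L2_integrable L2_diff u const)
    fix \<phi> \<phi>' assume \<phi>: "test_function a b \<phi> \<phi>'"
    note int = test_function_L2(1)[OF \<phi>] test_function_L2(1)[OF \<psi>(1)]
    define m where "m = (LINT x|Leb1 a b. \<phi> x) / J"
    have "(LINT x|Leb1 a b. \<phi> x - m * \<psi> x) = 0"
      using \<psi>(2) int by (simp add: L2_integrable m_def J_def)
    then obtain \<Phi> where "test_function a b \<Phi> (\<lambda>x. \<phi> x - m * \<psi> x)"
      using test_function_antiderivative[OF \<open>a < b\<close> test_function_diff_scaled[OF \<phi> \<psi>(1)]] by blast
    then have "(LINT x|Leb1 a b. u x * (\<phi> x - m * \<psi> x)) = 0"
      using zero by (auto simp: has_weak_deriv_iff)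
    also have "(\<lambda>x. u x * (\<phi> x - m * \<psi> x)) = (\<lambda>x. u x * \<phi> x - m * (u x * \<psi> x))"
      by (auto simp: algebra_simps)
    finally have "(LINT x|Leb1 a b. u x * \<phi> x) = m * (LINT x|Leb1 a b. u x * \<psi> x)"
      using u int by (simp add: L2_mult_integrable)
    then have "(LINT x|Leb1 a b. u x * \<phi> x) = c * (LINT x|Leb1 a b. \<phi> x)"
      by (simp add: m_def c_def)
    then show "(LINT x|Leb1 a b. (u x - c) * \<phi> x) = 0"
      using u int by (simp add: left_diff_distrib L2_mult_integrable L2_integrable)
  qed
  then show ?thesis
    unfolding L2_eq_def by (auto elim: eventually_mono)
qed

text \<open>Integration by parts for an indefinite integral, as an instance of Fubini's theorem.\<close>

lemma weak_deriv_indefinite_integral: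
  assumes v: "v \<in> L2 (Leb1 a b)"
  obtains F where "continuous_on {a..b} F" "has_weak_deriv a b F v"
proof
  define k :: "real \<Rightarrow> real \<Rightarrow> real" where "k x y = indicator {..x} y" for x y
  define F where "F x = (LINT y|Leb1 a b. k x y * v y)" for x
  have k: "(\<lambda>(x, y). k x y) \<in> L2 (Leb2 a b)"
  proof -
    have "(\<lambda>_. 1) \<in> L2 (Leb1 a b)"
      by (intro continuous_in_L2 continuous_on_const)
    then have one: "(\<lambda>(x, y). 1 * 1) \<in> L2 (Leb2 a b)"
      by (intro L2_tensor pair_sigma_finite_Leb1)
    have "(\<lambda>p. indicator {p. snd p \<le> fst p} p * (\<lambda>(x, y). 1 * 1) p) \<in> L2 (Leb2 a b)"
      by (intro L2_Linf_mult indicator_in_Linf one borel_measurable_le measurable_Leb2_coords)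
    then show ?thesis
      by (simp add: k_def split_beta' indicator_def)
  qed
  show "continuous_on {a..b} F"
  proof -
    have "continuous_on {a..b} (\<lambda>x. integral\<^sup>L (Leb1 a x) v)"
      by (rule indefinite_integral_continuous_real) (rule L2_integrable[OF v])
    moreover have "F x = integral\<^sup>L (Leb1 a x) v" if "x \<in> {a..b}" for x
      using set_integral_Leb1_lower[OF that, of v] by (simp add: F_def k_def Leb1_integral_set)
    ultimately show ?thesis
      by (subst continuous_on_cong[OF refl])
  qed
  show "has_weak_deriv a b F v"
    unfolding has_weak_deriv_iff
  proof (intro allI impI)
    fix \<phi> \<phi>' assume \<phi>: "test_function a b \<phi> \<phi>'"
    have "\<phi> b = 0"
      using \<phi> unfolding test_function_def by (metis atLeastAtMost_iff linorder_not_le)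
    have "(LINT x|Leb1 a b. k x y * \<phi>' x) = - \<phi> y" if y: "y \<in> {a..b}" for y
    proof -
      have "(LINT x|Leb1 a b. k x y * \<phi>' x) = (LINT x:{y..b}|lebesgue. \<phi>' x)"
        unfolding set_integral_Leb1_upper[OF y]
        by (rule Bochner_Integration.integral_cong) (auto simp: k_def indicator_def)
      also have "\<dots> = \<phi> b - \<phi> y"
        using \<phi> y by (intro FTC_Leb1) (auto simp: test_function_def)
      finally show ?thesis
        using \<open>\<phi> b = 0\<close> by simp
    qed
    then have "(LINT y|Leb1 a b. v y * (LINT x|Leb1 a b. k x y * \<phi>' x)) = (LINT y|Leb1 a b. - (v y * \<phi> y))"
      by (intro Bochner_Integration.integral_cong) auto
    then show "(LINT x|Leb1 a b. F x * \<phi>' x) = - (LINT x|Leb1 a b. v x * \<phi> x)"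
      using kernel_transpose_inner[OF pair_sigma_finite_Leb1 k v test_function_L2(2)[OF \<phi>]]
      by (simp add: F_def)
  qed
qed

text \<open>
  The function minus an indefinite integral of its weak derivative has weak derivative zero.
\<close>

lemma continuous_representative:
  assumes "a < b" and u: "u \<in> L2 (Leb1 a b)" and v: "v \<in> L2 (Leb1 a b)" and "has_weak_deriv a b u v"
  obtains g where "continuous_on {a..b} g" "L2_eq a b u g"
proof -
  obtain F where F: "continuous_on {a..b} F" "has_weak_deriv a b F v"
    using weak_deriv_indefinite_integral[OF v] .
  have "has_weak_deriv a b (\<lambda>x. u x - F x) (\<lambda>x. v x - v x)"
    by (intro has_weak_deriv_diff assms F continuous_in_L2)
  then obtain c where "L2_eq a b (\<lambda>x. u x - F x) (\<lambda>_. c)"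
    using weak_deriv_zero_imp_const[OF \<open>a < b\<close> L2_diff[OF u continuous_in_L2[OF F(1)]]] by auto
  then have "L2_eq a b u (\<lambda>x. F x + c)"
    unfolding L2_eq_def by (rule eventually_mono) simp
  moreover have "continuous_on {a..b} (\<lambda>x. F x + c)"
    by (intro continuous_intros F)
  ultimately show thesis
    using that by blast
qed

lemma has_weak_deriv_C1:
  assumes "a < b" and F: "\<And>x. (F has_real_derivative f x) (at x)" and f: "continuous_on UNIV f"
  shows "has_weak_deriv a b F f"
  unfolding has_weak_deriv_iff
proof (intro allI impI)
  fix \<phi> \<phi>' assume \<phi>: "test_function a b \<phi> \<phi>'"
  have "\<phi> a = 0" "\<phi> b = 0"
    using \<phi> unfolding test_function_def by (metis atLeastAtMost_iff linorder_not_le)+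
  have contF: "continuous_on S F" for S
    using F by (meson DERIV_isCont continuous_at_imp_continuous_on)
  have contf: "continuous_on S f" for S
    using f by (rule continuous_on_subset) simp
  note cont = test_function_continuous[OF \<phi>]
  have "(LINT x|Leb1 a b. F x * \<phi>' x + f x * \<phi> x) = F b * \<phi> b - F a * \<phi> a"
    unfolding Leb1_integral_set
  proof (rule FTC_Leb1)
    show "((\<lambda>x. F x * \<phi> x) has_real_derivative F x * \<phi>' x + f x * \<phi> x) (at x)" for x
      using DERIV_mult[OF F, of \<phi> "\<phi>' x" x] \<phi> by (simp add: test_function_def algebra_simps)
    show "continuous_on UNIV (\<lambda>x. F x * \<phi>' x + f x * \<phi> x)"
      by (intro continuous_intros contF f cont)
  qed (use \<open>a < b\<close> in simp)
  moreover have "integrable (Leb1 a b) (\<lambda>x. F x * \<phi>' x)" "integrable (Leb1 a b) (\<lambda>x. f x * \<phi> x)"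
    by (intro L2_mult_integrable continuous_in_L2 contF contf cont)+
  ultimately show "(LINT x|Leb1 a b. F x * \<phi>' x) = - (LINT x|Leb1 a b. f x * \<phi> x)"
    using \<open>\<phi> a = 0\<close> \<open>\<phi> b = 0\<close> by simp
qed

lemma continuous_L2_eq_imp_eq:
  assumes "a < b" and f: "continuous_on {a..b} f" and g: "continuous_on {a..b} g"
    and eq: "L2_eq a b f g" and x: "x \<in> {a..b}"
  shows "f x = g x"
proof -
  have cont: "continuous_on {a..b} (\<lambda>x. \<bar>f x - g x\<bar>)"
    by (intro continuous_intros f g)
  have "(LINT x|Leb1 a b. \<bar>f x - g x\<bar>) = 0"
    by (rule integral_eq_zero_AE) (use eq in \<open>auto simp: L2_eq_def elim: eventually_mono\<close>)
  then have "integral {a..b} (\<lambda>x. \<bar>f x - g x\<bar>) = 0"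
    using lebesgue_integral_eq_integral[OF continuous_imp_integrable_real[OF cont]] by simp
  moreover have "(\<lambda>x. \<bar>f x - g x\<bar>) integrable_on {a..b}"
    using cont by (rule integrable_continuous_real)
  ultimately have "((\<lambda>x. \<bar>f x - g x\<bar>) has_integral 0) {a..b}"
    by (metis integrable_integral)
  then have "\<bar>f x - g x\<bar> = 0"
    using has_integral_0_cbox_imp_0[of a b "\<lambda>x. \<bar>f x - g x\<bar>" x] cont \<open>a < b\<close> x
    by (simp add: box_real)
  then show ?thesis
    by simp
qed

lemma cont_rep_eq:
  assumes "a < b" and g: "continuous_on {a..b} g" and eq: "L2_eq a b f g" and x: "x \<in> {a..b}"
  shows "cont_rep a b f x = g x"
proof -
  have "continuous_on {a..b} (cont_rep a b f) \<and> L2_eq a b f (cont_rep a b f)"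
    unfolding cont_rep_def by (rule someI[of _ g]) (use g eq in simp)
  then show ?thesis
    using assms by (intro continuous_L2_eq_imp_eq[OF \<open>a < b\<close> _ g _ x]) (auto intro: L2_eq_sym L2_eq_trans)
qed

section \<open>Functions with equal derivatives of order \<open>N\<close>\<close>

lemma wderiv_has_weak_deriv:
  assumes "v \<in> L2 (Leb1 a b)" "has_weak_deriv a b u v"
  shows "wderiv a b u \<in> L2 (Leb1 a b)" "has_weak_deriv a b u (wderiv a b u)"
  using someI[of "\<lambda>v. v \<in> L2 (Leb1 a b) \<and> has_weak_deriv a b u v" v] assms
  by (simp_all add: wderiv_def)

text \<open>
  A weak derivative depends on a class only, and so does the choice of its representative; hence the
  derivatives of almost everywhere equal functions are equal, and not only almost everywhere.
\<close>

lemma wderiv_cong: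
  assumes u: "u \<in> L2 (Leb1 a b)" and eq: "L2_eq a b u u'"
  shows "wderiv a b u = wderiv a b u'"
proof -
  have u': "u' \<in> L2 (Leb1 a b)"
    using L2_eq_in_L2[OF u eq] .
  have "v \<in> L2 (Leb1 a b) \<and> has_weak_deriv a b u v \<longleftrightarrow> v \<in> L2 (Leb1 a b) \<and> has_weak_deriv a b u' v" for v
    using has_weak_deriv_cong[OF _ eq L2_eq_refl u] has_weak_deriv_cong[OF _ L2_eq_sym[OF eq] L2_eq_refl u']
    by blast
  then show ?thesis
    by (simp add: wderiv_def)
qed

lemma wderivs_cong:
  assumes "u \<in> L2 (Leb1 a b)" "L2_eq a b u u'"
  shows "L2_eq a b (wderivs a b k u) (wderivs a b k u')"
proof (cases k)
  case (Suc m)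
  then show ?thesis
    using wderiv_cong[OF assms] by (simp only: funpow_Suc_right o_apply L2_eq_refl)
qed (use assms in simp)

lemma sobolev_wderivs:
  assumes u: "u \<in> sobolev a b N"
  shows "k \<le> N \<Longrightarrow> wderivs a b k u \<in> L2 (Leb1 a b)"
    and "k < N \<Longrightarrow> has_weak_deriv a b (wderivs a b k u) (wderivs a b (Suc k) u)"
proof -
  have step: "wderivs a b (Suc k) u \<in> L2 (Leb1 a b)"
    "has_weak_deriv a b (wderivs a b k u) (wderivs a b (Suc k) u)" if k: "k < N" for k
  proof -
    obtain v where "v \<in> L2 (Leb1 a b)" "has_weak_deriv a b (wderivs a b k u) v"
      using u k by (auto simp: sobolev_def)
    from wderiv_has_weak_deriv[OF this] show "wderivs a b (Suc k) u \<in> L2 (Leb1 a b)"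
      "has_weak_deriv a b (wderivs a b k u) (wderivs a b (Suc k) u)"
      by simp_all
  qed
  show "wderivs a b k u \<in> L2 (Leb1 a b)" if "k \<le> N"
    using that u step(1) by (cases k) (auto simp: sobolev_def)
  show "has_weak_deriv a b (wderivs a b k u) (wderivs a b (Suc k) u)" if "k < N"
    using step(2)[OF that] .
qed

lemma continuous_on_poly: "continuous_on S (poly p :: real \<Rightarrow> real)"
  by (simp add: continuous_on_poly[OF continuous_on_id, unfolded id_def])

lemma has_weak_deriv_poly:
  assumes "a < b"
  shows "has_weak_deriv a b (poly p) (poly (pderiv p))"
  using assms by (intro has_weak_deriv_C1 poly_DERIV continuous_on_poly)

lemma poly_L2: "poly p \<in> L2 (Leb1 a b)"
  by (intro continuous_in_L2 continuous_on_poly)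

lemma wderivs_poly:
  assumes "a < b"
  shows "L2_eq a b (wderivs a b k (poly p)) (poly ((pderiv ^^ k) p))"
proof (induction k)
  case 0
  then show ?case
    by (simp add: L2_eq_refl)
next
  case (Suc k)
  let ?q = "(pderiv ^^ k) p"
  have "wderiv a b (wderivs a b k (poly p)) = wderiv a b (poly ?q)"
    using wderiv_cong[OF poly_L2 L2_eq_sym[OF Suc]] by simp
  moreover have "L2_eq a b (wderiv a b (poly ?q)) (poly (pderiv ?q))"
    using wderiv_has_weak_deriv[OF poly_L2 has_weak_deriv_poly[OF assms]]
    by (intro has_weak_deriv_unique[OF _ has_weak_deriv_poly[OF assms] _ poly_L2])
  ultimately show ?case
    by simp
qed

lemma poly_sobolev:
  assumes "a < b"
  shows "poly p \<in> sobolev a b N"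
proof -
  have "has_weak_deriv a b (wderivs a b k (poly p)) (poly (pderiv ((pderiv ^^ k) p)))" for k
    by (rule has_weak_deriv_cong[OF has_weak_deriv_poly[OF assms] L2_eq_sym[OF wderivs_poly[OF assms]]
          L2_eq_refl poly_L2 poly_L2])
  then show ?thesis
    unfolding sobolev_def using poly_L2 by blast
qed

lemma poly_antiderivative:
  fixes p :: "real poly"
  assumes "\<forall>i\<ge>m. coeff p i = 0"
  shows "\<exists>q. pderiv q = p \<and> (\<forall>i\<ge>Suc m. coeff q i = 0)"
proof -
  define q where "q = Abs_poly (\<lambda>i. case i of 0 \<Rightarrow> 0 | Suc j \<Rightarrow> coeff p j / real (Suc j))"
  have coeff_q: "coeff q i = (case i of 0 \<Rightarrow> 0 | Suc j \<Rightarrow> coeff p j / real (Suc j))" for i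
    unfolding q_def using assms
    by (subst coeff_Abs_poly[of m]) (auto split: nat.split)
  have "pderiv q = p"
    by (rule poly_eqI) (simp add: coeff_pderiv coeff_q)
  moreover have "\<forall>i\<ge>Suc m. coeff q i = 0"
    using assms by (auto simp: coeff_q split: nat.split)
  ultimately show ?thesis
    by blast
qed

text \<open>
  Integrating down from order \<open>N\<close>: each step subtracts a polynomial antiderivative, and what is left
  has weak derivative zero, hence is constant.
\<close>

lemma sobolev_equal_derivs_poly:
  assumes "a < b" and u: "u1 \<in> sobolev a b N" "u2 \<in> sobolev a b N"
    and eq: "L2_eq a b (wderivs a b N u1) (wderivs a b N u2)"
  obtains p where "\<forall>i\<ge>N. coeff p i = 0"
    and "\<And>k. k \<le> N \<Longrightarrow> L2_eq a b (\<lambda>x. wderivs a b k u1 x - wderivs a b k u2 x) (poly ((pderiv ^^ k) p))"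
proof -
  let ?w = "\<lambda>k x. wderivs a b k u1 x - wderivs a b k u2 x"
  have w_L2: "?w k \<in> L2 (Leb1 a b)" if "k \<le> N" for k
    by (intro L2_diff sobolev_wderivs(1)[OF u(1) that] sobolev_wderivs(1)[OF u(2) that])
  have w_deriv: "has_weak_deriv a b (?w k) (?w (Suc k))" if "k < N" for k
    using that by (intro has_weak_deriv_diff sobolev_wderivs(2)[OF u(1)] sobolev_wderivs(2)[OF u(2)]
        sobolev_wderivs(1)[OF u(1)] sobolev_wderivs(1)[OF u(2)]) auto
  have "\<exists>p. L2_eq a b (?w (N - m)) (poly p) \<and> (\<forall>i\<ge>m. coeff p i = 0)" if "m \<le> N" for m
    using that
  proof (induction m)
    case 0
    have "L2_eq a b (?w (N - 0)) (poly 0)"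
      using eq unfolding L2_eq_def by (auto elim: eventually_mono)
    then show ?case
      by (intro exI[of _ 0] conjI) (assumption, simp)
  next
    case (Suc m)
    then obtain p where p: "L2_eq a b (?w (N - m)) (poly p)" "\<forall>i\<ge>m. coeff p i = 0"
      by auto
    obtain q where q: "pderiv q = p" "\<forall>i\<ge>Suc m. coeff q i = 0"
      using poly_antiderivative[OF p(2)] by blast
    let ?k = "N - Suc m"
    have k: "?k < N" "Suc ?k = N - m"
      using Suc.prems by auto
    have "has_weak_deriv a b (?w ?k) (poly p)"
      by (rule has_weak_deriv_cong[OF w_deriv[OF k(1)] L2_eq_refl])
        (use k p w_L2[of ?k] w_L2[of "N - m"] in auto)
    then have "has_weak_deriv a b (\<lambda>x. ?w ?k x - poly q x) (\<lambda>x. poly p x - poly p x)"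
      using has_weak_deriv_poly[OF \<open>a < b\<close>, of q] q(1) w_L2[of ?k]
      by (intro has_weak_deriv_diff poly_L2) auto
    then obtain c where "L2_eq a b (\<lambda>x. ?w ?k x - poly q x) (\<lambda>_. c)"
      using weak_deriv_zero_imp_const[OF \<open>a < b\<close> L2_diff[OF w_L2[of ?k] poly_L2[of q]]] by auto
    then have "L2_eq a b (?w ?k) (poly (q + [:c:]))"
      unfolding L2_eq_def by (rule eventually_mono) simp
    moreover have "\<forall>i\<ge>Suc m. coeff (q + [:c:]) i = 0"
      using q(2) by (auto simp: coeff_pCons split: nat.split)
    ultimately show ?case
      by blast
  qed
  from this[of N] obtain p where p: "L2_eq a b (?w 0) (poly p)" "\<forall>i\<ge>N. coeff p i = 0"
    by auto
  have "L2_eq a b (?w k) (poly ((pderiv ^^ k) p))" if "k \<le> N" for k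
    using that
  proof (induction k)
    case 0
    then show ?case
      using p(1) by simp
  next
    case (Suc k)
    have "has_weak_deriv a b (?w k) (poly ((pderiv ^^ Suc k) p))"
      using has_weak_deriv_cong[OF has_weak_deriv_poly[OF \<open>a < b\<close>] L2_eq_sym[OF Suc.IH] L2_eq_refl poly_L2 poly_L2]
        Suc.prems by simp
    then show ?case
      using Suc.prems w_deriv[of k] w_L2[of "Suc k"] by (intro has_weak_deriv_unique[of a b "?w k"] poly_L2) auto
  qed
  then show thesis
    using that p(2) by blast
qed

text \<open>
  Two elements of \<open>XB\<close> with the same derivative of order \<open>N\<close> differ by a polynomial of degree less
  than \<open>N\<close>. The boundary conditions are linear, so the polynomial satisfies them and vanishes.
\<close>

lemma XB_inj:
  assumes "a < b" "N \<ge> 1" and wp: "well_posed_bc a b N B"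
    and u1: "u1 \<in> XB a b N B" and u2: "u2 \<in> XB a b N B"
    and eq: "L2_eq a b (wderivs a b N u1) (wderivs a b N u2)"
  shows "L2_eq a b u1 u2"
proof -
  have s: "u1 \<in> sobolev a b N" "u2 \<in> sobolev a b N"
    using u1 u2 by (auto simp: XB_def)
  obtain p where p: "\<forall>i\<ge>N. coeff p i = 0"
    and diff: "\<And>k. k \<le> N \<Longrightarrow> L2_eq a b (\<lambda>x. wderivs a b k u1 x - wderivs a b k u2 x) (poly ((pderiv ^^ k) p))"
    using sobolev_equal_derivs_poly[OF \<open>a < b\<close> s eq] by blast
  have bv: "cont_rep a b (wderivs a b k (poly p)) x
      = cont_rep a b (wderivs a b k u1) x - cont_rep a b (wderivs a b k u2) x"
    if k: "k < N" and x: "x \<in> {a..b}" for k x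
  proof -
    have "k \<le> N" "Suc k \<le> N"
      using k by auto
    obtain g1 where g1: "continuous_on {a..b} g1" "L2_eq a b (wderivs a b k u1) g1"
      using continuous_representative[OF \<open>a < b\<close> sobolev_wderivs(1)[OF s(1) \<open>k \<le> N\<close>]
          sobolev_wderivs(1)[OF s(1) \<open>Suc k \<le> N\<close>] sobolev_wderivs(2)[OF s(1) k]] .
    obtain g2 where g2: "continuous_on {a..b} g2" "L2_eq a b (wderivs a b k u2) g2"
      using continuous_representative[OF \<open>a < b\<close> sobolev_wderivs(1)[OF s(2) \<open>k \<le> N\<close>]
          sobolev_wderivs(1)[OF s(2) \<open>Suc k \<le> N\<close>] sobolev_wderivs(2)[OF s(2) k]] .
    have "L2_eq a b (poly ((pderiv ^^ k) p)) (\<lambda>x. g1 x - g2 x)"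
      using diff[OF \<open>k \<le> N\<close>] g1(2) g2(2) unfolding L2_eq_def by eventually_elim simp
    then have "poly ((pderiv ^^ k) p) x = g1 x - g2 x"
      by (intro continuous_L2_eq_imp_eq[OF \<open>a < b\<close> continuous_on_poly _ _ x] continuous_intros g1 g2)
    then show ?thesis
      using cont_rep_eq[OF \<open>a < b\<close> continuous_on_poly wderivs_poly[OF \<open>a < b\<close>] x]
        cont_rep_eq[OF \<open>a < b\<close> g1 x] cont_rep_eq[OF \<open>a < b\<close> g2 x] by simp
  qed
  have "poly p \<in> XB a b N B"
    unfolding XB_def
  proof (intro CollectI conjI allI impI)
    show "poly p \<in> sobolev a b N"
      using poly_sobolev[OF \<open>a < b\<close>] .
    fix r assume "r < N"
    have "(\<Sum>k<N. B r k * cont_rep a b (wderivs a b k (poly p)) a) +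
        (\<Sum>k<N. B r (N + k) * cont_rep a b (wderivs a b k (poly p)) b)
      = ((\<Sum>k<N. B r k * cont_rep a b (wderivs a b k u1) a) +
        (\<Sum>k<N. B r (N + k) * cont_rep a b (wderivs a b k u1) b))
      - ((\<Sum>k<N. B r k * cont_rep a b (wderivs a b k u2) a) +
        (\<Sum>k<N. B r (N + k) * cont_rep a b (wderivs a b k u2) b))"
      using bv \<open>a < b\<close> by (simp add: right_diff_distrib sum_subtractf)
    then show "(\<Sum>k<N. B r k * cont_rep a b (wderivs a b k (poly p)) a) +
        (\<Sum>k<N. B r (N + k) * cont_rep a b (wderivs a b k (poly p)) b) = 0"
      using u1 u2 \<open>r < N\<close> by (simp add: XB_def)
  qed
  moreover have "degree p \<le> N - 1"
    using p \<open>N \<ge> 1\<close> by (intro degree_le) auto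
  ultimately have "p = 0"
    using wp by (simp add: well_posed_bc_def)
  then show ?thesis
    using diff[of 0] unfolding L2_eq_def by (auto elim: eventually_mono)
qed

text \<open>
  \<open>T_op\<close> picks some element of \<open>XB\<close> with the prescribed derivative. For a prescribed derivative that
  comes from \<open>u\<close> such an element exists, and by injectivity it is \<open>u\<close>.
\<close>

lemma XB_T_op:
  assumes "a < b" "N \<ge> 1" "well_posed_bc a b N B" and u: "u \<in> XB a b N B"
  shows "L2_eq a b u (T_op a b N B (wderivs a b N u))"
proof -
  let ?v = "wderivs a b N u"
  have "T_op a b N B ?v \<in> XB a b N B \<and> L2_eq a b (wderivs a b N (T_op a b N B ?v)) ?v"
    unfolding T_op_def by (rule someI[of _ u]) (use u L2_eq_refl in blast)
  then show ?thesis
    using assms by (blast intro: XB_inj L2_eq_sym)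
qed

lemma XB_R_op:
  assumes "a < b" "N \<ge> 1" "well_posed_bc a b N B" and u: "u \<in> XB a b N B" and "j \<le> N"
  shows "L2_eq a b (wderivs a b j u) (R_op a b N B j (wderivs a b N u))"
proof -
  have "u \<in> L2 (Leb1 a b)"
    using u by (simp add: XB_def sobolev_def)
  then show ?thesis
    using wderivs_cong[OF _ XB_T_op[OF assms(1-4)]] \<open>j \<le> N\<close> by (auto simp: R_op_def L2_eq_refl)
qed

section \<open>Energy estimates\<close>

text \<open>The product \<open>V t * exp (c * t)\<close> is nonincreasing.\<close>

lemma exponential_decay:
  fixes V V' :: "real \<Rightarrow> real"
  assumes V: "\<And>t. t \<ge> 0 \<Longrightarrow> (V has_real_derivative V' t) (at t within {0..})"
    and V': "\<And>t. t \<ge> 0 \<Longrightarrow> V' t \<le> - c * V t" and "t \<ge> 0"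
  shows "V t \<le> V 0 * exp (- c * t)"
proof -
  have "V t * exp (c * t) \<le> V 0 * exp (c * 0)"
  proof (rule DERIV_nonpos_imp_decreasing_open[OF \<open>t \<ge> 0\<close>])
    show "continuous_on {0..t} (\<lambda>s. V s * exp (c * s))"
    proof (intro continuous_intros)
      have "continuous (at x within {0..}) V" if "x \<in> {0..}" for x
        by (rule DERIV_continuous[OF V]) (use that in simp)
      then have "continuous_on {0..} V"
        by (simp add: continuous_on_eq_continuous_within)
      then show "continuous_on {0..t} V"
        by (rule continuous_on_subset) auto
    qed
    fix s :: real assume s: "0 < s" "s < t"
    then have "(V has_real_derivative V' s) (at s)"
      using V[of s] at_within_interior[of s "{0..}"] by simp
    then have "((\<lambda>s. V s * exp (c * s)) has_real_derivative (V' s + c * V s) * exp (c * s)) (at s)"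
      by (auto intro!: derivative_eq_intros simp: algebra_simps)
    moreover have "(V' s + c * V s) * exp (c * s) \<le> 0"
      using V'[of s] s by (simp add: mult_le_0_iff)
    ultimately show "\<exists>y. ((\<lambda>s. V s * exp (c * s)) has_real_derivative y) (at s) \<and> y \<le> 0"
      by blast
  qed
  then have "V t * exp (c * t) * exp (- (c * t)) \<le> V 0 * exp (- (c * t))"
    by simp
  then show ?thesis
    by (simp add: mult.assoc exp_add[symmetric])
qed

lemma L2_inner_add_le:
  assumes p: "p \<in> L2 (Leb1 a b)" and q: "q \<in> L2 (Leb1 a b)"
  shows "L2_inner a b (\<lambda>s. p s + q s) (\<lambda>s. p s + q s) \<le> 2 * L2_inner a b p p + 2 * L2_inner a b q q"
proof -
  have "L2_inner a b (\<lambda>s. p s + q s) (\<lambda>s. p s + q s)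
      \<le> (LINT s|Leb1 a b. 2 * (p s * p s) + 2 * (q s * q s))"
    unfolding L2_inner_def
  proof (rule integral_mono)
    show "integrable (Leb1 a b) (\<lambda>s. (p s + q s) * (p s + q s))"
      by (intro L2_mult_integrable L2_add p q)
    show "integrable (Leb1 a b) (\<lambda>s. 2 * (p s * p s) + 2 * (q s * q s))"
      by (intro Bochner_Integration.integrable_add integrable_mult_right L2_mult_integrable p q)
    fix s
    have "0 \<le> (p s - q s)\<^sup>2"
      by simp
    then show "(p s + q s) * (p s + q s) \<le> 2 * (p s * p s) + 2 * (q s * q s)"
      by (simp add: power2_eq_square algebra_simps)
  qed
  also have "\<dots> = 2 * L2_inner a b p p + 2 * L2_inner a b q q"
    using L2_mult_integrable[OF p p] L2_mult_integrable[OF q q] by (simp add: L2_inner_def)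
  finally show ?thesis .
qed

text \<open>
  With \<open>x\<close> the increment of the curve, \<open>\<langle>u + x, P (u + x)\<rangle> = \<langle>u, P u\<rangle> + 2 \<langle>P u, x\<rangle> + \<langle>P x, x\<rangle>\<close> by
  symmetry, and boundedness of \<open>P\<close> makes the last term quadratically small.
\<close>

lemma quadratic_form_has_derivative:
  assumes P: "adjoint_pair a b P P" and bound: "\<And>v. v \<in> L2 (Leb1 a b) \<Longrightarrow> L2_norm a b (P v) \<le> C * L2_norm a b v"
    and u: "\<And>\<tau>. \<tau> \<ge> 0 \<Longrightarrow> u \<tau> \<in> L2 (Leb1 a b)" and deriv: "L2_has_deriv a b u d t" and "t \<ge> 0"
  shows "((\<lambda>\<tau>. L2_inner a b (u \<tau>) (P (u \<tau>))) has_real_derivative 2 * L2_inner a b (P (u t)) d)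
    (at t within {0..})"
proof -
  let ?L = "L2 (Leb1 a b)" and ?ip = "L2_inner a b" and ?n = "L2_norm a b"
  define r where "r \<tau> s = u \<tau> s - u t s - (\<tau> - t) * d s" for \<tau> s
  define e where "e \<tau> = ?n (r \<tau>) / \<bar>\<tau> - t\<bar>" for \<tau>
  have d: "d \<in> ?L" and e: "(e \<longlongrightarrow> 0) (at t within {0..})"
    using deriv by (simp_all add: L2_has_deriv_def e_def[abs_def] r_def[abs_def])
  have ut: "u t \<in> ?L"
    using u \<open>t \<ge> 0\<close> by simp
  have PL: "P v \<in> ?L" and sym: "?ip (P v) w = ?ip v (P w)" if "v \<in> ?L" "w \<in> ?L" for v w
    using P that by (auto simp: adjoint_pair_def)
  define g where "g \<tau> = 2 * ?n (P (u t)) * e \<tau> + 2 * \<bar>C\<bar> * \<bar>\<tau> - t\<bar> * ((?n d)\<^sup>2 + (e \<tau>)\<^sup>2)" for \<tau>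
  have "((\<lambda>\<tau>. (?ip (u \<tau>) (P (u \<tau>)) - ?ip (u t) (P (u t))) / (\<tau> - t) - 2 * ?ip (P (u t)) d) \<longlongrightarrow> 0)
    (at t within {0..})"
  proof (rule Lim_null_comparison)
    have "((\<lambda>\<tau>. \<bar>\<tau> - t\<bar>) \<longlongrightarrow> 0) (at t within {0..})"
      by (auto intro!: tendsto_eq_intros)
    then have "(g \<longlongrightarrow> 2 * ?n (P (u t)) * 0 + 2 * \<bar>C\<bar> * 0 * ((?n d)\<^sup>2 + 0\<^sup>2)) (at t within {0..})"
      unfolding g_def by (intro tendsto_intros e)
    then show "(g \<longlongrightarrow> 0) (at t within {0..})"
      by simp
    show "\<forall>\<^sub>F \<tau> in at t within {0..}.
      norm ((?ip (u \<tau>) (P (u \<tau>)) - ?ip (u t) (P (u t))) / (\<tau> - t) - 2 * ?ip (P (u t)) d) \<le> g \<tau>"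
      unfolding eventually_at_filter
    proof (rule always_eventually, intro allI impI)
      fix \<tau> assume \<tau>: "\<tau> \<noteq> t" "\<tau> \<in> {0..}"
      define h where "h = \<tau> - t"
      have "h \<noteq> 0"
        using \<tau> by (simp add: h_def)
      have r: "r \<tau> \<in> ?L"
        unfolding r_def[abs_def] using \<tau> by (intro L2_diff L2_cmult u ut d) simp
      define x where "x s = h * d s + r \<tau> s" for s
      have x: "x \<in> ?L"
        unfolding x_def[abs_def] by (intro L2_add L2_cmult d r)
      have u\<tau>: "u \<tau> = (\<lambda>s. u t s + x s)"
        by (simp add: x_def r_def h_def fun_eq_iff)
      have ux: "(\<lambda>s. u t s + x s) \<in> ?L"
        by (intro L2_add ut x)
      have "?ip (u \<tau>) (P (u \<tau>)) = ?ip (P (u t)) (\<lambda>s. u t s + x s) + ?ip (P x) (\<lambda>s. u t s + x s)"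
        unfolding u\<tau> L2_inner_add_left[OF ut x PL[OF ux ux]] by (simp only: sym[OF ut ux] sym[OF x ux])
      also have "\<dots> = ?ip (u t) (P (u t)) + 2 * ?ip (P (u t)) x + ?ip (P x) x"
        unfolding L2_inner_add_right[OF ut x PL[OF ut ut]] L2_inner_add_right[OF ut x PL[OF x x]]
        using sym[OF x ut] sym[OF ut ut] L2_inner_commute[of a b x "P (u t)"] by simp
      also have "?ip (P (u t)) x = h * ?ip (P (u t)) d + ?ip (P (u t)) (r \<tau>)"
        unfolding x_def[abs_def]
        by (subst L2_inner_add_right) (simp_all add: L2_cmult d r PL[OF ut ut] L2_inner_cmult_right)
      finally have "(?ip (u \<tau>) (P (u \<tau>)) - ?ip (u t) (P (u t))) / h - 2 * ?ip (P (u t)) d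
          = 2 * ?ip (P (u t)) (r \<tau>) / h + ?ip (P x) x / h"
        using \<open>h \<noteq> 0\<close> by (simp add: field_simps)
      moreover have "\<bar>2 * ?ip (P (u t)) (r \<tau>) / h\<bar> \<le> 2 * ?n (P (u t)) * e \<tau>"
        using L2_inner_bound[OF PL[OF ut ut] r] \<open>h \<noteq> 0\<close>
        by (simp add: e_def h_def[symmetric] abs_mult field_simps)
      moreover have "\<bar>?ip (P x) x / h\<bar> \<le> 2 * \<bar>C\<bar> * \<bar>h\<bar> * ((?n d)\<^sup>2 + (e \<tau>)\<^sup>2)"
      proof -
        have "\<bar>?ip (P x) x\<bar> \<le> ?n (P x) * ?n x"
          by (rule L2_inner_bound[OF PL[OF x x] x])
        also have "\<dots> \<le> (\<bar>C\<bar> * ?n x) * ?n x"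
          using bound[OF x] mult_right_mono[OF abs_ge_self[of C] L2_norm_ge_0[of a b x]]
          by (intro mult_right_mono L2_norm_ge_0) linarith
        also have "\<dots> = \<bar>C\<bar> * ?ip x x"
          by (simp add: L2_norm_sq[symmetric] power2_eq_square)
        also have "\<dots> \<le> \<bar>C\<bar> * (2 * (h\<^sup>2 * (?n d)\<^sup>2) + 2 * (?n (r \<tau>))\<^sup>2)"
          using L2_inner_add_le[OF L2_cmult[OF d] r, of h]
          by (intro mult_left_mono)
            (simp_all add: x_def[abs_def] L2_norm_sq L2_inner_cmult_left L2_inner_cmult_right
              power2_eq_square[of h] mult.assoc)
        also have "?n (r \<tau>) = \<bar>h\<bar> * e \<tau>"
          using \<open>h \<noteq> 0\<close> by (simp add: e_def h_def)
        finally have "\<bar>?ip (P x) x\<bar> \<le> (2 * \<bar>C\<bar> * \<bar>h\<bar> * ((?n d)\<^sup>2 + (e \<tau>)\<^sup>2)) * \<bar>h\<bar>"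
          unfolding power2_abs[of h, symmetric]
          by (simp add: power2_eq_square algebra_simps del: abs_mult_self_eq)
        then show ?thesis
          using \<open>h \<noteq> 0\<close> by (simp add: abs_divide pos_divide_le_eq)
      qed
      ultimately show "norm ((?ip (u \<tau>) (P (u \<tau>)) - ?ip (u t) (P (u t))) / (\<tau> - t) - 2 * ?ip (P (u t)) d) \<le> g \<tau>"
        unfolding g_def h_def[symmetric] real_norm_def by linarith
    qed
  qed
  then show ?thesis
    by (simp add: has_field_derivative_iff LIM_zero_iff)
qed

text \<open>
  A supremum of reals over an unbounded set carries no information, so the operator norm bounds the
  operator only once some bound \<open>C\<close> is known.
\<close>

lemma L2_onorm_bound:
  assumes "\<And>v. v \<in> L2 (Leb1 a b) \<Longrightarrow> L2_norm a b (R v) \<le> C * L2_norm a b v" and v: "v \<in> L2 (Leb1 a b)"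
  shows "L2_norm a b (R v) \<le> L2_onorm a b R * L2_norm a b v"
proof (cases "L2_norm a b v = 0")
  case True
  then show ?thesis
    using assms(1)[OF v] L2_norm_ge_0[of a b "R v"] by simp
next
  case False
  then have pos: "0 < L2_norm a b v"
    using L2_norm_ge_0[of a b v] by linarith
  have "L2_norm a b (R w) / L2_norm a b w \<le> max 0 C" if w: "w \<in> L2 (Leb1 a b)" for w
  proof (cases "L2_norm a b w = 0")
    case False
    then have "0 < L2_norm a b w"
      using L2_norm_ge_0[of a b w] by linarith
    then have "L2_norm a b (R w) / L2_norm a b w \<le> C"
      using assms(1)[OF w] by (simp add: pos_divide_le_eq)
    then show ?thesis
      by simp
  qed simp
  then have "L2_norm a b (R v) / L2_norm a b v \<le> L2_onorm a b R"
    unfolding L2_onorm_def by (intro cSUP_upper v bdd_aboveI2)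
  then show ?thesis
    using pos by (simp add: pos_divide_le_eq)
qed

lemma B_op_diagonal:
  assumes v: "v \<in> L2 (Leb1 a b)"
    and R: "\<And>j. j < N \<Longrightarrow> has_Pi2_kernels a b (R_op a b N B j) (R1 j) (R2 j)"
  shows "L2_eq a b (B_op a b N \<beta> R1 R2 (\<lambda>\<theta> \<eta>. v \<theta> * v \<eta>))
    (\<lambda>s. \<Sum>i<N. \<Sum>j\<le>i. \<beta> i j s * R_op a b N B i v s * R_op a b N B j v s)"
proof -
  have "AE s in Leb1 a b. \<forall>i\<in>{..<N}. \<forall>j\<in>{..<N}.
      tensor_PI a b (R1 i) (R2 i) (R1 j) (R2 j) (\<lambda>\<theta> \<eta>. v \<theta> * v \<eta>) s = R_op a b N B i v s * R_op a b N B j v s"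
    using tensor_PI_diagonal_AE[OF v R R] by (intro AE_finite_allI) (auto simp: L2_eq_def)
  then show ?thesis
    unfolding L2_eq_def
    by eventually_elim (auto simp: B_op_def mult_op_def mult.assoc intro!: sum.cong)
qed

section \<open>Exponential stability\<close>

theorem theorem13:
  fixes a b :: real and N :: nat and B :: "nat \<Rightarrow> nat \<Rightarrow> real"
    and \<alpha> :: "nat \<Rightarrow> real \<Rightarrow> real" and \<beta> :: "nat \<Rightarrow> nat \<Rightarrow> real \<Rightarrow> real"
    and R1 R2 :: "nat \<Rightarrow> real \<Rightarrow> real \<Rightarrow> real"
    and G1 G2 G3 :: "real \<Rightarrow> real \<Rightarrow> real \<Rightarrow> real"
    and P :: op1 and \<epsilon> \<delta> :: real
    and u0 :: "real \<Rightarrow> real" and u :: "real \<Rightarrow> real \<Rightarrow> real"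
  defines "T \<equiv> T_op a b N B" and "A \<equiv> A_op a b N B \<alpha>" and "\<B> \<equiv> B_op a b N \<beta> R1 R2"
    and "\<mu> \<equiv> L2_onorm a b P"
  assumes "a < b" and "N \<ge> 1" and "well_posed_bc a b N B"
    and "\<And>k. k \<le> N \<Longrightarrow> \<alpha> k \<in> Linf (Leb1 a b)"
    and "\<And>i j. j \<le> i \<Longrightarrow> i < N \<Longrightarrow> \<beta> i j \<in> Linf (Leb1 a b)"
    and R_kernels: "\<And>j. j < N \<Longrightarrow> has_Pi2_kernels a b (R_op a b N B j) (R1 j) (R2 j)"
    and R_kernels_bounded:
      "\<And>j. j < N \<Longrightarrow> (\<lambda>(s, \<theta>). R1 j s \<theta>) \<in> Linf (Leb2 a b) \<and> (\<lambda>(s, \<theta>). R2 j s \<theta>) \<in> Linf (Leb2 a b)"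
    and "\<epsilon> > 0" and "\<delta> > 0"
    and "P \<in> Pi3 a b" and "op_eq a b P (L2_adjoint a b P)"
    and "op_le a b (\<lambda>v s. \<epsilon> * v s) P"
    and "op_le a b
      (\<lambda>v s. L2_adjoint a b A (P (T v)) s + L2_adjoint a b T (P (A v)) s)
      (\<lambda>v s. - \<delta> * L2_adjoint a b T (T v) s)"
    and G_kernels: "has_Pi22_kernels a b (\<lambda>w. L2_adjoint a b T (P (\<B> w))) G1 G2 G3"
    and "\<And>w. (\<lambda>(s, \<theta>, \<eta>). w s \<theta> \<eta>) \<in> L2 (Leb3 a b) \<Longrightarrow> Klin a b G1 G2 G3 w = 0"
    and "u0 \<in> XB a b N B" and "classical_solution a b N B \<alpha> \<beta> u0 u"
  shows "\<forall>t\<ge>0. (L2_norm a b (u t))\<^sup>2 \<le>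
    \<mu> / \<epsilon> * (L2_norm a b (u 0))\<^sup>2 * exp (- (\<delta> / \<mu>) * t)"
proof (intro allI impI)
  let ?L = "L2 (Leb1 a b)" and ?ip = "L2_inner a b"
  note wp = \<open>a < b\<close> \<open>N \<ge> 1\<close> \<open>well_posed_bc a b N B\<close>
  note sol = \<open>classical_solution a b N B \<alpha> \<beta> u0 u\<close>[unfolded classical_solution_def]
  have R_adj: "adjoint_pair a b (R_op a b N B j) (L2_adjoint a b (R_op a b N B j))" if "j < N" for j
  proof -
    have "R_op a b N B j \<in> Pi3 a b"
      using R_kernels[OF that] unfolding has_Pi2_kernels_def Pi3_def by blast
    then show ?thesis
      using Pi3_adjoint_pair adjoint_pair_L2_adjoint by blast
  qed
  have "T = R_op a b N B 0"
    using \<open>N \<ge> 1\<close> by (simp add: T_def R_op_def fun_eq_iff)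
  then have T_adj: "adjoint_pair a b T (L2_adjoint a b T)"
    using R_adj[of 0] \<open>N \<ge> 1\<close> by simp
  have A_adj: "adjoint_pair a b A (L2_adjoint a b A)"
  proof -
    have "\<exists>S. adjoint_pair a b (R_op a b N B i) S" if "i \<le> N" for i
    proof (cases "i = N")
      case True
      then have "R_op a b N B i = (\<lambda>v. v)"
        by (simp add: R_op_def fun_eq_iff)
      then show ?thesis
        using adjoint_pair_id by metis
    next
      case False
      then show ?thesis
        using R_adj[of i] \<open>i \<le> N\<close> by auto
    qed
    then obtain S where "\<And>i. i \<le> N \<Longrightarrow> adjoint_pair a b (R_op a b N B i) (S i)"
      by metis
    then have "adjoint_pair a b (\<lambda>v s. \<Sum>i\<in>{..N}. mult_op (\<alpha> i) (R_op a b N B i v) s)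
        (\<lambda>w s. \<Sum>i\<in>{..N}. S i (mult_op (\<alpha> i) w) s)"
      by (intro adjoint_pair_sum adjoint_pair_mult_op assms(8)) auto
    then have "adjoint_pair a b A (\<lambda>w s. \<Sum>i\<in>{..N}. S i (mult_op (\<alpha> i) w) s)"
      by (simp add: A_def A_op_def[abs_def])
    then show ?thesis
      by (rule adjoint_pair_L2_adjoint)
  qed
  have P_sym: "adjoint_pair a b P P"
  proof -
    have P': "adjoint_pair a b P (L2_adjoint a b P)"
      using Pi3_adjoint_pair[OF \<open>P \<in> Pi3 a b\<close>] adjoint_pair_L2_adjoint by blast
    have "?ip v (L2_adjoint a b P w) = ?ip v (P w)" if "v \<in> ?L" "w \<in> ?L" for v w
    proof (rule L2_inner_cong)
      show "L2_eq a b (L2_adjoint a b P w) (P w)"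
        using \<open>op_eq a b P (L2_adjoint a b P)\<close> \<open>w \<in> ?L\<close> by (auto simp: op_eq_def intro: L2_eq_sym)
    qed (use that P' L2_eq_refl in \<open>auto simp: adjoint_pair_def intro: L2_measurable\<close>)
    then show ?thesis
      using P' by (auto simp: adjoint_pair_def)
  qed
  have P_L2: "P v \<in> ?L" if "v \<in> ?L" for v
    using P_sym that by (simp add: adjoint_pair_def)
  have P_ip: "?ip (P v) w = ?ip v (P w)" if "v \<in> ?L" "w \<in> ?L" for v w
    using P_sym that by (simp add: adjoint_pair_def)
  obtain C where C: "\<And>v. v \<in> ?L \<Longrightarrow> L2_norm a b (P v) \<le> C * L2_norm a b v"
    using Pi3_bounded[OF \<open>P \<in> Pi3 a b\<close>] by blast
  have upper: "?ip v (P v) \<le> \<mu> * ?ip v v" if v: "v \<in> ?L" for v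
  proof -
    have "?ip v (P v) \<le> L2_norm a b v * L2_norm a b (P v)"
      using L2_inner_bound[OF v P_L2[OF v]] by linarith
    also have "\<dots> \<le> L2_norm a b v * (\<mu> * L2_norm a b v)"
      unfolding \<mu>_def by (intro mult_left_mono L2_onorm_bound[OF C v] L2_norm_ge_0)
    finally show ?thesis
      by (simp add: L2_norm_sq[symmetric] power2_eq_square mult_ac)
  qed
  have lower: "\<epsilon> * ?ip v v \<le> ?ip v (P v)" if "v \<in> ?L" for v
    using \<open>op_le a b (\<lambda>v s. \<epsilon> * v s) P\<close> that by (simp add: op_le_def L2_inner_cmult_right)
  have "\<mu> > 0"
  proof -
    \<comment> \<open>The two bounds on a function of positive norm give \<open>\<epsilon> \<le> \<mu>\<close>.\<close>
    have one: "(\<lambda>_. 1) \<in> ?L"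
      by (intro continuous_in_L2 continuous_on_const)
    have "?ip (\<lambda>_. 1) (\<lambda>_. 1) = b - a"
      unfolding L2_inner_def Leb1_integral_set using \<open>a < b\<close>
      by (subst FTC_Leb1[where F = "\<lambda>x. x"]) auto
    then have "\<epsilon> * (b - a) \<le> \<mu> * (b - a)"
      using order_trans[OF lower[OF one] upper[OF one]] by simp
    then show ?thesis
      using \<open>a < b\<close> \<open>\<epsilon> > 0\<close> by simp
  qed
  have u_XB: "u t \<in> XB a b N B" if "t \<ge> 0" for t
    using sol that by blast
  have u_L2: "u t \<in> ?L" if "t \<ge> 0" for t
    using u_XB[OF that] by (simp add: XB_def sobolev_def)
  \<comment> \<open>The Lyapunov function, equivalent to the squared norm by the bounds \<open>lower\<close> and \<open>upper\<close>.\<close>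
  define V where "V t = ?ip (u t) (P (u t))" for t
  have "\<exists>V'. (V has_real_derivative V') (at t within {0..}) \<and> V' \<le> - (\<delta> / \<mu>) * V t" if "t \<ge> 0" for t
  proof -
    obtain d where d: "L2_has_deriv a b u d t" and d_eq: "AE s in Leb1 a b. d s =
        (\<Sum>i\<le>N. \<alpha> i s * wderivs a b i (u t) s) +
        (\<Sum>i<N. \<Sum>j\<le>i. \<beta> i j s * wderivs a b i (u t) s * wderivs a b j (u t) s)"
      using sol \<open>t \<ge> 0\<close> by blast
    \<comment> \<open>The state is \<open>T v\<close> and the equation reads \<open>d = A v + \<B> (v \<otimes> v)\<close>.\<close>
    define v where "v = wderivs a b N (u t)"
    define w where "w = (\<lambda>\<theta> \<eta>. v \<theta> * v \<eta>)"
    have v: "v \<in> ?L"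
      using u_XB[OF \<open>t \<ge> 0\<close>] sobolev_wderivs(1)[of "u t" a b N N] by (simp add: v_def XB_def)
    have dL: "d \<in> ?L"
      using d by (simp add: L2_has_deriv_def)
    have Tv: "T v \<in> ?L" "L2_eq a b (u t) (T v)"
      using T_adj v XB_T_op[OF wp u_XB[OF \<open>t \<ge> 0\<close>]] by (auto simp: adjoint_pair_def T_def v_def)
    have Av: "A v \<in> ?L"
      using A_adj v by (simp add: adjoint_pair_def)
    have split: "L2_eq a b d (\<lambda>s. A v s + \<B> w s)"
    proof -
      have "AE s in Leb1 a b. \<forall>i\<in>{..N}. wderivs a b i (u t) s = R_op a b N B i v s"
        using XB_R_op[OF wp u_XB[OF \<open>t \<ge> 0\<close>]] by (intro AE_finite_allI) (auto simp: L2_eq_def v_def)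
      moreover have "L2_eq a b (\<B> w)
          (\<lambda>s. \<Sum>i<N. \<Sum>j\<le>i. \<beta> i j s * R_op a b N B i v s * R_op a b N B j v s)"
        unfolding \<B>_def w_def by (intro B_op_diagonal v R_kernels)
      ultimately show ?thesis
        using d_eq
        unfolding L2_eq_def
      proof eventually_elim
        case (elim s)
        have "(\<Sum>i<N. \<Sum>j\<le>i. \<beta> i j s * wderivs a b i (u t) s * wderivs a b j (u t) s)
          = (\<Sum>i<N. \<Sum>j\<le>i. \<beta> i j s * R_op a b N B i v s * R_op a b N B j v s)"
          using elim(1) by (intro sum.cong refl) auto
        then show ?case
          using elim by (simp add: A_def A_op_def mult_op_def)
      qed
    qed
    \<comment> \<open>Products of \<open>L\<^sub>2\<close> functions are in general only integrable; the equation gives more.\<close>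
    have Bw: "\<B> w \<in> ?L"
    proof (rule L2_eq_in_L2[OF L2_diff[OF dL Av]])
      show "L2_eq a b (\<lambda>s. d s - A v s) (\<B> w)"
        using split unfolding L2_eq_def by (rule eventually_mono) simp
    qed
    have Pu: "?ip (P (u t)) f = ?ip (T v) (P f)" if "f \<in> ?L" for f
    proof -
      have "?ip (P (u t)) f = ?ip (u t) (P f)"
        using P_ip u_L2 \<open>t \<ge> 0\<close> that by simp
      also have "\<dots> = ?ip (T v) (P f)"
        by (rule L2_inner_cong) (use u_L2 \<open>t \<ge> 0\<close> P_L2 that Tv L2_measurable L2_eq_refl in auto)
      finally show ?thesis .
    qed
    have linear: "2 * ?ip (P (u t)) (A v) \<le> - \<delta> * ?ip (u t) (u t)"
    proof -
      have PTv: "P (T v) \<in> ?L" and PAv: "P (A v) \<in> ?L"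
        using Tv Av P_L2 by auto
      \<comment> \<open>Moving \<open>T\<close> or \<open>A\<close> to the other side gives the two summands of the operator inequality.\<close>
      have "?ip (P (u t)) (A v) = ?ip v (L2_adjoint a b T (P (A v)))"
        using Pu[OF Av] T_adj v PAv by (simp add: adjoint_pair_def)
      moreover have "?ip (P (u t)) (A v) = ?ip v (L2_adjoint a b A (P (T v)))"
        using Pu[OF Av] P_ip[OF Tv(1) Av] L2_inner_commute[of a b "P (T v)" "A v"] A_adj v PTv
        by (simp add: adjoint_pair_def)
      moreover have "?ip v (\<lambda>s. L2_adjoint a b A (P (T v)) s + L2_adjoint a b T (P (A v)) s)
        = ?ip v (L2_adjoint a b A (P (T v))) + ?ip v (L2_adjoint a b T (P (A v)))"
        using T_adj A_adj v PTv PAv by (intro L2_inner_add_right) (auto simp: adjoint_pair_def)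
      moreover have "?ip v (\<lambda>s. L2_adjoint a b A (P (T v)) s + L2_adjoint a b T (P (A v)) s)
        \<le> ?ip v (\<lambda>s. - \<delta> * L2_adjoint a b T (T v) s)"
        using assms(17) v by (simp add: op_le_def)
      moreover have "?ip v (\<lambda>s. - \<delta> * L2_adjoint a b T (T v) s) = - \<delta> * ?ip (T v) (T v)"
        using T_adj v Tv unfolding L2_inner_cmult_right by (simp add: adjoint_pair_def)
      moreover have "?ip (T v) (T v) = ?ip (u t) (u t)"
        by (rule L2_inner_cong) (use Tv L2_eq_sym L2_measurable in auto)
      ultimately show ?thesis
        by simp
    qed
    have quadratic: "?ip (P (u t)) (\<B> w) = 0"
    proof -
      have wL: "(\<lambda>(\<theta>, \<eta>). w \<theta> \<eta>) \<in> L2 (Leb2 a b)"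
        unfolding w_def by (intro L2_tensor pair_sigma_finite_Leb1 v)
      have "?ip (P (u t)) (\<B> w) = ?ip v (L2_adjoint a b T (P (\<B> w)))"
        using Pu[OF Bw] T_adj v P_L2[OF Bw] by (simp add: adjoint_pair_def)
      also have "\<dots> = ?ip v (PI22 a b G1 G2 G3 w)"
      proof (rule L2_inner_cong)
        show "L2_eq a b (L2_adjoint a b T (P (\<B> w))) (PI22 a b G1 G2 G3 w)"
          using G_kernels wL by (simp add: has_Pi22_kernels_def)
      qed (use T_adj v P_L2[OF Bw] L2_eq_refl in \<open>auto simp: adjoint_pair_def intro: L2_measurable\<close>)
      also have "\<dots> = Klin a b G1 G2 G3 (\<lambda>s \<theta> \<eta>. v s * (v \<theta> * v \<eta>))"
        unfolding w_def using G_kernels by (intro PI22_diagonal_inner_eq_Klin v) (auto simp: has_Pi22_kernels_def)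
      also have "\<dots> = 0"
        by (rule assms(19)) (rule L2_cube[OF v])
      finally show ?thesis .
    qed
    have "?ip (P (u t)) d = ?ip (P (u t)) (\<lambda>s. A v s + \<B> w s)"
      by (rule L2_inner_cong) (use split dL P_L2 u_L2 \<open>t \<ge> 0\<close> L2_measurable L2_eq_refl in auto)
    also have "\<dots> = ?ip (P (u t)) (A v) + ?ip (P (u t)) (\<B> w)"
      by (intro L2_inner_add_right Av Bw P_L2 u_L2 \<open>t \<ge> 0\<close>)
    finally have "2 * ?ip (P (u t)) d \<le> - \<delta> * ?ip (u t) (u t)"
      using linear quadratic by simp
    also have "\<dots> \<le> - (\<delta> / \<mu>) * V t"
    proof -
      have "V t / \<mu> \<le> ?ip (u t) (u t)"
        using upper[OF u_L2[OF \<open>t \<ge> 0\<close>]] \<open>\<mu> > 0\<close> by (simp add: V_def pos_divide_le_eq mult.commute)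
      from mult_left_mono[OF this, of \<delta>] show ?thesis
        using \<open>\<delta> > 0\<close> by simp
    qed
    finally show ?thesis
      using quadratic_form_has_derivative[OF P_sym C u_L2 d \<open>t \<ge> 0\<close>] by (auto simp: V_def[abs_def])
  qed
  then obtain V' where V': "\<And>t. t \<ge> 0 \<Longrightarrow> (V has_real_derivative V' t) (at t within {0..})"
    "\<And>t. t \<ge> 0 \<Longrightarrow> V' t \<le> - (\<delta> / \<mu>) * V t"
    by metis
  fix t :: real assume "t \<ge> 0"
  have "\<epsilon> * ?ip (u t) (u t) \<le> V t"
    using lower u_L2 \<open>t \<ge> 0\<close> by (simp add: V_def)
  also have "\<dots> \<le> V 0 * exp (- (\<delta> / \<mu>) * t)"
    using exponential_decay[OF V' \<open>t \<ge> 0\<close>] .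
  also have "\<dots> \<le> (\<mu> * ?ip (u 0) (u 0)) * exp (- (\<delta> / \<mu>) * t)"
    using upper[OF u_L2[of 0]] by (intro mult_right_mono) (simp_all add: V_def)
  finally show "(L2_norm a b (u t))\<^sup>2 \<le> \<mu> / \<epsilon> * (L2_norm a b (u 0))\<^sup>2 * exp (- (\<delta> / \<mu>) * t)"
    using \<open>\<epsilon> > 0\<close> by (simp add: L2_norm_sq field_simps)
qed

end
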